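(* Let $m,m'\in\mathbb Z\setminus\{0\}$, $\xi\in\mathbb Z_m$, $\xi'\in\mathbb Z_{m'}$. Then $\overline{BS}(m,\xi)$ and $\overline{BS}(m',\xi')$ are isomorphic as abstract groups if and only if there exist $\epsilon\in\{1,-1\}$ and a positive integer $d$ such that $m=\epsilon m'$, $d=\gcd(m,\xi)=\gcd(m',\xi')$, and the $m$-adic integers $\xi/d$ and $\epsilon\xi'/d$ have the same image under the canonical map $\mathbb Z_m\to\mathbb Z_{m/d}$. (Equivalently, for $m,m'>0$: $\widetilde{BS}(m,\xi)\cong\widetilde{BS}(m',\xi')$ iff $m=m'$ and $r_i(\xi)=r_i(\xi')$ for all $i\ge1$.)
   Context: $\mathbb Z_m$ is the ring of $m$-adic integers (note $\mathbb Z_m=\mathbb Z_{-m}$). For $n\in\mathbb Z,\xi\in\mathbb Z_m$, $\gcd(n,\xi)$ is the positive integer $d$ with $n\mathbb Z_m+\xi\mathbb Z_m=d\mathbb Z_m$; $\xi/d$ is well defined. For $p,q\in\mathbb Z\setminus\{0\}$, $BS(p,q)=\langle a,b\mid ab^pa^{-1}=b^q\rangle$, marked by $(a,b)$. $\mathcal G_2$ is the space of normal subgroups of $\mathbb F(a,b)$ with the ultrametric $d(N_1,N_2)=e^{-\lambda}$, $\lambda$ the minimal word length of an element of $N_1\triangle N_2$. $\overline{BS}(m,\xi)$ is the limit in $\mathcal G_2$ of $BS(m,\xi_n)$ for any sequence of integers $(\xi_n)$ with $|\xi_n|\to\infty$, $\xi_n\to\xi$ in $\mathbb Z_m$ (exists,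 independent of the sequence). The functions $r_i$: $r_0(\xi)=0$, $s_0(\xi)=1$, and for $i\ge1$, $r_i(\xi)\in\{0,\dots,|m|-1\}$, $s_i(\xi)\in\mathbb Z_m$ unique with $\xi s_{i-1}(\xi)=ms_i(\xi)+r_i(\xi)$. $\widetilde{BS}(m,\xi)=\langle E,a\mid axa^{-1}=\phi(x)\ \forall x\in E_{m,\xi}\rangle$ where $E$ is free abelian on $e_0,e_1,\dots$, $E_{m,\xi}$ has basis $me_0,\ e_i-r_i(\xi)e_0$ ($i\ge1$), and $\phi(me_0)=e_1$, $\phi(e_i-r_i(\xi)e_0)=e_{i+1}$. *)

theory Defs
  imports "HOL-Algebra.Algebra"
begin

text \<open>The ring of m-adic integers Z_m = lim Z/|m|^j Z, represented as compatible
sequences of residues x j in [0, |m|^j).  Note Z_m = Z_{-m} literally.\<close>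

definition Zadic :: "int \<Rightarrow> (nat \<Rightarrow> int) set" where
  "Zadic m = {x. \<forall>j. 0 \<le> x j \<and> x j < \<bar>m\<bar> ^ j \<and> x (Suc j) mod (\<bar>m\<bar> ^ j) = x j}"

definition adic_of_int :: "int \<Rightarrow> int \<Rightarrow> (nat \<Rightarrow> int)" where
  "adic_of_int m k = (\<lambda>j. k mod (\<bar>m\<bar> ^ j))"

definition adic_add :: "int \<Rightarrow> (nat \<Rightarrow> int) \<Rightarrow> (nat \<Rightarrow> int) \<Rightarrow> (nat \<Rightarrow> int)" where
  "adic_add m x y = (\<lambda>j. (x j + y j) mod (\<bar>m\<bar> ^ j))"

definition adic_mul :: "int \<Rightarrow> (nat \<Rightarrow> int) \<Rightarrow> (nat \<Rightarrow> int) \<Rightarrow> (nat \<Rightarrow> int)" where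
  "adic_mul m x y = (\<lambda>j. (x j * y j) mod (\<bar>m\<bar> ^ j))"

definition adic_smul :: "int \<Rightarrow> int \<Rightarrow> (nat \<Rightarrow> int) \<Rightarrow> (nat \<Rightarrow> int)" where
  "adic_smul m c x = adic_mul m (adic_of_int m c) x"

definition adic_gcd :: "int \<Rightarrow> int \<Rightarrow> (nat \<Rightarrow> int) \<Rightarrow> int" where
  "adic_gcd m n \<xi> = (THE d. d > 0 \<and> d dvd n \<and>
     {adic_add m (adic_smul m n x) (adic_mul m \<xi> y) | x y. x \<in> Zadic m \<and> y \<in> Zadic m}
     = {adic_smul m d z | z. z \<in> Zadic m})"

definition adic_div :: "int \<Rightarrow> (nat \<Rightarrow> int) \<Rightarrow> int \<Rightarrow> (nat \<Rightarrow> int)" where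
  "adic_div m \<xi> d = (THE \<eta>. \<eta> \<in> Zadic m \<and> adic_smul m d \<eta> = \<xi>)"

text \<open>Canonical map Z_m \<rightarrow> Z_k for k dividing m: reduce the level-j residue mod |k|^j.\<close>
definition adic_proj :: "int \<Rightarrow> (nat \<Rightarrow> int) \<Rightarrow> (nat \<Rightarrow> int)" where
  "adic_proj k x = (\<lambda>j. x j mod (\<bar>k\<bar> ^ j))"

definition adic_tendsto :: "int \<Rightarrow> (nat \<Rightarrow> int) \<Rightarrow> (nat \<Rightarrow> int) \<Rightarrow> bool" where
  "adic_tendsto m s \<xi> = (\<forall>j. \<exists>n0. \<forall>n\<ge>n0. s n mod (\<bar>m\<bar> ^ j) = \<xi> j)"

text \<open>Letters: (generator, inverted); generator False = a, True = b.\<close>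
type_synonym letter = "bool \<times> bool"

definition inv_letter :: "letter \<Rightarrow> letter" where
  "inv_letter l = (fst l, \<not> snd l)"

fun reduced :: "letter list \<Rightarrow> bool" where
  "reduced [] = True"
| "reduced [x] = True"
| "reduced (x # y # w) = (y \<noteq> inv_letter x \<and> reduced (y # w))"

definition cons_red :: "letter \<Rightarrow> letter list \<Rightarrow> letter list" where
  "cons_red l w = (case w of [] \<Rightarrow> [l] | h # t \<Rightarrow> (if h = inv_letter l then t else l # w))"

definition reduce :: "letter list \<Rightarrow> letter list" where
  "reduce w = foldr cons_red w []"

definition FG :: "letter list monoid" where
  "FG = \<lparr>carrier = {w. reduced w}, monoid.mult = (\<lambda>x y. reduce (x @ y)), monoid.one = []\<rparr>"

definition gen_a :: "letter list" where "gen_a = [(False, False)]"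
definition gen_b :: "letter list" where "gen_b = [(True, False)]"

definition BS_rel :: "int \<Rightarrow> int \<Rightarrow> letter list" where
  "BS_rel p q = gen_a \<otimes>\<^bsub>FG\<^esub> (gen_b [^]\<^bsub>FG\<^esub> p) \<otimes>\<^bsub>FG\<^esub> inv\<^bsub>FG\<^esub> gen_a
                \<otimes>\<^bsub>FG\<^esub> inv\<^bsub>FG\<^esub> (gen_b [^]\<^bsub>FG\<^esub> q)"

text \<open>The kernel of F(a,b) \<rightarrow> BS(p,q): normal closure of the relator.\<close>
definition BSN :: "int \<Rightarrow> int \<Rightarrow> letter list set" where
  "BSN p q = \<Inter> {N. N \<lhd> FG \<and> BS_rel p q \<in> N}"

text \<open>Convergence in the space G_2 (ultrametric d = e^-lambda, lambda = minimal length
of a reduced word in the symmetric difference).\<close>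
definition G2_tendsto :: "(nat \<Rightarrow> letter list set) \<Rightarrow> letter list set \<Rightarrow> bool" where
  "G2_tendsto Ns N = (\<forall>L::nat. \<exists>n0. \<forall>n\<ge>n0. \<forall>w \<in> carrier FG.
      length w \<le> L \<longrightarrow> (w \<in> Ns n \<longleftrightarrow> w \<in> N))"

definition BSbar :: "int \<Rightarrow> (nat \<Rightarrow> int) \<Rightarrow> letter list set" where
  "BSbar m \<xi> = (THE N. N \<lhd> FG \<and>
     (\<forall>s :: nat \<Rightarrow> int. filterlim (\<lambda>n. \<bar>s n\<bar>) at_top sequentially \<and> adic_tendsto m s \<xi>
        \<longrightarrow> G2_tendsto (\<lambda>n. BSN m (s n)) N))"

end

theory Submission
  imports Defs "HOL-Computational_Algebra.Polynomial"
begin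

text \<open>For \<open>m > 0\<close> the limit group is the HNN extension of \<open>E = \<int>[X]\<close> (with \<open>e\<^sub>i = X\<^sup>i\<close>) by
\<open>\<phi> : E\<^bsub>m,\<xi>\<^esub> \<rightarrow> X\<int>[X]\<close>: the normal forms of \<open>BS(m,\<xi>\<^sub>n)\<close> are eventually the images of those of
this extension under \<open>e\<^sub>0 \<mapsto> 1\<close>, \<open>e\<^sub>i \<mapsto> \<xi>\<^sub>n s\<^bsub>i-1\<^esub>(\<xi>\<^sub>n)\<close>.  So the limit only depends on \<open>m\<close> and the
digits \<open>r\<^sub>i\<close>, and comparing digits is elementary arithmetic.

Conversely let \<open>f\<close> be an isomorphism between two such groups.  In the Bass-Serre tree of the target,
with its height function coming from the exponent sum of \<open>a\<close>, the element \<open>f(b)\<close> preserves heights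
and fixes a vertex, because \<open>f(a b\<^sup>m a\<^sup>-\<^sup>1)\<close> commutes with it.  After conjugation \<open>f(b)\<close> lies in \<open>E'\<close>;
as \<open>E\<close> is the centralizer of \<open>b\<close> for \<open>m \<ge> 2\<close>, \<open>f\<close> maps \<open>E\<close> onto \<open>E'\<close>.  Conjugation by an
element of height \<open>h\<close> acts on \<open>E'\<close> as a partial power \<open>\<phi>'\<^sup>h\<close>, which raises degrees by \<open>h\<close>.
Surjectivity forces \<open>f(e\<^sub>0) = \<plusminus> e\<^sub>0\<close> and \<open>f \<phi> = \<phi>' f\<close>, and then \<open>m\<close> and all \<open>r\<^sub>i\<close> can be read off.
The case \<open>m = 1\<close> is the one where elements of height zero commute.\<close>

section \<open>Reduced words\<close>

text \<open>No presentation of the limit group is used. Left multiplication by \<open>a\<close> and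
  \<open>b\<close> is written as operators on states (list, element of \<open>E\<close>); the groups
  studied are the permutation groups which these generate. A state decides the word problem, and its
  list is a vertex of the Bass-Serre tree. A single word involves only finitely many choices of
  representatives, and each of them agrees with the choice made in the approximating group from some
  index on; this is why the comparison is stated with "eventually". That the limit acts freely on
  normal forms is then inherited from the normality of the approximating subgroups. The obstacle for
  the converse is that an abstract isomorphism knows neither the generators nor the height: both
  have to be recovered from commutation. For \<open>m = 1\<close> the map \<phi> is defined on all
  of \<open>E\<close>, so \<open>b\<close> fixes an edge and its centralizer is larger than
  \<open>E\<close>; hence this case needs an invariant of its own.\<close>

lemma inv_letter_inv_letter [simp]: "inv_letter (inv_letter l) = l"
  by (simp add: inv_letter_def)

lemma reduced_ConsD: "reduced (l # w) \<Longrightarrow> reduced w"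
  by (cases w) auto

lemma reduced_cons_red: "reduced w \<Longrightarrow> reduced (cons_red l w)"
  by (cases w) (auto simp: cons_red_def dest: reduced_ConsD)

lemma cons_red_cancel: "reduced w \<Longrightarrow> cons_red l (cons_red (inv_letter l) w) = w"
  by (cases w rule: reduced.cases) (auto simp: cons_red_def)

lemma reduced_foldr_cons_red: "reduced v \<Longrightarrow> reduced (foldr cons_red w v)"
  by (induction w) (auto intro: reduced_cons_red)

lemma reduced_reduce: "reduced (reduce w)"
  by (simp add: reduce_def reduced_foldr_cons_red)

lemma reduce_id: "reduced w \<Longrightarrow> reduce w = w"
proof (induction w)
  case (Cons l w)
  then show ?case
    by (cases w) (auto simp: reduce_def cons_red_def dest: reduced_ConsD)
qed (simp add: reduce_def)

text \<open>The only case with content is a cancellation: if \<open>w\<close> starts with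
  \<open>inv_letter l\<close>, folding over \<open>w\<close> ends with
  \<open>cons_red (inv_letter l)\<close>, which \<open>cons_red l\<close> undoes. Associativity of
  the free group rests on this.\<close>

lemma foldr_cons_red:
  assumes "reduced v"
  shows "foldr cons_red (cons_red l w) v = cons_red l (foldr cons_red w v)"
proof (cases w)
  case (Cons h t)
  have "cons_red l (cons_red (inv_letter l) (foldr cons_red t v)) = foldr cons_red t v"
    by (simp add: assms cons_red_cancel reduced_foldr_cons_red)
  then show ?thesis using Cons by (auto simp: cons_red_def[of l "h # t"])
qed (simp add: cons_red_def)

lemma foldr_cons_red_reduce:
  assumes "reduced v"
  shows "foldr cons_red (reduce w) v = foldr cons_red w v"
  by (induction w) (simp_all add: reduce_def foldr_cons_red assms)

lemma reduce_append_left: "reduce (reduce u @ w) = reduce (u @ w)"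
  using foldr_cons_red_reduce[OF reduced_reduce[of w, unfolded reduce_def], of u]
  by (simp add: reduce_def)

lemma reduce_append_right: "reduce (u @ reduce w) = reduce (u @ w)"
  using reduce_id[OF reduced_reduce, of w] by (simp add: reduce_def)

definition word_inv :: "letter list \<Rightarrow> letter list" where
  "word_inv w = map inv_letter (rev w)"

lemma foldr_cons_red_word_inv:
  "reduced v \<Longrightarrow> foldr cons_red (word_inv w) (foldr cons_red w v) = v"
proof (induction w)
  case (Cons l w)
  have "cons_red (inv_letter l) (cons_red l (foldr cons_red w v)) = foldr cons_red w v"
    using cons_red_cancel[OF reduced_foldr_cons_red[OF Cons.prems], of "inv_letter l"] by simp
  then show ?case using Cons by (simp add: word_inv_def)
qed (simp add: word_inv_def)

lemma reduce_word_inv: "reduce (word_inv w @ w) = []"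
  using foldr_cons_red_word_inv[of "[]" w] by (simp add: reduce_def)

lemma carrier_FG [simp]: "w \<in> carrier FG \<longleftrightarrow> reduced w"
  and mult_FG [simp]: "u \<otimes>\<^bsub>FG\<^esub> w = reduce (u @ w)"
  and one_FG [simp]: "\<one>\<^bsub>FG\<^esub> = []"
  by (simp_all add: FG_def)

lemma group_FG: "group FG"
proof (rule groupI)
  fix x assume "x \<in> carrier FG"
  show "\<exists>y\<in>carrier FG. y \<otimes>\<^bsub>FG\<^esub> x = \<one>\<^bsub>FG\<^esub>"
    by (rule bexI[of _ "reduce (word_inv x)"])
      (simp_all add: reduced_reduce reduce_append_left reduce_word_inv)
qed (simp_all add: reduced_reduce reduce_append_left reduce_append_right reduce_id)

interpretation FG: group FG by (rule group_FG)

section \<open>Groups of permutations generated by letters\<close>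

definition word_act :: "(letter \<Rightarrow> 's \<Rightarrow> 's) \<Rightarrow> letter list \<Rightarrow> 's \<Rightarrow> 's" where
  "word_act T w = foldr (\<lambda>l g. T l \<circ> g) w id"

lemma word_act_simps [simp]:
  "word_act T [] = id"
  "word_act T (l # w) = T l \<circ> word_act T w"
  by (simp_all add: word_act_def)

lemma word_act_append: "word_act T (u @ w) = word_act T u \<circ> word_act T w"
  by (induction u) (simp_all add: comp_assoc)

text \<open>The range runs over all words, reduced or not, so that closure under composition is
  concatenation.\<close>

definition act_group :: "(letter \<Rightarrow> 's \<Rightarrow> 's) \<Rightarrow> ('s \<Rightarrow> 's) monoid" where
  "act_group T = \<lparr>carrier = range (word_act T), monoid.mult = (\<circ>), monoid.one = id\<rparr>"

lemma act_group_simps [simp]: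
  "carrier (act_group T) = range (word_act T)"
  "g \<otimes>\<^bsub>act_group T\<^esub> h = g \<circ> h"
  "\<one>\<^bsub>act_group T\<^esub> = id"
  by (simp_all add: act_group_def)

locale letter_act =
  fixes T :: "letter \<Rightarrow> 's \<Rightarrow> 's"
  assumes T_inv: "T l (T (inv_letter l) s) = s"
begin

lemma word_act_cons_red: "word_act T (cons_red l w) = T l \<circ> word_act T w"
  by (cases w) (auto simp: cons_red_def T_inv)

lemma word_act_reduce: "word_act T (reduce w) = word_act T w"
  by (induction w) (auto simp: reduce_def word_act_cons_red)

lemma word_act_inv: "word_act T (word_inv w) \<circ> word_act T w = id"
proof (induction w)
  case (Cons l w)
  have "T (inv_letter l) (T l s) = s" for s using T_inv[of "inv_letter l"] by simp
  then show ?case using Cons by (auto simp: word_inv_def word_act_append fun_eq_iff)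
qed (simp add: word_inv_def)

lemma group_act_group: "group (act_group T)"
proof (rule groupI)
  fix x y assume "x \<in> carrier (act_group T)" "y \<in> carrier (act_group T)"
  then obtain u w where "x = word_act T u" "y = word_act T w" by auto
  then show "x \<otimes>\<^bsub>act_group T\<^esub> y \<in> carrier (act_group T)"
    by (simp flip: word_act_append)
next
  show "\<one>\<^bsub>act_group T\<^esub> \<in> carrier (act_group T)"
    using word_act_simps(1)[of T] by (metis act_group_simps(1,3) rangeI)
next
  fix x assume "x \<in> carrier (act_group T)"
  then show "\<exists>y\<in>carrier (act_group T). y \<otimes>\<^bsub>act_group T\<^esub> x = \<one>\<^bsub>act_group T\<^esub>"
    using word_act_inv by auto
qed (auto simp: comp_assoc)

lemma group_hom_word_act: "group_hom FG (act_group T) (word_act T)"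
  by (rule group_hom.intro[OF group_FG group_act_group], unfold_locales)
    (auto simp: hom_def word_act_reduce word_act_append)

definition act_kernel :: "letter list set" where
  "act_kernel = {w. reduced w \<and> word_act T w = id}"

lemma act_kernel_eq: "act_kernel = kernel FG (act_group T) (word_act T)"
  by (simp add: act_kernel_def kernel_def)

lemma normal_act_kernel: "act_kernel \<lhd> FG"
  unfolding act_kernel_eq by (rule group_hom.normal_kernel[OF group_hom_word_act])

lemma FG_Mod_act_kernel: "FG Mod act_kernel \<cong> act_group T"
proof -
  have "word_act T ` carrier FG = carrier (act_group T)"
  proof -
    have "\<exists>u. reduced u \<and> word_act T w = word_act T u" for w
      using word_act_reduce[of w] reduced_reduce by metis
    then show ?thesis by (auto simp: image_iff Bex_def)
  qed
  then show ?thesis unfolding act_kernel_eq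
    by (rule group_hom.FactGroup_iso[OF group_hom_word_act])
qed

end

section \<open>Trees with a height function\<close>

text \<open>\<open>ht_adj\<close> rules out inversions: an automorphism that preserves heights
  cannot exchange the ends of an edge. Acyclicity follows in a second locale because it is stated
  through the walks \<open>nb\<close>, which are defined in this one.\<close>

locale height_tree =
  fixes V :: "'v set" and adj :: "'v \<Rightarrow> 'v \<Rightarrow> bool" and ht :: "'v \<Rightarrow> int"
  assumes adj_sym: "adj u v \<Longrightarrow> adj v u"
    and adj_V: "adj u v \<Longrightarrow> u \<in> V"
    and ht_adj: "adj u v \<Longrightarrow> ht u \<noteq> ht v"
    and connected: "u \<in> V \<Longrightarrow> v \<in> V \<Longrightarrow> adj\<^sup>*\<^sup>* u v"
begin

text \<open>Walks without backtracking.\<close>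

fun nb :: "'v list \<Rightarrow> bool" where
  "nb [] = False"
| "nb [u] = (u \<in> V)"
| "nb (u # v # p) = (adj u v \<and> nb (v # p) \<and> (p = [] \<or> hd p \<noteq> u))"

end

locale tree_with_height = height_tree V adj ht
  for V :: "'v set" and adj ht +
  assumes acyclic: "nb p \<Longrightarrow> hd p = last p \<Longrightarrow> length p = 1"
begin

section \<open>Geodesics in a tree\<close>

lemma nb_not_Nil: "nb p \<Longrightarrow> p \<noteq> []" by auto

lemma nb_ConsD: "nb (u # p) \<Longrightarrow> p \<noteq> [] \<Longrightarrow> nb p"
  by (cases p) auto

lemma nb_set: "nb p \<Longrightarrow> set p \<subseteq> V"
  by (induction p rule: nb.induct) (auto dest: adj_V adj_sym)

text \<open>\<open>nb\<close> only inspects three consecutive vertices, so two walks that share an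
  edge can be glued along it.\<close>

lemma nb_overlap: "nb (p @ u # v # q) \<longleftrightarrow> nb (p @ [u, v]) \<and> nb (u # v # q)"
proof (induction p)
  case Nil
  show ?case using adj_V adj_sym by auto
next
  case (Cons x p)
  then show ?case
    by (cases p; cases "tl p") (auto simp: adj_V)
qed

lemma nb_rev: "nb (rev p) \<longleftrightarrow> nb p"
proof -
  have "nb p \<Longrightarrow> nb (rev p)" for p
  proof (induction p rule: nb.induct)
    case (3 u v q)
    show ?case
    proof (cases q)
      case Nil
      then show ?thesis using 3 adj_sym adj_V by auto
    next
      case (Cons w q')
      have "nb (rev q' @ [w, v])" "nb [w, v, u]"
        using 3 Cons adj_sym adj_V by (auto split: if_splits)
      then show ?thesis using Cons nb_overlap[of "rev q'" w v "[u]"] by simp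
    qed
  qed auto
  from this[of p] this[of "rev p"] show ?thesis by auto
qed

lemma nb_join:
  assumes "nb p" "nb q" "last p = hd q"
    "length p \<ge> 2 \<Longrightarrow> length q \<ge> 2 \<Longrightarrow> last (butlast p) \<noteq> hd (tl q)"
  shows "nb (p @ tl q)"
proof -
  have q: "q = hd q # tl q" and p: "p = butlast p @ [last p]"
    using nb_not_Nil[OF assms(1)] nb_not_Nil[OF assms(2)] by simp_all
  show ?thesis
  proof (cases "tl q")
    case Nil
    then show ?thesis using assms by simp
  next
    case q': (Cons v q')
    show ?thesis
    proof (cases "butlast p" rule: rev_cases)
      case Nil
      then have "p @ tl q = q" using p q assms(3) by (metis append_Cons append_Nil)
      then show ?thesis using assms by simp
    next
      case (snoc p' x)
      have p2: "p = p' @ [x, hd q]" using p snoc assms(3) by simp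
      have ne: "x \<noteq> v" using assms(4) snoc q' p q by (metis (no_types, lifting) Nitpick.size_list_simp(2)
            One_nat_def Suc_le_mono append_is_Nil_conv last_snoc le0 length_append_singleton list.sel(1) list.simps(3) numeral_2_eq_2 length_greater_0_conv Suc_leI)
      have "adj x (hd q)" using assms(1) p2 nb_overlap[of p' x "hd q" "[]"] by simp
      then have "nb (x # hd q # v # q')" using assms(2) q q' ne by (metis list.sel(1) nb.simps(3))
      then have "nb (p' @ x # hd q # v # q')" using assms(1) p2 nb_overlap by blast
      then show ?thesis using p2 q' by simp
    qed
  qed
qed

text \<open>If the walks part at the second vertex, the reverse of \<open>p\<close> followed by
  \<open>q\<close> does not backtrack at the common start. It is closed because the last vertices
  agree, which contradicts \<open>acyclic\<close>.\<close>

lemma nb_unique: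
  assumes "nb p" "nb q" "hd p = hd q" "last p = last q"
  shows "p = q"
  using assms
proof (induction p arbitrary: q rule: nb.induct)
  case (2 u)
  then show ?case using acyclic[of q] by (cases q) auto
next
  case (3 u v p)
  obtain q' where q: "q = u # q'" using 3 by (cases q) auto
  show ?case
  proof (cases q')
    case Nil
    then show ?thesis using 3 acyclic[of "u # v # p"] q by auto
  next
    case (Cons w q'')
    show ?thesis
    proof (cases "v = w")
      case True
      then show ?thesis using 3(1)[of q'] 3(2-) q Cons by simp
    next
      case False
      have "nb (rev (u # v # p) @ tl q)"
        using 3 q Cons False nb_rev[of "u # v # p"]
        by (intro nb_join) (auto simp: butlast_append)
      moreover have "hd (rev (u # v # p) @ tl q) = last (u # v # p)"
        by (simp add: hd_append hd_rev)
      moreover have "last (rev (u # v # p) @ tl q) = last q" using q Cons by simp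
      ultimately show ?thesis using acyclic[of "rev (u # v # p) @ tl q"] 3 by simp
    qed
  qed
qed auto

definition geod :: "'v \<Rightarrow> 'v \<Rightarrow> 'v list" where
  "geod u v = (THE p. nb p \<and> hd p = u \<and> last p = v)"

lemma geodI: "nb p \<Longrightarrow> hd p = u \<Longrightarrow> last p = v \<Longrightarrow> geod u v = p"
  unfolding geod_def by (rule the_equality) (auto intro: nb_unique)

lemma nb_step:
  assumes "nb p" "adj u (hd p)"
  shows "nb (if tl p \<noteq> [] \<and> hd (tl p) = u then tl p else u # p)"
  using assms by (cases p rule: nb.cases) auto

lemma nb_exists:
  assumes "u \<in> V" "v \<in> V"
  shows "\<exists>p. nb p \<and> hd p = u \<and> last p = v"
  using connected[OF assms]
proof (induction rule: converse_rtranclp_induct)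
  case base
  show ?case by (rule exI[of _ "[v]"]) (use assms in auto)
next
  case (step u w)
  then obtain p where p: "nb p" "hd p = w" "last p = v" by auto
  from nb_step[OF p(1), of u] step p nb_not_Nil[OF p(1)]
  show ?case by (intro exI[of _ "if tl p \<noteq> [] \<and> hd (tl p) = u then tl p else u # p"])
      (auto simp: last_tl)
qed

lemma geod:
  assumes "u \<in> V" "v \<in> V"
  shows "nb (geod u v)" "hd (geod u v) = u" "last (geod u v) = v" "geod u v \<noteq> []"
proof -
  obtain p where "nb p" "hd p = u" "last p = v" using nb_exists[OF assms] by auto
  then show "nb (geod u v)" "hd (geod u v) = u" "last (geod u v) = v" "geod u v \<noteq> []"
    using geodI[of p u v] by auto
qed

lemma geod_rev: "u \<in> V \<Longrightarrow> v \<in> V \<Longrightarrow> geod v u = rev (geod u v)"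
  by (rule geodI) (auto simp: nb_rev geod hd_rev last_rev)

lemma geod_self: "u \<in> V \<Longrightarrow> geod u u = [u]"
  by (rule geodI) auto

lemma geod_step:
  assumes "adj u w" "v \<in> V"
  shows "geod u v = (if tl (geod w v) \<noteq> [] \<and> hd (tl (geod w v)) = u then tl (geod w v)
    else u # geod w v)"
proof -
  have w: "w \<in> V" using assms adj_sym adj_V by blast
  note g = geod[OF w assms(2)]
  show ?thesis
    by (rule geodI[OF nb_step]) (use g assms in \<open>auto simp: last_tl\<close>)
qed

lemma length_geod_step_left:
  assumes "adj u w" "v \<in> V"
  shows "length (geod u v) \<le> Suc (length (geod w v))"
  using geod_step[OF assms] by auto

lemma length_geod_step_right:
  assumes "adj u w" "v \<in> V"
  shows "length (geod v u) \<le> Suc (length (geod v w))"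
  using length_geod_step_left[OF assms] assms adj_V adj_sym geod_rev[of v u] geod_rev[of v w]
  by (metis length_rev)

lemma set_geod_step_left:
  assumes "adj u w" "v \<in> V"
  shows "set (geod u v) \<subseteq> insert u (set (geod w v))"
  using geod_step[OF assms] by (cases "geod w v") (auto split: if_splits)

lemma set_geod_step_right:
  assumes "adj u w" "v \<in> V"
  shows "set (geod v u) \<subseteq> insert u (set (geod v w))"
  using set_geod_step_left[OF assms] assms adj_V adj_sym geod_rev[of v u] geod_rev[of v w]
  by (metis set_rev)

text \<open>By \<open>geod_step\<close>, moving the start along one edge removes or adds a single
  vertex at the front, so fewer than \<open>length p\<close> steps cannot reach
  \<open>z\<close>.\<close>

lemma geod_move_start:
  assumes "nb (w # ws)" "v \<in> V" "geod w v = p @ z # q" "length ws < length p"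
  shows "\<exists>p'. geod (last (w # ws)) v = p' @ z # q \<and> length p' + length ws \<ge> length p"
  using assms
proof (induction ws arbitrary: w p)
  case (Cons w' ws)
  have a: "adj w' w" using Cons.prems(1) adj_sym by auto
  have nb: "nb (w' # ws)" using Cons.prems(1) by auto
  obtain p0 where p: "p = w # p0" using Cons.prems geod(2)[of w v] nb_set[OF Cons.prems(1)]
    by (cases p) auto
  define p1 where "p1 = (if p0 @ [z] \<noteq> [] \<and> hd (p0 @ [z]) = w' then p0 else w' # p)"
  have tl: "tl (geod w v) = (p0 @ [z]) @ q" using Cons.prems(3) p by simp
  have wp: "geod w v = p @ z # q" by fact
  have "geod w' v = p1 @ z # q"
    using geod_step[OF a Cons.prems(2)] unfolding tl p1_def
    by (cases p0) (auto simp: wp)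
  moreover have "length ws < length p1" "length p1 + 1 \<ge> length p"
    using Cons.prems p by (auto simp: p1_def)
  ultimately show ?case using Cons.IH[OF nb Cons.prems(2)] by fastforce
qed auto

text \<open>The two ends are moved one after the other, the second one after reversal.
  \<open>length\<close> counts vertices, so the number of steps is strictly below
  \<open>length p\<close> and \<open>length q\<close>.\<close>

lemma geod_middle:
  assumes V: "u \<in> V" "v \<in> V" "u' \<in> V" "v' \<in> V"
    and g: "geod u v = p @ z # q"
    and u: "length (geod u u') \<le> length p" and v: "length (geod v v') \<le> length q"
  shows "z \<in> set (geod u' v')"
proof -
  have move: "\<exists>p'. geod w' v = p' @ z # q"
    if h: "w \<in> V" "w' \<in> V" "v \<in> V" "geod w v = p @ z # q" "length (geod w w') \<le> length p"
    for w w' v p q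
  proof -
    obtain ws where ws: "geod w w' = w # ws"
      using geod[OF h(1,2)] by (cases "geod w w'") auto
    show ?thesis
      using geod_move_start[of w ws v p z q] h geod[OF h(1,2)] ws by fastforce
  qed
  obtain p' where p': "geod u' v = p' @ z # q" using move[OF V(1,3,2) g u] by blast
  have "geod v u' = rev q @ z # rev p'" using p' geod_rev[of u' v] V by simp
  from move[OF V(2,4,3) this] v obtain q' where "geod v' u' = q' @ z # rev p'" by auto
  then have "z \<in> set (geod v' u')" by simp
  then show ?thesis using geod_rev[of u' v'] V by simp
qed

section \<open>Automorphisms and their axes\<close>

text \<open>The integer is the shift of height. Injectivity keeps images of walks free of
  backtracking, so geodesics go to geodesics.\<close>

definition aut :: "('v \<Rightarrow> 'v) \<Rightarrow> int \<Rightarrow> bool" where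
  "aut x c \<longleftrightarrow> (\<forall>u v. adj u v \<longrightarrow> adj (x u) (x v)) \<and> inj_on x V \<and> x ` V \<subseteq> V \<and>
    (\<forall>u\<in>V. ht (x u) = ht u + c)"

lemma aut_nb:
  assumes "aut x c" "nb p"
  shows "nb (map x p)"
  using assms(2)
proof (induction p rule: nb.induct)
  case (3 u v p)
  have "p \<noteq> [] \<Longrightarrow> x (hd p) \<noteq> x u"
    using 3 assms(1) nb_set[of "u # v # p"] by (cases p) (auto simp: aut_def inj_on_def)
  then show ?case using 3 assms(1) by (auto simp: aut_def hd_map)
qed (use assms in \<open>auto simp: aut_def\<close>)

lemma aut_V: "aut x c \<Longrightarrow> u \<in> V \<Longrightarrow> x u \<in> V"
  by (auto simp: aut_def)

lemma aut_ht: "aut x c \<Longrightarrow> u \<in> V \<Longrightarrow> ht (x u) = ht u + c"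
  by (auto simp: aut_def)

lemma aut_geod: "aut x c \<Longrightarrow> u \<in> V \<Longrightarrow> v \<in> V \<Longrightarrow> geod (x u) (x v) = map x (geod u v)"
  by (rule geodI) (auto simp: aut_nb geod hd_map last_map)

lemma aut_funpow: "aut x c \<Longrightarrow> aut (x ^^ k) (int k * c)"
proof (induction k)
  case (Suc k)
  then have x: "aut x c" and k: "aut (x ^^ k) (int k * c)" by auto
  have "inj_on (x \<circ> x ^^ k) V"
    by (rule comp_inj_on) (use x k in \<open>auto simp: aut_def intro: inj_on_subset\<close>)
  moreover have "ht (x ((x ^^ k) u)) = ht u + int (Suc k) * c" if "u \<in> V" for u
    using aut_ht[OF k that] aut_ht[OF x aut_V[OF k that]] by (simp add: algebra_simps)
  ultimately show ?case
    using x k aut_V[OF x] aut_V[OF k] unfolding aut_def by auto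
qed (auto simp: aut_def)

text \<open>Vertices of least displacement: the fixed vertices if there are any, otherwise (for
  height shift 0) the translation axis.\<close>

definition axis :: "('v \<Rightarrow> 'v) \<Rightarrow> 'v set" where
  "axis x = {u \<in> V. \<forall>w\<in>V. length (geod u (x u)) \<le> length (geod w (x w))}"

lemma axis_V: "u \<in> axis x \<Longrightarrow> u \<in> V" by (simp add: axis_def)

lemma axis_nonempty:
  assumes "V \<noteq> {}" shows "\<exists>u. u \<in> axis x"
proof -
  obtain u where "u \<in> V" "\<forall>w\<in>V. length (geod u (x u)) \<le> length (geod w (x w))"
    using ex_has_least_nat[of "\<lambda>u. u \<in> V" _ "\<lambda>u. length (geod u (x u))"] assms
    by (metis all_not_in_conv)
  then show ?thesis by (auto simp: axis_def)
qed

text \<open>\<open>y\<close> carries the geodesic from \<open>u\<close> to \<open>x u\<close> onto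
  the one from \<open>y u\<close> to \<open>x (y u)\<close>, so both vertices are moved equally
  far.\<close>

lemma axis_commute:
  assumes x: "aut x c" and y: "aut y d" and comm: "\<And>u. u \<in> V \<Longrightarrow> y (x u) = x (y u)"
    and u: "u \<in> axis x"
  shows "y u \<in> axis x"
proof -
  have "u \<in> V" using u axis_V by blast
  then have "geod (y u) (x (y u)) = map y (geod u (x u))"
    using aut_geod[OF y, of u "x u"] comm[of u] aut_V[OF x] by simp
  then show ?thesis using u aut_V[OF y] by (auto simp: axis_def)
qed

end

locale hyperbolic = tree_with_height V adj ht
  for V :: "'v set" and adj ht +
  fixes x
  assumes aut: "aut x 0" and no_fix: "u \<in> V \<Longrightarrow> x u \<noteq> u"
begin

lemma length_geod_ge2: "u \<in> V \<Longrightarrow> length (geod u (x u)) \<ge> 2"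
  using geod[of u "x u"] no_fix[of u] aut_V[OF aut, of u]
  by (cases "geod u (x u)" rule: nb.cases) auto

text \<open>If the geodesic from \<open>p\<close> to \<open>q\<close> left the axis at \<open>p\<close>, then following it back to \<open>p\<close>,
moving on to \<open>x p\<close> and then to \<open>x q\<close> would be a geodesic, and \<open>q\<close> would be moved further than \<open>p\<close>.\<close>

lemma axis_step:
  assumes p: "p \<in> axis x" and q: "q \<in> axis x" and g: "geod p q = p # p1 # rest"
  shows "p1 \<in> axis x \<and> ht ` set (geod p1 (x p1)) \<subseteq> ht ` set (geod p (x p))"
proof -
  let ?c = "geod p (x p)"
  have V: "p \<in> V" "x p \<in> V" "q \<in> V" "x q \<in> V" using p q axis_V aut_V[OF aut] by auto
  note gpq = geod[OF V(1,3)] and c = geod[OF V(1,2)]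
  have a: "adj p p1" using gpq g by simp
  have p1: "p1 \<in> V" using gpq(1) g nb_set[OF gpq(1)] by auto
  have xp1: "x p1 \<in> V" using p1 aut_V[OF aut] by auto
  have ax: "adj (x p) (x p1)" using a aut by (auto simp: aut_def)
  have l2: "length ?c \<ge> 2" using length_geod_ge2 V by blast
  then have c1: "?c = p # tl ?c" "tl ?c \<noteq> []" using c by (cases ?c; auto)+
  have c2: "butlast ?c \<noteq> []" "hd (butlast ?c) = p" using c1 by (metis butlast.simps(2) list.distinct(1), metis butlast.simps(2) list.sel(1))
  have nbt: "nb (tl ?c)" using c(1) c1 nb_ConsD by metis
  have nbb: "nb (butlast ?c)"
  proof -
    have "nb (rev ?c)" using c nb_rev by blast
    then have "nb (tl (rev ?c))" using c1 c2 nb_ConsD[of "hd (rev ?c)" "tl (rev ?c)"]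
      by (metis append_butlast_last_id list.sel(3) nb.simps(1) rev.simps(1) rev_append rev_rev_ident list.collapse rev_singleton_conv append_Cons append_Nil)
    then show ?thesis using nb_rev[of "butlast ?c"] by (metis butlast_rev rev_rev_ident)
  qed
  have "p1 = hd (tl ?c) \<or> x p1 = last (butlast ?c)"
  proof (rule ccontr)
    assume neg: "\<not> ?thesis"
    have nb1: "nb (rev (geod p q) @ tl ?c)"
    proof (rule nb_join)
      show "nb (rev (geod p q))" using gpq nb_rev by blast
      show "last (butlast (rev (geod p q))) \<noteq> hd (tl ?c)" using g neg by (simp add: butlast_append)
    qed (use gpq c in \<open>auto simp: last_rev\<close>)
    have bl: "butlast (rev (geod p q) @ tl ?c) \<noteq> []" using g c1 by (auto simp: butlast_append)
    have lb: "last (butlast (rev (geod p q) @ tl ?c)) = last (butlast ?c)"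
    proof -
      have "butlast (rev (geod p q) @ tl ?c) = rev (geod p q) @ butlast (tl ?c)"
        using c1 by (simp add: butlast_append)
      moreover have "butlast ?c = p # butlast (tl ?c)" using c1 by (metis butlast.simps(2))
      ultimately show ?thesis using g by (auto simp: last_append)
    qed
    have "nb ((rev (geod p q) @ tl ?c) @ tl (map x (geod p q)))"
    proof (rule nb_join[OF nb1])
      show "nb (map x (geod p q))" using aut_nb[OF aut gpq(1)] .
      show "last (rev (geod p q) @ tl ?c) = hd (map x (geod p q))"
        using g c1 c by (metis hd_map last_appendR last_tl list.discI gpq(2))
      show "last (butlast (rev (geod p q) @ tl ?c)) \<noteq> hd (tl (map x (geod p q)))"
        unfolding lb using g neg by auto
    qed
    then have "geod q (x q) = (rev (geod p q) @ tl ?c) @ tl (map x (geod p q))"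
    proof (rule geodI)
      show "hd ((rev (geod p q) @ tl ?c) @ tl (map x (geod p q))) = q"
        using gpq by (simp add: hd_append hd_rev)
      show "last ((rev (geod p q) @ tl ?c) @ tl (map x (geod p q))) = x q"
        using gpq(3) g by (auto simp: last_map split: if_splits)
    qed
    then have "length (geod q (x q)) > length ?c" using g l2 by simp
    then show False using q V(1) by (auto simp: axis_def)
  qed
  then show ?thesis
  proof
    \<comment> \<open>One vertex is dropped at the front of \<open>?c\<close> and at most
      \<open>x p1\<close> is added at the end; its height already occurs because \<open>p1\<close>
      lies on \<open>?c\<close>. The other case is symmetric.\<close>
    assume e: "p1 = hd (tl ?c)"
    have g1: "geod p1 (x p) = tl ?c" by (rule geodI) (use e c1 c nbt in \<open>auto simp: last_tl\<close>)
    have "length (geod p1 (x p1)) \<le> length ?c"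
      using length_geod_step_right[OF adj_sym[OF ax] p1] g1 l2 by simp
    moreover have "set (geod p1 (x p1)) \<subseteq> insert (x p1) (set (tl ?c))"
      using set_geod_step_right[OF adj_sym[OF ax] p1] g1 by simp
    moreover have "ht (x p1) = ht p1" "p1 \<in> set (tl ?c)"
      using aut_ht[OF aut p1] e c1 by auto
    moreover have "set (tl ?c) \<subseteq> set ?c" using c1 by (metis set_subset_Cons)
    ultimately have "ht ` set (geod p1 (x p1)) \<subseteq> ht ` set ?c" by fastforce
    moreover have "p1 \<in> axis x" using p p1 \<open>length (geod p1 (x p1)) \<le> length ?c\<close>
      unfolding axis_def by (auto intro: order_trans)
    ultimately show ?thesis by blast
  next
    assume e: "x p1 = last (butlast ?c)"
    have g1: "geod p (x p1) = butlast ?c" by (rule geodI) (use e c2 nbb in auto)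
    have "length (geod p1 (x p1)) \<le> length ?c"
      using length_geod_step_left[OF adj_sym[OF a] xp1] g1 l2 by simp
    moreover have "set (geod p1 (x p1)) \<subseteq> insert p1 (set (butlast ?c))"
      using set_geod_step_left[OF adj_sym[OF a] xp1] g1 by simp
    moreover have "ht (x p1) = ht p1" "x p1 \<in> set (butlast ?c)"
      using aut_ht[OF aut p1] e c2 by auto
    moreover have "set (butlast ?c) \<subseteq> set ?c" by (auto dest: in_set_butlastD)
    moreover have "ht p1 \<in> ht ` set ?c" using calculation by (metis image_eqI subsetD)
    ultimately have "ht ` set (geod p1 (x p1)) \<subseteq> ht ` set ?c" by blast
    moreover have "p1 \<in> axis x" using p p1 \<open>length (geod p1 (x p1)) \<le> length ?c\<close>
      unfolding axis_def by (auto intro: order_trans)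
    ultimately show ?thesis by blast
  qed
qed

text \<open>\<open>axis_step\<close> is iterated along the geodesic: the inclusions of height sets
  compose, and at the end \<open>q\<close> lies on its own segment from \<open>q\<close> to
  \<open>x q\<close>.\<close>

lemma axis_convex:
  assumes "p \<in> axis x" "q \<in> axis x"
  shows "set (geod p q) \<subseteq> axis x \<and> ht q \<in> ht ` set (geod p (x p))"
proof -
  have "set (geod p q) \<subseteq> axis x \<and> ht q \<in> ht ` set (geod p (x p))"
    if "p \<in> axis x" "geod p q = w" for p w
    using that
  proof (induction w arbitrary: p)
    case Nil
    then show ?case using geod[of p q] assms axis_V by metis
  next
    case (Cons p' w)
    have V: "p \<in> V" "q \<in> V" using Cons.prems assms axis_V by auto
    have pp: "p' = p" using geod[OF V] Cons.prems by simp
    show ?case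
    proof (cases w)
      case Nil
      then have "q = p" using geod[OF V] Cons.prems pp by simp
      moreover have "p \<in> set (geod p (x p))"
        using geod[OF V(1) aut_V[OF aut V(1)]] by (metis list.set_sel(1))
      ultimately show ?thesis using Cons.prems V by (auto simp: geod_self)
    next
      case (Cons p1 rest)
      have g: "geod p q = p # p1 # rest" using Cons Cons.prems pp by simp
      from axis_step[OF Cons.prems(1) assms(2) g]
      have p1: "p1 \<in> axis x" "ht ` set (geod p1 (x p1)) \<subseteq> ht ` set (geod p (x p))" by auto
      have "geod p1 q = w" by (rule geodI) (use geod[OF V] g Cons in auto)
      from Cons.IH[OF p1(1) this] p1(2) this Cons.prems pp show ?thesis by auto
    qed
  qed
  then show ?thesis using assms by blast
qed

text \<open>As far as heights are concerned, the segment from one axis point \<open>p\<close> to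
  \<open>x p\<close> already represents the whole axis.\<close>

lemma finite_axis_heights: "finite (ht ` axis x)"
proof (cases "axis x = {}")
  case False
  then obtain p where "p \<in> axis x" by auto
  then have "ht ` axis x \<subseteq> ht ` set (geod p (x p))" using axis_convex by blast
  then show ?thesis using finite_surj by blast
qed auto

text \<open>A backtrack between the segment and its translate would make the displacement of the
  second vertex \<open>u\<close> two edges shorter, against minimality. A segment of a single edge
  is excluded because its ends differ in height while \<open>x\<close> preserves heights.\<close>

lemma axis_no_backtrack:
  assumes "v \<in> axis x"
  shows "last (butlast (geod v (x v))) \<noteq> x (hd (tl (geod v (x v))))"
proof
  let ?c = "geod v (x v)"
  assume e: "last (butlast ?c) = x (hd (tl ?c))"
  have V: "v \<in> V" "x v \<in> V" using assms axis_V aut_V[OF aut] by auto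
  note c = geod[OF V]
  have "length ?c \<ge> 2" using length_geod_ge2 V by blast
  then obtain u c' where cc: "?c = v # u # c'" using c by (cases ?c rule: nb.cases) auto
  have a: "adj v u" and u: "u \<in> V" using c cc nb_set[OF c(1)] by auto
  show False
  proof (cases c' rule: rev_cases)
    case Nil
    then have "u = x v" using c cc by simp
    then show False using a ht_adj aut_ht[OF aut V(1)] by fastforce
  next
    case (snoc d z)
    have "nb (rev ?c)" using c nb_rev by blast
    then have "nb (z # rev (v # u # d))" using cc snoc by simp
    then have "nb (rev (v # u # d))" by (rule nb_ConsD) auto
    then have "nb (v # u # d)" using nb_rev by blast
    then have "nb (u # d)" by auto
    moreover have "x u = last (u # d)" using e cc snoc by (auto simp: butlast_append split: if_splits)
    ultimately have "geod u (x u) = u # d" by (intro geodI) auto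
    then have "length (geod u (x u)) < length ?c" using cc snoc by simp
    then show False using assms u by (auto simp: axis_def)
  qed
qed

text \<open>By \<open>axis_no_backtrack\<close> the translates of the segment from \<open>v\<close>
  to \<open>x v\<close> join to a geodesic, and each contributes at least one edge;
  \<open>tl\<close> removes the shared vertex.\<close>

lemma geod_funpow:
  assumes v: "v \<in> axis x"
  shows "geod v ((x ^^ (i + j)) v) = geod v ((x ^^ i) v) @ tl (map (x ^^ i) (geod v ((x ^^ j) v)))
    \<and> length (geod v ((x ^^ i) v)) > i"
proof -
  let ?c = "geod v (x v)"
  have V: "v \<in> V" "x v \<in> V" using assms axis_V aut_V[OF aut] by auto
  note c = geod[OF V]
  have Vk: "(x ^^ k) v \<in> V" for k using aut_V[OF aut_funpow[OF aut]] V by blast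
  obtain u c' where cc: "?c = v # u # c'" using c length_geod_ge2[OF V(1)] by (cases ?c rule: nb.cases) auto
  have geod_Suc: "geod v ((x ^^ Suc k) v) = ?c @ tl (map x (geod v ((x ^^ k) v))) \<and>
     (\<exists>c''. geod v ((x ^^ Suc k) v) = v # u # c'')" for k
  proof (induction k)
    case 0
    then show ?case using cc V by (simp add: geod_self)
  next
    case (Suc k)
    then obtain c'' where c'': "geod v ((x ^^ Suc k) v) = v # u # c''" by blast
    note gk = geod[OF V(1) Vk[of "Suc k"]]
    have "nb (?c @ tl (map x (geod v ((x ^^ Suc k) v))))"
      by (rule nb_join[OF c(1) aut_nb[OF aut gk(1)]])
        (use c c'' axis_no_backtrack[OF v] cc in auto)
    then have "geod v ((x ^^ Suc (Suc k)) v) = ?c @ tl (map x (geod v ((x ^^ Suc k) v)))"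
      by (rule geodI) (use c c'' cc gk in \<open>auto simp: last_map\<close>)
    then show ?case using cc by auto
  qed
  have "geod v ((x ^^ (i + j)) v) = geod v ((x ^^ i) v) @ tl (map (x ^^ i) (geod v ((x ^^ j) v)))"
  proof (induction i)
    case 0
    have "geod v ((x ^^ j) v) = v # tl (geod v ((x ^^ j) v))"
      using geod[OF V(1) Vk[of j]] by (metis list.collapse)
    then show ?case using V by (simp add: geod_self)
  next
    case (Suc i)
    have "geod v ((x ^^ i) v) \<noteq> []" using geod[OF V(1) Vk] by blast
    then have "geod v ((x ^^ (Suc i + j)) v) = geod v ((x ^^ Suc i) v) @ map x (tl (map (x ^^ i) (geod v ((x ^^ j) v))))"
      using Suc.IH geod_Suc[of "i + j"] geod_Suc[of i] by (simp add: map_tl)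
    then show ?case by (simp add: map_tl comp_def)
  qed
  moreover have "length (geod v ((x ^^ i) v)) > i"
  proof (induction i)
    case 0
    then show ?case using V by (simp add: geod_self)
  next
    case (Suc i)
    then show ?case using geod_Suc[of i] cc by simp
  qed
  ultimately show ?thesis by blast
qed

end

section \<open>Criteria for a fixed vertex\<close>

context tree_with_height
begin

lemma hyperbolicI: "aut x 0 \<Longrightarrow> \<not> (\<exists>u\<in>V. x u = u) \<Longrightarrow> hyperbolic V adj ht x"
  by unfold_locales auto

text \<open>Otherwise the axis of \<open>y\<close> has only finitely many heights; but
  \<open>x\<close> maps this axis into itself and shifts heights by \<open>c\<close>.\<close>

lemma fixed_vertex_of_commuting:
  assumes y: "aut y 0" and x: "aut x c" "c \<noteq> 0" and comm: "\<And>u. u \<in> V \<Longrightarrow> x (y u) = y (x u)"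
    and ne: "V \<noteq> {}"
  shows "\<exists>u\<in>V. y u = u"
proof (rule ccontr)
  assume "\<not> ?thesis"
  then interpret hyperbolic V adj ht y using y hyperbolicI by blast
  obtain v where v: "v \<in> axis y" using axis_nonempty[OF ne] by blast
  have "(x ^^ k) v \<in> axis y" for k
    by (induction k) (auto simp: v axis_commute[OF y x(1) comm])
  then have "range (\<lambda>k. ht ((x ^^ k) v)) \<subseteq> ht ` axis y" by auto
  moreover have "ht ((x ^^ k) v) = ht v + int k * c" for k
    using aut_ht[OF aut_funpow[OF x(1)]] axis_V[OF v] by blast
  then have "inj (\<lambda>k. ht ((x ^^ k) v))" using x(2) by (auto simp: inj_def)
  ultimately show False using finite_axis_heights finite_subset range_inj_infinite by blast
qed

text \<open>Otherwise \<open>x\<close> translates along its axis, whose heights are bounded because \<open>x\<close> preserves heights.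
Since \<open>y\<close> preserves the axis, long geodesics between points \<open>v\<close> and \<open>y\<^bsup>2D\<^esup> v\<close> stay on it, while their
middle parts are translates by \<open>t\<close> of parts of the axis: so the set of heights of the axis is invariant
under addition of \<open>c\<close>.\<close>

lemma fixed_vertex_of_conj_power:
  assumes x: "aut x 0" and t: "aut t c" "c \<noteq> 0" and y: "aut y 0"
    and comm: "\<And>u. u \<in> V \<Longrightarrow> y (x u) = x (y u)"
    and conj: "\<And>u. u \<in> V \<Longrightarrow> t ((x ^^ m) u) = y (t u)" and m: "m > 0"
    and ne: "V \<noteq> {}"
  shows "\<exists>u\<in>V. x u = u"
proof (rule ccontr)
  assume "\<not> ?thesis"
  then interpret hyperbolic V adj ht x using x hyperbolicI by blast
  have step: "\<exists>z\<in>axis x. ht z = ht v + c" if v: "v \<in> axis x" for v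
  proof -
    have vV: "v \<in> V" "t v \<in> V" using v axis_V aut_V[OF t(1)] by auto
    define D where "D = length (geod v (t v))"
    let ?k = "m * D"
    \<comment> \<open>By \<open>conj\<close> this is \<open>(y ^^ D) (t v)\<close>, the middle of
      the geodesic from \<open>t v\<close> to \<open>(y ^^ (2 * D)) (t v)\<close>. Besides
      \<open>?z\<close> each half has at least \<open>D\<close> vertices, and \<open>D\<close> also
      measures how far the ends are from \<open>v\<close> and \<open>?w\<close>, as
      \<open>geod_middle\<close> demands.\<close>
    let ?z = "t ((x ^^ ?k) v)"
    have Vx: "(x ^^ k) v \<in> V" for k using aut_V[OF aut_funpow[OF x]] vV by blast
    have autY: "aut (y ^^ k) 0" for k using aut_funpow[OF y, of k] by simp
    have yk: "(y ^^ k) (t v) = t ((x ^^ (m * k)) v)" for k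
    proof (induction k)
      case (Suc k)
      have "t ((x ^^ (m * Suc k)) v) = t ((x ^^ m) ((x ^^ (m * k)) v))"
        by (simp add: funpow_add)
      then show ?case using Suc conj[OF Vx] by simp
    qed simp
    let ?w = "(y ^^ (2 * D)) v"
    have wV: "?w \<in> V" "(y ^^ (2 * D)) (t v) \<in> V" using aut_V[OF autY] vV by blast+
    have w: "?w \<in> axis x"
    proof -
      have "(y ^^ k) v \<in> axis x" for k
        by (induction k) (auto simp: v axis_commute[OF x y comm])
      then show ?thesis by blast
    qed
    define g where "g = geod v ((x ^^ ?k) v)"
    have gne: "g \<noteq> []" and gl: "last g = (x ^^ ?k) v" using geod[OF vV(1) Vx] by (auto simp: g_def)
    have len: "length g > D"
    proof -
      have "length g > ?k" using geod_funpow[OF v, of ?k 0] by (simp add: g_def)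
      moreover have "?k \<ge> D" using m by simp
      ultimately show ?thesis by linarith
    qed
    have "geod v ((x ^^ (?k + ?k)) v) = butlast g @ (x ^^ ?k) v # tl (map (x ^^ ?k) g)"
      using geod_funpow[OF v, of ?k ?k] gne gl unfolding g_def[symmetric]
      by (metis append_Cons append_Nil append_assoc append_butlast_last_id)
    then have "geod (t v) (t ((x ^^ (?k + ?k)) v)) = map t (butlast g) @ ?z # map t (tl (map (x ^^ ?k) g))"
      using aut_geod[OF t(1) vV(1) Vx] by simp
    moreover have "t ((x ^^ (?k + ?k)) v) = (y ^^ (2 * D)) (t v)"
      unfolding yk by (simp add: mult.assoc mult_2_right algebra_simps)
    ultimately have "geod (t v) ((y ^^ (2 * D)) (t v)) = map t (butlast g) @ ?z # map t (tl (map (x ^^ ?k) g))"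
      by simp
    then have "?z \<in> set (geod v ?w)"
    proof (rule geod_middle[rotated 4])
      show "length (geod (t v) v) \<le> length (map t (butlast g))"
        using geod_rev[OF vV] len by (simp add: D_def)
      have "geod ?w ((y ^^ (2 * D)) (t v)) = map (y ^^ (2 * D)) (geod v (t v))"
        using aut_geod[OF autY vV] .
      then show "length (geod ((y ^^ (2 * D)) (t v)) ?w) \<le> length (map t (tl (map (x ^^ ?k) g)))"
        using geod_rev[OF wV] len by (simp add: D_def)
    qed (use vV wV in auto)
    then have "?z \<in> axis x" using axis_convex[OF v w] by blast
    moreover have "ht ?z = ht v + c"
      using aut_ht[OF t(1) Vx] aut_ht[OF aut_funpow[OF x] vV(1)] by simp
    ultimately show ?thesis by blast
  qed
  obtain v where v: "v \<in> axis x" using axis_nonempty[OF ne] by blast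
  have "\<exists>z\<in>axis x. ht z = ht v + int k * c" for k
  proof (induction k)
    case (Suc k)
    then show ?case using step by (fastforce simp: algebra_simps)
  qed (use v in auto)
  then have "range (\<lambda>k. ht v + int k * c) \<subseteq> ht ` axis x" by (metis (no_types, lifting) image_iff image_subsetI)
  moreover have "inj (\<lambda>k. ht v + int k * c)" using t(2) by (auto simp: inj_def)
  ultimately show False using finite_axis_heights finite_subset range_inj_infinite by blast
qed

end

section \<open>HNN extensions of abelian groups\<close>

text \<open>An HNN extension of an abelian group \<open>E\<close> with stable letter \<open>a\<close>.  The subgroup of
elements that can be moved to the right of \<open>a\<close> (index \<open>True\<close>) or of \<open>a\<^sup>-\<^sup>1\<close> (index \<open>False\<close>)
is the zero set of \<open>rep\<close>, which picks coset representatives, and \<open>ph\<close> is the effect of moving.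
The list \<open>[(\<epsilon>\<^sub>1,\<rho>\<^sub>1),\<dots>]\<close> together with \<open>p\<close> stands for the normal form
\<open>\<rho>\<^sub>1 a\<^bsup>\<epsilon>\<^sub>1\<^esup> \<rho>\<^sub>2 a\<^bsup>\<epsilon>\<^sub>2\<^esup> \<dots> p\<close>; the lists alone are the vertices of the Bass-Serre tree.\<close>

locale hnn =
  fixes rep ph :: "bool \<Rightarrow> 'e::ab_group_add \<Rightarrow> 'e" and \<beta> :: 'e
  assumes rep_0 [simp]: "rep e 0 = 0"
    and rep_diff: "rep e (x - rep e x) = 0"
    and rep_absorb: "rep e y = 0 \<Longrightarrow> rep e (x + y) = rep e x"
    and ph_add: "rep e x = 0 \<Longrightarrow> rep e y = 0 \<Longrightarrow> ph e (x + y) = ph e x + ph e y"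
    and rep_ph [simp]: "rep e x = 0 \<Longrightarrow> rep (\<not> e) (ph e x) = 0"
    and ph_ph [simp]: "rep e x = 0 \<Longrightarrow> ph (\<not> e) (ph e x) = x"
begin

lemma rep_ph' [simp]: "rep (\<not> e) x = 0 \<Longrightarrow> rep e (ph (\<not> e) x) = 0"
  using rep_ph[of "\<not> e" x] by simp

lemma ph_ph' [simp]: "rep (\<not> e) x = 0 \<Longrightarrow> ph e (ph (\<not> e) x) = x"
  using ph_ph[of "\<not> e" x] by simp

lemma rep_absorb': "rep e y = 0 \<Longrightarrow> rep e (y + x) = rep e x"
  using rep_absorb[of e y x] by (simp add: add.commute)

lemma rep_uminus: "rep e x = 0 \<Longrightarrow> rep e (- x) = 0"
  using rep_absorb[of e x "- x"] by simp

lemma rep_minus: "rep e x = 0 \<Longrightarrow> rep e y = 0 \<Longrightarrow> rep e (x - y) = 0"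
  using rep_absorb[of e "- y" x] rep_uminus[of e y] by simp

lemma rep_rep [simp]: "rep e (rep e x) = rep e x"
  using rep_absorb[OF rep_diff, of e "rep e x" x] by simp

lemma rep_eqD: "rep e x = rep e y \<Longrightarrow> rep e (x - y) = 0"
  using rep_minus[OF rep_diff[of e x] rep_diff[of e y]] by simp

lemma ph_0 [simp]: "ph e 0 = 0"
  using ph_add[of e 0 0] by simp

text \<open>The sum \<open>q + \<rho>\<close> is split into a representative, which stays, and a
  remainder; the remainder crosses the stable letter and arrives as this element at the rest of the
  normal form.\<close>

definition nx :: "bool \<Rightarrow> 'e \<Rightarrow> 'e \<Rightarrow> 'e" where
  "nx e q \<rho> = ph e (q + \<rho> - rep e (q + \<rho>))"

lemma rep_nx [simp]: "rep (\<not> e) (nx e q \<rho>) = 0"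
  by (simp add: nx_def rep_diff)

text \<open>Cocycle identities: moving \<open>q2\<close> and then \<open>q1\<close> has the same
  effect as moving the sum. They make \<open>vE\<close> an action and \<open>cE\<close> additive
  along it.\<close>

lemma nx_add: "nx e (q1 + q2) \<rho> = nx e q1 (rep e (q2 + \<rho>)) + nx e q2 \<rho>"
  and rep_add_rep: "rep e (q1 + rep e (q2 + \<rho>)) = rep e (q1 + q2 + \<rho>)"
proof -
  have *: "rep e (q1 + rep e (q2 + \<rho>)) = rep e (q1 + q2 + \<rho>)"
    using rep_absorb[OF rep_diff[of e "q2 + \<rho>"], of "q1 + rep e (q2 + \<rho>)"]
    by (simp add: algebra_simps)
  then show "rep e (q1 + rep e (q2 + \<rho>)) = rep e (q1 + q2 + \<rho>)" .
  show "nx e (q1 + q2) \<rho> = nx e q1 (rep e (q2 + \<rho>)) + nx e q2 \<rho>"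
  proof -
    have "q1 + q2 + \<rho> - rep e (q1 + q2 + \<rho>) =
      (q1 + rep e (q2 + \<rho>) - rep e (q1 + rep e (q2 + \<rho>))) + (q2 + \<rho> - rep e (q2 + \<rho>))"
      unfolding * by simp
    then show ?thesis unfolding nx_def by (simp only: ph_add rep_diff)
  qed
qed

section \<open>Left multiplication on normal forms\<close>

text \<open>When \<open>q\<close> is multiplied from the left, \<open>vE\<close> is the new list and
  \<open>cE\<close> is what comes out at the right end.\<close>

fun vE :: "'e \<Rightarrow> (bool \<times> 'e) list \<Rightarrow> (bool \<times> 'e) list" where
  "vE q [] = []"
| "vE q ((e, \<rho>) # l) = (e, rep e (q + \<rho>)) # vE (nx e q \<rho>) l"

fun cE :: "'e \<Rightarrow> (bool \<times> 'e) list \<Rightarrow> 'e" where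
  "cE q [] = q"
| "cE q ((e, \<rho>) # l) = cE (nx e q \<rho>) l"

text \<open>The last condition excludes a pinch, that is, a power of \<open>a\<close> followed by
  representative 0 and the opposite power.\<close>

fun valid :: "(bool \<times> 'e) list \<Rightarrow> bool" where
  "valid [] = True"
| "valid ((e, \<rho>) # l) = (rep e \<rho> = \<rho> \<and> valid l \<and> (l = [] \<or> hd l \<noteq> (\<not> e, 0)))"

definition push :: "bool \<Rightarrow> (bool \<times> 'e) list \<Rightarrow> (bool \<times> 'e) list" where
  "push e l = (if l \<noteq> [] \<and> hd l = (\<not> e, 0) then tl l else (e, 0) # l)"

lemma vE_add: "vE (q1 + q2) l = vE q1 (vE q2 l)"
  by (induction l arbitrary: q1 q2) (auto simp: nx_add rep_add_rep)

lemma cE_add: "cE (q1 + q2) l = cE q1 (vE q2 l) + cE q2 l"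
  by (induction l arbitrary: q1 q2) (auto simp: nx_add rep_add_rep)

lemma vE_eq_Nil [simp]: "vE q l = [] \<longleftrightarrow> l = []"
  by (cases l) auto

lemma nx_0: "rep e \<rho> = \<rho> \<Longrightarrow> nx e 0 \<rho> = 0"
  by (simp add: nx_def)

lemma vE_0: "valid l \<Longrightarrow> vE 0 l = l"
  by (induction l rule: valid.induct) (auto simp: nx_0)

lemma cE_0: "valid l \<Longrightarrow> cE 0 l = 0"
  by (induction l rule: valid.induct) (auto simp: nx_0)

text \<open>No pinch is created: \<open>nx e q \<rho>\<close> lies in the subgroup that belongs to
  the opposite sign, so adding it cannot turn a nonzero representative for that sign into 0.\<close>

lemma valid_vE: "valid l \<Longrightarrow> valid (vE q l)"
proof (induction l arbitrary: q)
  case (Cons s l)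
  obtain e \<rho> where s: "s = (e, \<rho>)" by (cases s)
  have "hd (vE (nx e q \<rho>) l) \<noteq> (\<not> e, 0)" if ne: "l \<noteq> []"
  proof
    assume h: "hd (vE (nx e q \<rho>) l) = (\<not> e, 0)"
    obtain e' \<rho>' l' where l: "l = (e', \<rho>') # l'" using ne by (cases l) auto
    with h have "e' = (\<not> e)" "rep (\<not> e) (nx e q \<rho> + \<rho>') = 0" by auto
    then have "rep (\<not> e) \<rho>' = 0" using rep_absorb'[OF rep_nx] by metis
    then show False using Cons.prems s l \<open>e' = (\<not> e)\<close> by auto
  qed
  then show ?case using Cons s by auto
qed simp

lemma valid_tl: "valid l \<Longrightarrow> valid (tl l)"
  by (cases l rule: valid.cases) auto

lemma valid_push: "valid l \<Longrightarrow> valid (push e l)"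
  by (auto simp: push_def valid_tl)

lemma push_push: "valid l \<Longrightarrow> push e (push (\<not> e) l) = l"
  by (cases l rule: valid.cases) (auto simp: push_def)

text \<open>This is the HNN relation on normal forms. Either \<open>push\<close> cancels a leading
  syllable, which \<open>q\<close> crosses as \<open>ph (\<not> e) q\<close>, or it adds one, which
  \<open>ph (\<not> e) q\<close> crosses back to \<open>q\<close>.\<close>

lemma push_vE:
  assumes "valid l" "rep (\<not> e) q = 0"
  shows "push e (vE q l) = vE (ph (\<not> e) q) (push e l)"
    and "cE q l = cE (ph (\<not> e) q) (push e l)"
proof -
  have "push e (vE q l) = vE (ph (\<not> e) q) (push e l) \<and> cE q l = cE (ph (\<not> e) q) (push e l)"
  proof (cases "l \<noteq> [] \<and> hd l = (\<not> e, 0)")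
    case True
    then obtain l' where "l = (\<not> e, 0) # l'" by (cases l) auto
    then show ?thesis using assms by (auto simp: push_def nx_def)
  next
    case False
    have "\<not> (vE q l \<noteq> [] \<and> hd (vE q l) = (\<not> e, 0))"
      using False assms rep_absorb'[of "\<not> e" q] by (cases e; cases l rule: valid.cases) auto
    then show ?thesis using False assms by (auto simp: push_def nx_def)
  qed
  then show "push e (vE q l) = vE (ph (\<not> e) q) (push e l)"
    and "cE q l = cE (ph (\<not> e) q) (push e l)" by auto
qed

text \<open>Outside the normal forms all operators are the identity, so that they are permutations
of the whole type.\<close>

definition eop :: "'e \<Rightarrow> (bool \<times> 'e) list \<times> 'e \<Rightarrow> (bool \<times> 'e) list \<times> 'e" where
  "eop q s = (if valid (fst s) then (vE q (fst s), cE q (fst s) + snd s) else s)"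

definition aop :: "bool \<Rightarrow> (bool \<times> 'e) list \<times> 'e \<Rightarrow> (bool \<times> 'e) list \<times> 'e" where
  "aop e s = (if valid (fst s) then (push e (fst s), snd s) else s)"

lemma eop_add: "eop (q1 + q2) = eop q1 \<circ> eop q2"
  by (auto simp: eop_def valid_vE vE_add cE_add algebra_simps)

lemma eop_0: "eop 0 = id"
  by (auto simp: eop_def vE_0 cE_0)

lemma eop_base [simp]: "eop q ([], p) = ([], q + p)"
  by (simp add: eop_def)

lemma eop_inj: "eop p = eop q \<Longrightarrow> p = q"
  using eop_base[of p 0] eop_base[of q 0] by (metis add.right_neutral prod.inject)

lemma eop_uminus: "eop (- q) \<circ> eop q = id" "eop q \<circ> eop (- q) = id"
  by (simp_all flip: eop_add add: eop_0)

lemma eop_commute: "eop p \<circ> eop q = eop q \<circ> eop p"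
  by (simp flip: eop_add add: add.commute)

lemma aop_aop: "aop e \<circ> aop (\<not> e) = id"
  by (auto simp: aop_def valid_push push_push)

lemma aop_eop: "rep (\<not> e) q = 0 \<Longrightarrow> aop e \<circ> eop q = eop (ph (\<not> e) q) \<circ> aop e"
  by (auto simp: aop_def eop_def valid_push valid_vE push_vE)

text \<open>\<open>snd\<close> marks inverse letters, so \<open>a\<close> itself is
  \<open>aop True\<close>; \<open>\<beta>\<close> is the image of \<open>b\<close>.\<close>

definition T :: "letter \<Rightarrow> (bool \<times> 'e) list \<times> 'e \<Rightarrow> (bool \<times> 'e) list \<times> 'e" where
  "T l = (if fst l then eop (if snd l then - \<beta> else \<beta>) else aop (\<not> snd l))"

sublocale letter_act T
proof
  fix l s
  show "T l (T (inv_letter l) s) = s"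
    using eop_uminus[of \<beta>] aop_aop[of "\<not> snd l"]
    by (cases s) (auto simp: T_def inv_letter_def fun_eq_iff)
qed

abbreviation G where "G \<equiv> range (word_act T)"

lemma G_comp: "g \<in> G \<Longrightarrow> h \<in> G \<Longrightarrow> g \<circ> h \<in> G"
  by (auto simp flip: word_act_append)

lemma G_id: "id \<in> G"
  using word_act_simps(1)[of T] by (metis rangeI)

lemma G_inv: "g \<in> G \<Longrightarrow> \<exists>h\<in>G. h \<circ> g = id \<and> g \<circ> h = id"
proof -
  assume g: "g \<in> G"
  then obtain h where h: "h \<in> G" "h \<circ> g = id" using word_act_inv by auto
  then obtain k where "k \<in> G" "k \<circ> h = id" using word_act_inv by auto
  then have "k = g" using h(2) by (metis comp_assoc comp_id id_comp)
  then show ?thesis using h \<open>k \<circ> h = id\<close> by auto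
qed

lemma aop_in_G: "aop e \<in> G"
proof -
  have "word_act T [(False, \<not> e)] = aop e" by (simp add: T_def)
  then show ?thesis by (metis rangeI)
qed

lemma eop_\<beta>_in_G: "eop \<beta> \<in> G" "eop (- \<beta>) \<in> G"
proof -
  have "word_act T [(True, False)] = eop \<beta>" "word_act T [(True, True)] = eop (- \<beta>)"
    by (simp_all add: T_def)
  then show "eop \<beta> \<in> G" "eop (- \<beta>) \<in> G" by (metis rangeI)+
qed

lemma G_induct [consumes 1, case_names id comp_a comp_b]:
  assumes "g \<in> G" "P id" "\<And>e g. g \<in> G \<Longrightarrow> P g \<Longrightarrow> P (aop e \<circ> g)"
    "\<And>q g. q = \<beta> \<or> q = - \<beta> \<Longrightarrow> g \<in> G \<Longrightarrow> P g \<Longrightarrow> P (eop q \<circ> g)"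
  shows "P g"
proof -
  obtain w where "g = word_act T w" using assms(1) by auto
  moreover have "P (word_act T w)"
  proof (induction w)
    case (Cons l w)
    have "(\<exists>e. T l = aop e) \<or> (\<exists>q. (q = \<beta> \<or> q = - \<beta>) \<and> T l = eop q)"
      unfolding T_def by auto
    then show ?case unfolding word_act_simps using assms(3,4) Cons by (metis rangeI)
  qed (simp only: word_act_simps assms(2))
  ultimately show ?thesis by simp
qed

section \<open>The Bass-Serre tree\<close>

text \<open>The entry 0 is an arbitrary choice: by \<open>G_state\<close> it does not influence the
  list.\<close>

definition vm where "vm g u = fst (g (u, 0::'e))"

fun ht :: "(bool \<times> 'e) list \<Rightarrow> int" where
  "ht [] = 0"
| "ht ((e, \<rho>) # l) = (if e then 1 else - 1) + ht l"

definition hgt where "hgt g = ht (vm g [])"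

lemma ht_vE: "ht (vE q l) = ht l"
  by (induction l arbitrary: q) auto

lemma ht_push: "ht (push e l) = (if e then 1 else - 1) + ht l"
  by (cases l) (auto simp: push_def)

text \<open>The parent of a vertex is obtained at the right end of the list, while the group acts
  from the left; hence the action respects adjacency.\<close>

definition adj where
  "adj u v \<longleftrightarrow> valid u \<and> valid v \<and> (\<exists>s. v = u @ [s] \<or> u = v @ [s])"

lemma vE_append: "\<exists>q'. vE q (l @ k) = vE q l @ vE q' k"
  by (induction l arbitrary: q) (auto intro: exI[of _ q])

lemma adj_vE: "adj u v \<Longrightarrow> adj (vE q u) (vE q v)"
proof -
  have "\<exists>s'. vE q (u @ [s]) = vE q u @ [s']" for u s
    using vE_append[of q u "[s]"] by (cases s) auto
  then show "adj u v \<Longrightarrow> adj (vE q u) (vE q v)" unfolding adj_def by (metis valid_vE)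
qed

lemma adj_push: "adj u v \<Longrightarrow> adj (push e u) (push e v)"
proof -
  have "(\<exists>s'. push e (u @ [s]) = push e u @ [s'] \<or> push e u = push e (u @ [s]) @ [s'])" for u s
    by (cases u) (auto simp: push_def)
  then show "adj u v \<Longrightarrow> adj (push e u) (push e v)" unfolding adj_def by (metis valid_push)
qed

text \<open>Left multiplications commute with right multiplication by \<open>E\<close>: this is why
  \<open>p\<close> is merely translated and the list does not depend on it.\<close>

lemma G_state:
  assumes "g \<in> G" "valid u"
  shows "g (u, p) = (vm g u, snd (g (u, 0)) + p) \<and> valid (vm g u) \<and> ht (vm g u) = ht u + hgt g"
  using assms
proof (induction arbitrary: u p rule: G_induct)
  case id
  then show ?case by (simp add: vm_def hgt_def)
next
  case (comp_a e g)
  have "g (u, p) = (vm g u, snd (g (u, 0)) + p)" "valid (vm g u)" "ht (vm g u) = ht u + hgt g"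
    "g (u, 0) = (vm g u, snd (g (u, 0)))" "g ([], 0) = (vm g [], snd (g ([], 0)))" "valid (vm g [])"
    using comp_a(2)[of u p] comp_a(2)[of u 0] comp_a(2)[of "[]" 0] comp_a.prems by auto
  then show ?case by (simp add: vm_def hgt_def aop_def valid_push ht_push)
next
  case (comp_b q g)
  have "g (u, p) = (vm g u, snd (g (u, 0)) + p)" "valid (vm g u)" "ht (vm g u) = ht u + hgt g"
    "g (u, 0) = (vm g u, snd (g (u, 0)))" "g ([], 0) = (vm g [], snd (g ([], 0)))" "valid (vm g [])"
    using comp_b(3)[of u p] comp_b(3)[of u 0] comp_b(3)[of "[]" 0] comp_b.prems by auto
  then show ?case by (simp add: vm_def hgt_def eop_def valid_vE ht_vE algebra_simps)
qed

lemma vm_comp: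
  assumes "g \<in> G" "h \<in> G" "valid u"
  shows "vm (g \<circ> h) u = vm g (vm h u)"
proof -
  have "h (u, 0) = (vm h u, snd (h (u, 0)))" "valid (vm h u)" using G_state[OF assms(2,3), of 0] by auto
  then show ?thesis using G_state[OF assms(1), of "vm h u" "snd (h (u, 0))"] by (simp add: vm_def)
qed

lemma hgt_comp: "g \<in> G \<Longrightarrow> h \<in> G \<Longrightarrow> hgt (g \<circ> h) = hgt g + hgt h"
  using G_state[of h "[]" 0] G_state[of g "vm h []" 0] vm_comp[of g h "[]"]
  by (simp add: hgt_def)

lemma hgt_simps [simp]: "hgt id = 0" "hgt (aop e) = (if e then 1 else - 1)" "hgt (eop q) = 0"
  by (simp_all add: hgt_def vm_def aop_def push_def)

lemma vm_aop: "valid u \<Longrightarrow> vm (aop e) u = push e u"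
  and vm_eop: "valid u \<Longrightarrow> vm (eop q) u = vE q u"
  by (simp_all add: vm_def aop_def eop_def)

lemma valid_vm: "g \<in> G \<Longrightarrow> valid u \<Longrightarrow> valid (vm g u)"
  using G_state by blast

lemma adj_vm: "g \<in> G \<Longrightarrow> adj u v \<Longrightarrow> adj (vm g u) (vm g v)"
proof (induction arbitrary: u v rule: G_induct)
  case id
  then show ?case by (simp add: vm_def)
next
  case (comp_a e g)
  have V: "valid u" "valid v" using comp_a.prems by (auto simp: adj_def)
  show ?case unfolding vm_comp[OF aop_in_G comp_a(1) V(1)] vm_comp[OF aop_in_G comp_a(1) V(2)]
    using comp_a V by (simp only: vm_aop valid_vm adj_push)
next
  case (comp_b q g)
  have V: "valid u" "valid v" using comp_b.prems by (auto simp: adj_def)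
  have q: "eop q \<in> G" using comp_b(1) eop_\<beta>_in_G by auto
  show ?case unfolding vm_comp[OF q comp_b(2) V(1)] vm_comp[OF q comp_b(2) V(2)]
    using comp_b V by (simp only: vm_eop valid_vm adj_vE)
qed

lemma valid_append: "valid (u @ v) \<Longrightarrow> valid u"
  by (induction u rule: valid.induct) (auto simp: hd_append split: if_splits)

sublocale tree: height_tree "{u. valid u}" adj ht
proof
  have root: "adj\<^sup>*\<^sup>* u [] \<and> adj\<^sup>*\<^sup>* [] u" if "valid u" for u
    using that
  proof (induction u rule: rev_induct)
    case (snoc s u)
    have "valid u" using snoc.prems valid_append by blast
    then have "adj u (u @ [s])" "adj (u @ [s]) u" using snoc.prems by (auto simp: adj_def)
    then show ?case using snoc.IH[OF \<open>valid u\<close>]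
      by (meson converse_rtranclp_into_rtranclp rtranclp.rtrancl_into_rtrancl)
  qed simp
  show "adj\<^sup>*\<^sup>* u v" if "u \<in> {u. valid u}" "v \<in> {u. valid u}" for u v
    using root[of u] root[of v] that by auto
  have app: "ht (u @ [s]) \<noteq> ht u" for u s
    by (induction u rule: ht.induct) (cases s, auto)
  show "ht u \<noteq> ht v" if "adj u v" for u v
    using that app[of u] app[of v] by (fastforce simp: adj_def)
qed (auto simp: adj_def)

text \<open>Only one neighbour of a vertex is nearer to the root, so a walk without backtracking
  that has once left the root direction never turns back.\<close>

lemma nb_down: "tree.nb (u # (u @ [s]) # p) \<Longrightarrow> \<exists>t. last (u # (u @ [s]) # p) = u @ s # t"
proof (induction p arbitrary: u s)
  case (Cons w p)
  have "adj (u @ [s]) w" "w \<noteq> u" using Cons.prems by auto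
  then obtain s' where w: "w = (u @ [s]) @ [s']" by (auto simp: adj_def)
  have "tree.nb ((u @ [s]) # ((u @ [s]) @ [s']) # p)" using Cons.prems w by simp
  from Cons.IH[OF this] w show ?case by auto
qed simp

text \<open>By \<open>nb_down\<close> a closed walk must start towards the root, and by
  \<open>nb_up\<close> it must return from there. Both neighbours of its base point are then the
  parent, and deleting the two ends gives a shorter closed walk.\<close>

sublocale tree: tree_with_height "{u. valid u}" adj ht
proof
  have nbI: "tree.nb (p @ [x, y]) \<Longrightarrow> tree.nb (p @ [x])" for p x y
    by (induction p rule: tree.nb.induct) (auto simp: adj_def hd_append split: if_splits)
  have nb_last: "tree.nb (p @ [x, y]) \<Longrightarrow> adj x y" for p x y
  proof (induction p)
    case (Cons z p)
    then show ?case by (cases p) auto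
  qed auto
  \<comment> \<open>Time reversal of \<open>nb_down\<close>: a walk that ends with a step towards
    the root starts below its end.\<close>
  have nb_up: "\<exists>t. u = last (p @ [x, y]) @ s # t"
    if "tree.nb (p @ [x, y])" "x = y @ [s]" "hd (p @ [x, y]) = u" for p x y u s
    using that
  proof (induction p arbitrary: u)
    case (Cons z p)
    show ?case
    proof (cases p)
      case Nil
      then have "adj z x" "z \<noteq> y" using Cons.prems by auto
      then show ?thesis using Cons.prems Nil by (auto simp: adj_def)
    next
      case (Cons z' p')
      have "tree.nb (p @ [x, y])" using Cons.prems(1) Cons by simp
      then obtain t where t: "z' = y @ s # t" using Cons.IH[of z'] Cons.prems Cons by auto
      show ?thesis
      proof (cases "\<exists>s'. z = z' @ [s']")
        case True
        then show ?thesis using t Cons.prems by auto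
      next
        case False
        have "adj z z'" using Cons.prems(1) Cons by simp
        then obtain s' where "z' = z @ [s']" using False by (auto simp: adj_def)
        then obtain t' where "last (z # (p @ [x, y])) = z @ s' # t'"
          using nb_down[of z s' "p' @ [x, y]"] Cons.prems(1) Cons by auto
        then show ?thesis using t \<open>z' = z @ [s']\<close> by auto
      qed
    qed
  qed auto
  fix p
  show "length p = 1" if "tree.nb p" "hd p = last p"
    using that
  proof (induction p rule: length_induct)
    case (1 p)
    show ?case
    proof (rule ccontr)
      assume "length p \<noteq> 1"
      then obtain u v q where p: "p = u # v # q" using 1 by (cases p rule: tree.nb.cases) auto
      have a: "adj u v" using 1 p by simp
      then have "u \<noteq> v" by (auto simp: adj_def)
      then obtain q' where q: "q = q' @ [u]" using 1 p by (cases q rule: rev_cases) auto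
      obtain s where s: "u = v @ [s]"
      proof -
        obtain s where "v = u @ [s] \<or> u = v @ [s]" using a by (auto simp: adj_def)
        moreover have "v \<noteq> u @ [s]"
        proof
          assume v: "v = u @ [s]"
          have "tree.nb (u # (u @ [s]) # q)" using 1 p v by blast
          from nb_down[OF this] show False using q by simp
        qed
        ultimately show ?thesis using that by blast
      qed
      show False
      proof (cases q' rule: rev_cases)
        case Nil
        then show ?thesis using 1 p q by simp
      next
        case (snoc q'' v')
        have nb: "tree.nb ((u # v # q'') @ [v', u])" using 1 p q snoc by simp
        have a': "adj v' u" using nb_last[OF nb] .
        have "u = v' @ [s] \<or> (\<exists>s'. v' = u @ [s'])" using a' s by (auto simp: adj_def)
        moreover have "\<not> (\<exists>s'. v' = u @ [s'])"
        proof
          assume "\<exists>s'. v' = u @ [s']"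
          then obtain s' where "v' = u @ [s']" by blast
          from nb_up[OF nb this, of u] show False by auto
        qed
        ultimately have "v' = v" using s by simp
        moreover have "tree.nb (v # q'' @ [v'])" using nbI[OF nb] by simp
        ultimately have "length (v # q'' @ [v']) = 1"
          using 1(1)[rule_format, of "v # q'' @ [v']"] p q snoc by simp
        then show False by simp
      qed
    qed
  qed
qed

lemma aut_vm: "g \<in> G \<Longrightarrow> tree.aut (vm g) (hgt g)"
proof -
  assume g: "g \<in> G"
  then obtain h where h: "h \<in> G" "h \<circ> g = id" using G_inv by blast
  have "vm h (vm g u) = u" if "valid u" for u
    using vm_comp[OF h(1) g that] h(2) by (simp add: vm_def)
  then have "inj_on (vm g) {u. valid u}" by (metis inj_onI mem_Collect_eq)
  then show ?thesis using g adj_vm G_state unfolding tree.aut_def by auto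
qed

text \<open>Both sides are evaluated at the base state: the vertex \<open>vm g []\<close> has to be
  fixed by \<open>Q\<close>, and \<open>Q\<close> has to come out as \<open>P\<close> behind its
  list.\<close>

lemma conj_eop:
  assumes "g \<in> G" "eop Q \<circ> g = g \<circ> eop P"
  shows "valid (vm g [])" "vE Q (vm g []) = vm g []" "cE Q (vm g []) = P"
proof -
  define c where "c = snd (g ([], 0))"
  have v: "valid []" by simp
  note st = G_state[OF assms(1) v, folded c_def]
  show "valid (vm g [])" using st by blast
  have g0: "g ([], 0) = (vm g [], c)" using st[of 0] by simp
  have "eop Q (g ([], 0)) = g (eop P ([], 0))" using assms(2) by (metis comp_apply)
  then have "eop Q (vm g [], c) = (vm g [], c + P)" using st[of P] unfolding g0 by simp
  then show "vE Q (vm g []) = vm g []" "cE Q (vm g []) = P"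
    using \<open>valid (vm g [])\<close> by (auto simp: eop_def add.commute)
qed

text \<open>An element of \<open>E\<close> that fixes a vertex fixes the whole path to the root, so
  it crosses the first syllable; \<open>\<rho>\<close> drops out because \<open>E\<close> is
  abelian.\<close>

lemma vE_fix:
  assumes "valid ((e, \<rho>) # l)" "vE q ((e, \<rho>) # l) = (e, \<rho>) # l"
  shows "rep e q = 0" "vE (ph e q) l = l" "cE q ((e, \<rho>) # l) = cE (ph e q) l"
proof -
  have r: "rep e (q + \<rho>) = \<rho>" "rep e \<rho> = \<rho>" using assms by auto
  then show "rep e q = 0" using rep_eqD[of e "q + \<rho>" \<rho>] by simp
  have "nx e q \<rho> = ph e q" using r by (simp add: nx_def)
  then show "vE (ph e q) l = l" "cE q ((e, \<rho>) # l) = cE (ph e q) l" using assms(2) by auto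
qed

end

text \<open>The two assumptions say that the conjugates of \<open>\<beta>\<close> generate
  \<open>E\<close> and that stabilizers of the base state are trivial. With
  \<open>transitive_states\<close>, \<open>G\<close> acts simply transitively on the states with
  valid list.\<close>

locale hnn_regular = hnn +
  assumes eop_in_G: "eop q \<in> G"
    and free: "g \<in> G \<Longrightarrow> g ([], 0) = ([], 0) \<Longrightarrow> g = id"
begin

lemma regular: "g \<in> G \<Longrightarrow> h \<in> G \<Longrightarrow> g ([], 0) = h ([], 0) \<Longrightarrow> g = h"
proof -
  assume gh: "g \<in> G" "h \<in> G" "g ([], 0) = h ([], 0)"
  obtain k where k: "k \<in> G" "k \<circ> h = id" "h \<circ> k = id" using G_inv[OF gh(2)] by blast
  have "(k \<circ> g) ([], 0) = ([], 0)" using gh(3) k(2) by (metis comp_apply id_apply)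
  then have "k \<circ> g = id" using free G_comp k gh by blast
  then show "g = h" using k(3) by (metis comp_assoc comp_id id_comp)
qed

lemma stabilizer: "g \<in> G \<Longrightarrow> vm g [] = [] \<Longrightarrow> \<exists>q. g = eop q"
  using regular[of g "eop (snd (g ([], 0)))"] eop_in_G G_state[of g "[]" 0] by auto

end

context hnn
begin

lemma transitive_states:
  assumes "\<And>q. eop q \<in> G" "valid l"
  shows "\<exists>g\<in>G. g ([], 0) = (l, p)"
  using assms(2)
proof (induction l rule: valid.induct)
  case 1
  show ?case by (rule bexI[of _ "eop p"]) (auto simp: assms)
next
  case (2 e \<rho> l)
  then obtain g where g: "g \<in> G" "g ([], 0) = (l, p)" by auto
  have "aop e (l, p) = ((e, 0) # l, p)" using 2 by (auto simp: aop_def push_def)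
  moreover have "valid ((e, 0) # l)" using 2 by auto
  then have "eop \<rho> ((e, 0) # l, p) = ((e, \<rho>) # l, p)"
    using 2 by (simp add: eop_def nx_def vE_0 cE_0)
  ultimately have "(eop \<rho> \<circ> (aop e \<circ> g)) ([], 0) = ((e, \<rho>) # l, p)" using g by simp
  moreover have "eop \<rho> \<circ> (aop e \<circ> g) \<in> G"
    by (intro G_comp assms(1) aop_in_G g(1))
  ultimately show ?case by (rule bexI)
qed

end

section \<open>Baumslag-Solitar groups\<close>

text \<open>Representatives of least absolute value: a fixed integer is its own representative modulo
every sufficiently large \<open>x\<close>, which a representative in \<open>{0..<\<bar>x\<bar>}\<close> would not give.\<close>

definition smod :: "int \<Rightarrow> int \<Rightarrow> int" where
  "smod x k = (k + \<bar>x\<bar> div 2) mod \<bar>x\<bar> - \<bar>x\<bar> div 2"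

lemma smod_dvd: "x dvd k - smod x k"
proof -
  have "k - smod x k = \<bar>x\<bar> * ((k + \<bar>x\<bar> div 2) div \<bar>x\<bar>)"
    using minus_mod_eq_mult_div[of "k + \<bar>x\<bar> div 2" "\<bar>x\<bar>"] by (simp add: smod_def)
  then show ?thesis by simp
qed

lemma smod_add: "x dvd y \<Longrightarrow> smod x (k + y) = smod x k"
  by (simp add: smod_def mod_eq_dvd_iff)

lemma smod_small:
  assumes "2 * \<bar>k\<bar> < \<bar>x\<bar>" shows "smod x k = k"
proof -
  have "0 \<le> k + \<bar>x\<bar> div 2" "k + \<bar>x\<bar> div 2 < \<bar>x\<bar>" using assms by linarith+
  then show ?thesis by (simp add: smod_def)
qed

lemma smod_eq_0_iff: "x \<noteq> 0 \<Longrightarrow> smod x k = 0 \<longleftrightarrow> x dvd k"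
  using smod_dvd[of x k] smod_add[of x k 0] smod_small[of 0 x] by auto

text \<open>The data of \<open>BS(M,x)\<close> as an HNN extension of the powers of
  \<open>b\<close>: \<open>True\<close> stands for \<open>b\<^sup>x a = a b\<^sup>M\<close>,
  \<open>False\<close> for
  \<open>b\<^sup>M a\<^sup>-\<^sup>1 = a\<^sup>-\<^sup>1 b\<^sup>x\<close>.\<close>

definition Zrep :: "int \<Rightarrow> int \<Rightarrow> bool \<Rightarrow> int \<Rightarrow> int" where
  "Zrep M x e k = (if e then smod x k else k mod M)"

definition Zph :: "int \<Rightarrow> int \<Rightarrow> bool \<Rightarrow> int \<Rightarrow> int" where
  "Zph M x e k = (if e then (k div x) * M else (k div M) * x)"

lemma hnn_Z:
  assumes "M > 0" "x \<noteq> 0"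
  shows "hnn (Zrep M x) (Zph M x)"
proof
  fix e :: bool and y k :: int
  have Z0: "Zrep M x e k = 0 \<longleftrightarrow> (if e then x else M) dvd k" for e k
    using assms by (auto simp: Zrep_def smod_eq_0_iff dvd_eq_mod_eq_0)
  show "Zrep M x e 0 = 0" by (simp add: Z0)
  show "Zrep M x e (k - Zrep M x e k) = 0"
    unfolding Z0 using smod_dvd[of x k] by (auto simp: Zrep_def)
  show "Zrep M x e (k + y) = Zrep M x e k" if "Zrep M x e y = 0"
    using that smod_add[of x y k] unfolding Z0 by (auto simp: Zrep_def elim!: dvdE)
  show "Zph M x e (k + y) = Zph M x e k + Zph M x e y" if "Zrep M x e k = 0" "Zrep M x e y = 0"
    using that assms unfolding Z0
    by (auto simp: Zph_def algebra_simps elim!: dvdE simp flip: distrib_left split: if_splits)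
  show "Zrep M x (\<not> e) (Zph M x e k) = 0" if "Zrep M x e k = 0"
    unfolding Z0 by (auto simp: Zph_def)
  show "Zph M x (\<not> e) (Zph M x e k) = k" if "Zrep M x e k = 0"
    using that assms unfolding Z0 by (auto simp: Zph_def elim!: dvdE split: if_splits)
qed

text \<open>Normal forms are evaluated in an arbitrary group in which the relation holds. This
  yields the half of the normal form theorem saying that a word which fixes the base state is
  trivial in every such group.\<close>

locale bs_relation = group K for K (structure) +
  fixes a b :: 'a and M x :: int
  assumes ab: "a \<in> carrier K" "b \<in> carrier K"
    and rel: "a \<otimes> b [^] M \<otimes> inv a = b [^] x"
    and M: "M > 0" and x: "x \<noteq> 0"
begin

interpretation Z: hnn "Zrep M x" "Zph M x" 1 by (rule hnn_Z[OF M x])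

definition A where "A e = (if e then a else inv a)"

lemma A_closed [simp]: "A e \<in> carrier K"
  using ab by (simp add: A_def)

lemma b_closed [simp]: "b [^] (k::int) \<in> carrier K"
  using ab by simp

lemma a_pow: "a \<otimes> b [^] (M * j) = b [^] (x * j) \<otimes> a"
proof -
  have "group_hom K K (\<lambda>g. a \<otimes> g \<otimes> inv a)"
    by unfold_locales (use ab in \<open>auto simp: hom_def m_assoc inv_solve_left\<close>)
  from group_hom.hom_int_pow[OF this, of "b [^] M" j]
  have "a \<otimes> b [^] (M * j) \<otimes> inv a = b [^] (x * j)"
    using ab rel by (simp add: int_pow_pow)
  then show ?thesis using ab by (metis inv_closed inv_solve_right' m_closed b_closed inv_inv)
qed

lemma A_pow:
  assumes "Zrep M x e k = 0"
  shows "b [^] k \<otimes> A e = A e \<otimes> b [^] Zph M x e k"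
proof (cases e)
  case True
  then obtain j where "k = x * j" using assms smod_eq_0_iff[OF x] by (auto simp: Zrep_def)
  then show ?thesis using True a_pow[of j] x by (simp add: A_def Zph_def mult.commute)
next
  case False
  then obtain j where k: "k = M * j" using assms by (auto simp: Zrep_def)
  have "inv a \<otimes> (a \<otimes> b [^] (M * j)) \<otimes> inv a = inv a \<otimes> (b [^] (x * j) \<otimes> a) \<otimes> inv a"
    by (simp add: a_pow)
  then have "b [^] (M * j) \<otimes> inv a = inv a \<otimes> b [^] (x * j)"
    using ab by (simp add: m_assoc inv_solve_left)
      (metis ab(1) b_closed inv_closed l_inv l_one m_assoc r_inv r_one m_closed)
  then show ?thesis using False k M by (simp add: A_def Zph_def mult.commute)
qed

fun val :: "(bool \<times> int) list \<Rightarrow> int \<Rightarrow> 'a" where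
  "val [] k = b [^] k"
| "val ((e, \<rho>) # l) k = b [^] \<rho> \<otimes> (A e \<otimes> val l k)"

lemma val_closed [simp]: "val l k \<in> carrier K"
  by (induction l) auto

lemma val_eop: "b [^] q \<otimes> val l k = val (Z.vE q l) (Z.cE q l + k)"
proof (induction l arbitrary: q)
  case Nil
  then show ?case using ab by (simp add: int_pow_mult)
next
  case (Cons s l)
  obtain e \<rho> where s: "s = (e, \<rho>)" by (cases s)
  define \<rho>' where "\<rho>' = Zrep M x e (q + \<rho>)"
  have "b [^] q \<otimes> val (s # l) k = b [^] (\<rho>' + (q + \<rho> - \<rho>')) \<otimes> (A e \<otimes> val l k)"
    using ab by (simp add: s int_pow_mult[symmetric] m_assoc[symmetric])
  also have "\<dots> = b [^] \<rho>' \<otimes> ((b [^] (q + \<rho> - \<rho>') \<otimes> A e) \<otimes> val l k)"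
    by (simp only: int_pow_mult[OF ab(2)] m_assoc b_closed A_closed val_closed m_closed)
  also have "b [^] (q + \<rho> - \<rho>') \<otimes> A e = A e \<otimes> b [^] Z.nx e q \<rho>"
    unfolding Z.nx_def \<rho>'_def by (rule A_pow[OF Z.rep_diff])
  also have "A e \<otimes> b [^] Z.nx e q \<rho> \<otimes> val l k = A e \<otimes> val (Z.vE (Z.nx e q \<rho>) l) (Z.cE (Z.nx e q \<rho>) l + k)"
    by (simp add: m_assoc Cons.IH)
  finally show ?case by (simp add: s \<rho>'_def)
qed

lemma val_aop: "A e \<otimes> val l k = val (Z.push e l) k"
proof (cases "l \<noteq> [] \<and> hd l = (\<not> e, 0)")
  case True
  then obtain l' where l: "l = (\<not> e, 0) # l'" by (cases l) auto
  have "A e \<otimes> (A (\<not> e) \<otimes> val l' k) = val l' k"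
    using ab by (simp add: A_def m_assoc[symmetric])
  then show ?thesis using l by (simp add: Z.push_def)
qed (auto simp: Z.push_def)

definition ev where "ev l = (if fst l then b [^] (if snd l then - 1 else 1 :: int) else A (\<not> snd l))"

lemma ev_closed [simp]: "ev l \<in> carrier K"
  by (simp add: ev_def)

lemma ev_T:
  assumes "Z.valid (fst s)"
  shows "ev l \<otimes> val (fst s) (snd s) = val (fst (Z.T l s)) (snd (Z.T l s))"
  using assms by (auto simp: ev_def Z.T_def Z.eop_def Z.aop_def val_eop val_aop)

text \<open>The value of a word in \<open>K\<close> depends only on the state to which the word
  moves the base state.\<close>

lemma val_word_act:
  "foldr (\<lambda>l g. ev l \<otimes> g) w \<one> =
    val (fst (word_act Z.T w ([], 0))) (snd (word_act Z.T w ([], 0)))"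
proof (induction w)
  case (Cons l w)
  have "Z.valid (fst (word_act Z.T w ([], 0)))"
    using Z.G_state[of "word_act Z.T w" "[]" 0] by (auto simp: Z.vm_def)
  then show ?case using Cons ev_T by simp
qed simp

end

section \<open>The word problem of BS(M,x)\<close>

lemma normal_BSN: "BSN p q \<lhd> FG"
proof -
  have c: "carrier FG \<lhd> FG" 
    by (rule FG.normal_invI[OF FG.subgroup_self]) (intro FG.m_closed FG.inv_closed)
  have "subgroup (BSN p q) FG"
    unfolding BSN_def
  proof (rule FG.subgroups_Inter)
    show "{N. N \<lhd> FG \<and> BS_rel p q \<in> N} \<noteq> {}"
      using c by (auto intro!: exI[of _ "carrier FG"] simp: BS_rel_def reduced_reduce)
  qed (auto simp: normal_imp_subgroup)
  moreover have "g \<otimes>\<^bsub>FG\<^esub> h \<otimes>\<^bsub>FG\<^esub> inv\<^bsub>FG\<^esub> g \<in> BSN p q"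
    if "g \<in> carrier FG" "h \<in> BSN p q" for g h
    using that normal.inv_op_closed2 unfolding BSN_def by fastforce
  ultimately show ?thesis by (rule FG.normal_invI)
qed

lemma reduced_gen [simp]: "reduced gen_a" "reduced gen_b"
  by (simp_all add: gen_a_def gen_b_def)

lemma BS_rel_in_BSN: "BS_rel p q \<in> BSN p q"
  by (simp add: BSN_def)

lemma BS_rel_closed: "BS_rel p q \<in> carrier FG"
  using FG.m_closed FG.inv_closed FG.int_pow_closed reduced_gen
  by (simp add: BS_rel_def reduced_reduce)

lemma in_normal_iff:
  assumes "N \<lhd> FG" "g \<in> carrier FG"
  shows "g \<in> N \<longleftrightarrow> N #>\<^bsub>FG\<^esub> g = N"
  using assms FG.coset_join1 FG.coset_join2 normal_imp_subgroup
  by (metis FG.coset_join1 FG.coset_join2 normal_imp_subgroup FG.rcos_self)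

text \<open>The relator acts trivially, so its normal closure lies in the kernel of the action.
  Conversely the quotient by \<open>BSN M x\<close> is a \<open>bs_relation\<close>, and
  \<open>val_word_act\<close> computes the class of \<open>w\<close> in it.\<close>

lemma BSN_word_act:
  assumes M: "M > 0" and x: "x \<noteq> 0" and w: "reduced w"
  shows "w \<in> BSN M x \<longleftrightarrow> word_act (hnn.T (Zrep M x) (Zph M x) 1) w ([], 0) = ([], 0)"
proof -
  interpret Z: hnn "Zrep M x" "Zph M x" 1 by (rule hnn_Z[OF M x])
  interpret h: group_hom FG "act_group Z.T" "word_act Z.T" by (rule Z.group_hom_word_act)
  interpret N: normal "BSN M x" FG by (rule normal_BSN)
  let ?Q = "FG Mod BSN M x"
  let ?p = "\<lambda>g. BSN M x #>\<^bsub>FG\<^esub> g"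
  interpret Q: group ?Q by (rule N.factorgroup_is_group)
  interpret p: group_hom FG ?Q ?p
    by unfold_locales (rule N.r_coset_hom_Mod)
  have one: "\<one>\<^bsub>?Q\<^esub> = BSN M x" by (simp add: FactGroup_def)
  have a: "gen_a \<in> carrier FG" and b: "gen_b \<in> carrier FG" by simp_all
  show ?thesis
  proof
    assume "w \<in> BSN M x"
    have bk: "word_act Z.T (gen_b [^]\<^bsub>FG\<^esub> (k::int)) = Z.eop k" for k
    proof -
      have nat: "word_act Z.T (gen_b [^]\<^bsub>FG\<^esub> (n::nat)) = Z.eop (int n)" for n
      proof (induction n)
        case 0
        show ?case by (simp add: Z.eop_0)
      next
        case (Suc n)
        have "word_act Z.T (gen_b [^]\<^bsub>FG\<^esub> Suc n) =
          word_act Z.T (gen_b [^]\<^bsub>FG\<^esub> n) \<circ> word_act Z.T gen_b"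
          by (simp only: FG.nat_pow_Suc mult_FG Z.word_act_reduce word_act_append)
        also have "word_act Z.T gen_b = Z.eop 1"
          by (simp only: gen_b_def word_act_simps) (simp add: Z.T_def fun_eq_iff)
        finally show ?case unfolding Suc by (simp only: Z.eop_add[symmetric]) (simp add: add.commute)
      qed
      show ?thesis
      proof (cases k rule: int_cases2)
        case (nonneg n)
        then show ?thesis using nat[of n] by (simp add: int_pow_int)
      next
        case (nonpos n)
        let ?u = "gen_b [^]\<^bsub>FG\<^esub> n"
        have u: "?u \<in> carrier FG" using b by blast
        have "gen_b [^]\<^bsub>FG\<^esub> k = inv\<^bsub>FG\<^esub> ?u" using nonpos FG.int_pow_neg_int[OF b] by simp
        moreover have "word_act Z.T (inv\<^bsub>FG\<^esub> ?u) \<circ> word_act Z.T ?u = id"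
        proof -
          have "word_act Z.T (inv\<^bsub>FG\<^esub> ?u) \<otimes>\<^bsub>act_group Z.T\<^esub> word_act Z.T ?u = word_act Z.T (inv\<^bsub>FG\<^esub> ?u \<otimes>\<^bsub>FG\<^esub> ?u)"
            using u by (intro h.hom_mult[symmetric] FG.inv_closed)
          then show ?thesis using FG.l_inv[OF u] by (simp only: act_group_simps one_FG word_act_simps)
        qed
        then have "word_act Z.T (inv\<^bsub>FG\<^esub> ?u) = Z.eop (- int n)"
          using Z.eop_uminus(2)[of "int n"] unfolding nat by (metis comp_assoc comp_id id_comp)
        ultimately show ?thesis using nonpos by simp
      qed
    qed
    have "BS_rel M x \<in> Z.act_kernel"
    proof -
      have inv: "word_act Z.T u \<circ> word_act Z.T (inv\<^bsub>FG\<^esub> u) = id" if u: "u \<in> carrier FG" for u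
      proof -
        have "word_act Z.T u \<otimes>\<^bsub>act_group Z.T\<^esub> word_act Z.T (inv\<^bsub>FG\<^esub> u) = word_act Z.T (u \<otimes>\<^bsub>FG\<^esub> inv\<^bsub>FG\<^esub> u)"
          using u by (intro h.hom_mult[symmetric] FG.inv_closed)
        then show ?thesis using FG.r_inv[OF u] by (simp only: act_group_simps one_FG word_act_simps)
      qed
      have ga: "word_act Z.T gen_a = Z.aop True"
        by (simp only: gen_a_def word_act_simps) (simp add: Z.T_def fun_eq_iff)
      have "Zrep M x False M = 0" "Zph M x False M = x" using M by (simp_all add: Zrep_def Zph_def)
      then have c: "Z.aop True \<circ> Z.eop M = Z.eop x \<circ> Z.aop True"
        using Z.aop_eop[of True M] by simp
      have "word_act Z.T (BS_rel M x) = word_act Z.T gen_a \<circ> word_act Z.T (gen_b [^]\<^bsub>FG\<^esub> M) \<circ>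
        word_act Z.T (inv\<^bsub>FG\<^esub> gen_a) \<circ> word_act Z.T (inv\<^bsub>FG\<^esub> (gen_b [^]\<^bsub>FG\<^esub> x))"
        by (simp only: BS_rel_def mult_FG Z.word_act_reduce word_act_append)
      also have "\<dots> = Z.eop x \<circ> (Z.aop True \<circ> word_act Z.T (inv\<^bsub>FG\<^esub> gen_a)) \<circ> word_act Z.T (inv\<^bsub>FG\<^esub> (gen_b [^]\<^bsub>FG\<^esub> x))"
        unfolding bk ga c by (simp only: comp_assoc)
      also have "\<dots> = id"
        using inv[OF a] inv[of "gen_b [^]\<^bsub>FG\<^esub> x"] b unfolding ga bk
        by (metis FG.int_pow_closed comp_id)
      finally show ?thesis using BS_rel_closed by (simp add: Z.act_kernel_def)
    qed
    then have "BSN M x \<subseteq> Z.act_kernel"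
      using Z.normal_act_kernel by (auto simp: BSN_def)
    then show "word_act Z.T w ([], 0) = ([], 0)"
      using \<open>w \<in> BSN M x\<close> by (auto simp: Z.act_kernel_def)
  next
    assume w0: "word_act Z.T w ([], 0) = ([], 0)"
    have rel: "?p gen_a \<otimes>\<^bsub>?Q\<^esub> ?p gen_b [^]\<^bsub>?Q\<^esub> M \<otimes>\<^bsub>?Q\<^esub> inv\<^bsub>?Q\<^esub> (?p gen_a) = ?p gen_b [^]\<^bsub>?Q\<^esub> x"
    proof -
      have eq: "g = h" if "g \<otimes>\<^bsub>?Q\<^esub> inv\<^bsub>?Q\<^esub> h = \<one>\<^bsub>?Q\<^esub>" "g \<in> carrier ?Q" "h \<in> carrier ?Q" for g h
        using that Q.inv_equality[of g "inv\<^bsub>?Q\<^esub> h"] by (simp only: Q.inv_inv Q.inv_closed)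
      have "?p (BS_rel M x) = \<one>\<^bsub>?Q\<^esub>"
        using in_normal_iff[OF normal_BSN BS_rel_closed] BS_rel_in_BSN one by simp
      then have "?p gen_a \<otimes>\<^bsub>?Q\<^esub> ?p gen_b [^]\<^bsub>?Q\<^esub> M \<otimes>\<^bsub>?Q\<^esub> inv\<^bsub>?Q\<^esub> (?p gen_a) \<otimes>\<^bsub>?Q\<^esub>
        inv\<^bsub>?Q\<^esub> (?p gen_b [^]\<^bsub>?Q\<^esub> x) = \<one>\<^bsub>?Q\<^esub>"
        unfolding BS_rel_def using a b
        by (simp only: p.hom_mult p.hom_inv p.hom_int_pow FG.m_closed FG.inv_closed FG.int_pow_closed)
      moreover have "?p gen_a \<in> carrier ?Q" "?p gen_b \<in> carrier ?Q"
        using a b p.hom_closed by blast+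
      ultimately show ?thesis
        by (intro eq[of _ "?p gen_b [^]\<^bsub>?Q\<^esub> x"] Q.m_closed Q.inv_closed Q.int_pow_closed)
    qed
    interpret B: bs_relation ?Q "?p gen_a" "?p gen_b" M x
      by unfold_locales (use a b rel M x in auto)
    have ev: "B.ev l = ?p [l]" for l
    proof -
      obtain g i where l: "l = (g, i)" by (cases l)
      have inv: "inv\<^bsub>FG\<^esub> [(g, False)] = [(g, True)]"
        by (rule FG.inv_equality) (auto simp: reduce_def cons_red_def inv_letter_def)
      have "[(g, False)] \<in> carrier FG" by simp
      from p.hom_inv[OF this] have pinv: "inv\<^bsub>?Q\<^esub> (?p [(g, False)]) = ?p [(g, True)]"
        unfolding inv by simp
      have "?p gen_b [^]\<^bsub>?Q\<^esub> (1::int) = ?p gen_b" "?p gen_b [^]\<^bsub>?Q\<^esub> (- 1::int) = inv\<^bsub>?Q\<^esub> (?p gen_b)"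
        using p.hom_closed[OF b] Q.int_pow_1 Q.int_pow_neg[of "?p gen_b" 1] by auto
      then show ?thesis
        using pinv unfolding l B.ev_def B.A_def fst_conv snd_conv
        by (cases g; cases i) (simp_all add: gen_a_def gen_b_def)
    qed
    have "foldr (\<lambda>l g. B.ev l \<otimes>\<^bsub>?Q\<^esub> g) v \<one>\<^bsub>?Q\<^esub> = ?p v" if "reduced v" for v
      using that
    proof (induction v)
      case Nil
      have "?p \<one>\<^bsub>FG\<^esub> = \<one>\<^bsub>?Q\<^esub>" by (rule p.hom_one)
      then show ?case by simp
    next
      case (Cons l v)
      have r: "reduced v" using Cons.prems reduced_ConsD by blast
      have "?p [l] \<otimes>\<^bsub>?Q\<^esub> ?p v = ?p ([l] \<otimes>\<^bsub>FG\<^esub> v)" using r by (intro p.hom_mult[symmetric]) auto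
      also have "[l] \<otimes>\<^bsub>FG\<^esub> v = l # v" using reduce_id[OF Cons.prems] by simp
      finally show ?case using Cons r ev by simp
    qed
    from this[OF w] B.val_word_act[of w] w0 have "?p w = \<one>\<^bsub>?Q\<^esub>" by simp
    then show "w \<in> BSN M x" using in_normal_iff[OF normal_BSN] w one by simp
  qed
qed

section \<open>Limits of Baumslag-Solitar groups\<close>

text \<open>The additive homomorphism from \<int>[X] to \<int> with values \<open>u i\<close> on the
  basis. Polynomials serve as the free abelian group on the powers of \<open>X\<close>, and their
  degree will be the decisive invariant.\<close>

definition lin :: "(nat \<Rightarrow> int) \<Rightarrow> int poly \<Rightarrow> int" where
  "lin u P = (\<Sum>i\<le>degree P. coeff P i * u i)"

lemma lin_ge: "degree P \<le> n \<Longrightarrow> lin u P = (\<Sum>i\<le>n. coeff P i * u i)"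
  unfolding lin_def by (rule sum.mono_neutral_left) (auto simp: coeff_eq_0)

lemma lin_add: "lin u (P + Q) = lin u P + lin u Q"
proof -
  define n where "n = max (degree P) (degree Q)"
  have "degree (P + Q) \<le> n" "degree P \<le> n" "degree Q \<le> n"
    using degree_add_le_max[of P Q] by (auto simp: n_def)
  then show ?thesis by (simp add: lin_ge[of _ n] sum.distrib algebra_simps)
qed

lemma lin_uminus: "lin u (- P) = - lin u P"
  by (simp add: lin_def sum_negf)

lemma lin_diff: "lin u (P - Q) = lin u P - lin u Q"
  using lin_add[of u P "- Q"] by (simp add: lin_uminus)

lemma lin_const [simp]: "lin u [:c:] = c * u 0"
  by (simp add: lin_def)

lemma lin_pCons: "lin u (pCons c P) = c * u 0 + lin (\<lambda>i. u (Suc i)) P"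
proof -
  have "degree (pCons c P) \<le> Suc (degree P)" by (simp add: degree_pCons_le)
  then have "lin u (pCons c P) = (\<Sum>i\<le>Suc (degree P). coeff (pCons c P) i * u i)" by (rule lin_ge)
  then show ?thesis by (simp only: sum.atMost_Suc_shift coeff_pCons_0 coeff_pCons_Suc lin_def)
qed

lemma lin_monom [simp]: "lin u (monom c n) = c * u n"
  using lin_ge[OF degree_monom_le, of u c n] by (simp add: if_distrib[of "\<lambda>x. x * _"] cong: if_cong)

lemma lin_0 [simp]: "lin u 0 = 0"
  by (simp add: lin_def)

lemma lin_smult: "lin u (smult c P) = c * lin u P"
  using lin_ge[OF degree_smult_le, of u c P] by (simp add: lin_def sum_distrib_left algebra_simps)

lemma lin_mult: "lin (\<lambda>i. c * u i) P = c * lin u P"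
  by (simp add: lin_def sum_distrib_left algebra_simps)

lemma lin_add_fun: "lin (\<lambda>i. u i + v i) P = lin u P + lin v P"
  by (simp add: lin_def sum.distrib algebra_simps)

lemma lin_cong: "(\<And>i. i \<le> degree P \<Longrightarrow> u i = v i) \<Longrightarrow> lin u P = lin v P"
  by (simp add: lin_def)

text \<open>For an integer argument the \<open>s\<^sub>i\<close> are integers, so quotient and
  remainder are \<open>div\<close> and \<open>mod\<close>.\<close>

fun ss :: "int \<Rightarrow> int \<Rightarrow> nat \<Rightarrow> int" where
  "ss M x 0 = 1"
| "ss M x (Suc i) = (x * ss M x i) div M"

text \<open>The value at \<open>0\<close> is \<open>1\<close> rather than \<open>0\<close>, which makes \<open>lin r\<close> the homomorphism
with \<open>e\<^sub>0 \<mapsto> 1\<close> and \<open>e\<^sub>i \<mapsto> r\<^sub>i\<close> whose reduction modulo \<open>m\<close> has kernel \<open>E\<^bsub>m,\<xi>\<^esub>\<close>.\<close>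

fun rr :: "int \<Rightarrow> int \<Rightarrow> nat \<Rightarrow> int" where
  "rr M x 0 = 1"
| "rr M x (Suc i) = (x * ss M x i) mod M"

lemma ss_rr: "x * ss M x i = M * ss M x (Suc i) + rr M x (Suc i)"
  by simp

lemma rr_bound: "M > 0 \<Longrightarrow> i > 0 \<Longrightarrow> 0 \<le> rr M x i \<and> rr M x i < M"
  by (cases i) auto

text \<open>Each division by \<open>M = d * K\<close> costs one factor \<open>K\<close> of
  precision; the factor \<open>d\<close> is regained at every step because \<open>d\<close> divides
  \<open>x'\<close>. The case \<open>d = 1\<close> shows that digits are continuous, the case of the
  gcd gives one half of the final comparison.\<close>

lemma rr_cong:
  assumes M: "M = d * K" "d > 0" "K > 0" and d: "d dvd x'" and dvd: "d * K ^ n dvd x - x'"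
    and i: "i \<le> n"
  shows "K ^ (n - i) dvd ss M x i - ss M x' i \<and> rr M x i = rr M x' i"
  using i
proof (induction i)
  case (Suc i)
  define D where "D = x * ss M x i - x' * ss M x' i"
  have "K ^ (n - i) dvd ss M x i - ss M x' i" using Suc by simp
  then have 1: "d * K ^ (n - i) dvd x' * (ss M x i - ss M x' i)" using d by (rule mult_dvd_mono[rotated])
  have "d * K ^ (n - i) dvd d * K ^ n" by (simp add: le_imp_power_dvd)
  then have 2: "d * K ^ (n - i) dvd (x - x') * ss M x i" using dvd by (meson dvd_mult2 dvd_trans)
  have "D = x' * (ss M x i - ss M x' i) + (x - x') * ss M x i" by (simp add: D_def algebra_simps)
  then have D: "d * K ^ (n - i) dvd D" using dvd_add[OF 1 2] by simp
  have e: "d * K ^ (n - i) = M * K ^ (n - Suc i)"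
    using Suc.prems M by (simp add: Suc_diff_Suc flip: power_Suc)
  then have "M dvd D" using D by (metis dvd_mult_left)
  then have r: "rr M x (Suc i) = rr M x' (Suc i)" by (simp add: D_def mod_eq_dvd_iff)
  have "D = M * (ss M x (Suc i) - ss M x' (Suc i))"
    using ss_rr[of x M i] ss_rr[of x' M i] r unfolding D_def by (simp only: right_diff_distrib)
  then have "K ^ (n - Suc i) dvd ss M x (Suc i) - ss M x' (Suc i)"
    using D e M by (metis dvd_mult_cancel_left less_irrefl mult_pos_pos)
  then show ?case using r by simp
qed simp

text \<open>In \<open>BS(M,x)\<close> the generator \<open>e\<^sub>i\<close> of the limit becomes the power of \<open>b\<close> with exponent \<open>psi M x i\<close>.\<close>

fun psi :: "int \<Rightarrow> int \<Rightarrow> nat \<Rightarrow> int" where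
  "psi M x 0 = 1"
| "psi M x (Suc i) = x * ss M x i"

section \<open>The limit group as an HNN extension of \<int>[X]\<close>

definition Prep :: "int \<Rightarrow> (nat \<Rightarrow> int) \<Rightarrow> bool \<Rightarrow> int poly \<Rightarrow> int poly" where
  "Prep M r e P = (if e then [:coeff P 0:] else [:lin r P mod M:])"

text \<open>In the basis \<open>M e\<^sub>0\<close>, \<open>e\<^sub>i - r\<^sub>i e\<^sub>0\<close>
  of its domain, \<open>P\<close> has the coefficients \<open>lin r P div M\<close> and
  \<open>coeff P i\<close>; so \<phi> (index \<open>False\<close>) replaces the constant coefficient
  and shifts. In the inverse the constant is chosen to make \<open>lin r\<close> of the result equal
  to \<open>M * coeff P 1\<close>.\<close>

definition Pph :: "int \<Rightarrow> (nat \<Rightarrow> int) \<Rightarrow> bool \<Rightarrow> int poly \<Rightarrow> int poly" where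
  "Pph M r e P = (if e then let Q = poly_shift 1 P in Q + [:M * coeff Q 0 - lin r Q:]
    else pCons 0 (P + [:lin r P div M - coeff P 0:]))"

lemma pCons_poly_shift: "coeff P 0 = 0 \<Longrightarrow> pCons 0 (poly_shift (Suc 0) P) = P"
  by (simp add: poly_eq_iff coeff_pCons coeff_poly_shift split: nat.split)

lemma poly_shift_add: "poly_shift n (P + Q) = poly_shift n P + poly_shift n Q"
  by (simp add: poly_eq_iff coeff_poly_shift)

lemma poly_shift_pCons: "poly_shift (Suc 0) (pCons c P) = P"
  by (simp add: poly_eq_iff coeff_poly_shift)

lemma hnn_P:
  assumes M: "M > 0" and r: "r 0 = 1"
  shows "hnn (Prep M r) (Pph M r)"
proof
  fix e :: bool and P Q :: "int poly"
  have F0: "Prep M r False P = 0 \<longleftrightarrow> M dvd lin r P" and T0: "Prep M r True P = 0 \<longleftrightarrow> coeff P 0 = 0" for P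
    by (auto simp: Prep_def dvd_eq_mod_eq_0)
  show "Prep M r e 0 = 0" by (simp add: Prep_def)
  show "Prep M r e (P - Prep M r e P) = 0"
    by (simp add: Prep_def lin_diff r minus_mod_eq_mult_div)
  show "Prep M r e (P + Q) = Prep M r e P" if "Prep M r e Q = 0"
    using that by (cases e) (auto simp: Prep_def lin_add elim!: dvdE)
  show "Pph M r e (P + Q) = Pph M r e P + Pph M r e Q" if "Prep M r e P = 0" "Prep M r e Q = 0"
  proof (cases e)
    case True
    then show ?thesis by (simp add: Pph_def Let_def poly_shift_add lin_add algebra_simps)
  next
    case False
    then have "M dvd lin r P" using that F0 by simp
    then show ?thesis using False div_plus_div_distrib_dvd_left[of M "lin r P" "lin r Q"]
      by (simp add: Pph_def lin_add algebra_simps)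
  qed
  have Fph: "lin r (Pph M r True P) = M * coeff P 1" for P
    by (simp add: Pph_def Let_def lin_add r coeff_poly_shift)
  show "Prep M r (\<not> e) (Pph M r e P) = 0" if "Prep M r e P = 0"
    using Fph[of P] by (cases e) (auto simp: F0 T0 Pph_def)
  show "Pph M r (\<not> e) (Pph M r e P) = P" if P0: "Prep M r e P = 0"
  proof (cases e)
    case True
    then have P: "pCons 0 (poly_shift (Suc 0) P) = P" using P0 T0 pCons_poly_shift by simp
    have "Pph M r False (Pph M r True P) =
      pCons 0 (Pph M r True P + [:coeff P 1 - coeff (Pph M r True P) 0:])"
      unfolding Pph_def[of M r False] using Fph[of P] M by simp
    also have "Pph M r True P + [:coeff P 1 - coeff (Pph M r True P) 0:] = poly_shift (Suc 0) P"
      by (simp add: Pph_def Let_def poly_eq_iff coeff_pCons coeff_poly_shift split: nat.split)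
    finally show ?thesis using True P by simp
  next
    case False
    then obtain j where j: "lin r P = M * j" using P0 F0 by auto
    define R where "R = P + [:j - coeff P 0:]"
    have ph: "Pph M r False P = pCons 0 R" using j M by (simp add: Pph_def R_def)
    have "Pph M r True (pCons 0 R) = R + [:M * coeff R 0 - lin r R:]"
      by (simp add: Pph_def Let_def poly_shift_pCons)
    also have "\<dots> = P" using j r by (simp add: R_def lin_add)
    finally show ?thesis using False ph by simp
  qed
qed

definition approx :: "int \<Rightarrow> (nat \<Rightarrow> int) \<Rightarrow> (nat \<Rightarrow> int) \<Rightarrow> bool" where
  "approx M r s \<longleftrightarrow> filterlim (\<lambda>n. \<bar>s n\<bar>) at_top sequentially \<and>
    (\<forall>i. \<forall>\<^sub>F n in sequentially. rr M (s n) i = r i)"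

text \<open>Only the digit sequence enters, which keeps \<int>_m out of the group theory. The
  approximating sequence guarantees that \<open>r\<close> is a possible digit sequence and is also
  the source of freeness.\<close>

locale bs_limit =
  fixes M :: int and r :: "nat \<Rightarrow> int"
  assumes M: "M > 0" and ex_approx: "\<exists>s. approx M r s"
begin

lemma r_eq: "\<exists>x. r i = rr M x i"
proof -
  obtain s where "approx M r s" using ex_approx by blast
  then have "\<forall>\<^sub>F n in sequentially. rr M (s n) i = r i" by (auto simp: approx_def)
  then show ?thesis by (auto simp: eventually_sequentially) (metis order_refl)
qed

lemma r_0: "r 0 = 1"
  using r_eq[of 0] by simp

lemma r_bound: "i > 0 \<Longrightarrow> 0 \<le> r i \<and> r i < M"
  using r_eq[of i] rr_bound[OF M] by auto

sublocale hnn "Prep M r" "Pph M r" 1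
  by (rule hnn_P) (rule M, rule r_0)

lemma rep_True: "Prep M r True P = 0 \<longleftrightarrow> coeff P 0 = 0"
  and rep_False: "Prep M r False P = 0 \<longleftrightarrow> M dvd lin r P"
  by (auto simp: Prep_def dvd_eq_mod_eq_0)

lemma eop_in_G: "eop P \<in> G"
proof -
  have add: "eop (P + Q) \<in> G" if "eop P \<in> G" "eop Q \<in> G" for P Q
    using that G_comp by (simp add: eop_add)
  have minus: "eop (- P) \<in> G" if P: "eop P \<in> G" for P
  proof -
    obtain h where h: "h \<in> G" "h \<circ> eop P = id" using G_inv[OF P] by blast
    then have "h = eop (- P)" using eop_uminus(2)[of P] by (metis comp_assoc comp_id id_comp)
    then show ?thesis using h by simp
  qed
  have zero: "eop 0 \<in> G" using G_id eop_0 by simp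
  have smult: "eop (smult c P) \<in> G" if "eop P \<in> G" for c P
  proof -
    have nat: "eop (smult (int n) P) \<in> G" for n
      by (induction n) (auto simp: zero smult_add_left intro: add that)
    show ?thesis
    proof (cases c rule: int_cases2)
      case (nonpos n)
      then show ?thesis using minus[OF nat[of n]] by simp
    qed (use nat in auto)
  qed
  have one: "eop 1 \<in> G" by (rule eop_\<beta>_in_G)
  have phi: "eop (Pph M r False P) \<in> G" if "eop P \<in> G" "M dvd lin r P" for P
  proof -
    have "aop True \<circ> eop P = eop (Pph M r False P) \<circ> aop True"
      using aop_eop[of True P] that rep_False by simp
    then have "eop (Pph M r False P) = aop True \<circ> eop P \<circ> aop False"
      using aop_aop[of True] by (metis comp_assoc comp_id)
    then show ?thesis using G_comp aop_in_G that by simp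
  qed
  have monom: "eop (monom 1 i) \<in> G" for i
  proof (induction i)
    case 0
    then show ?case using one by simp
  next
    case (Suc i)
    show ?case
    proof (cases i)
      case 0
      have "Pph M r False [:M:] = monom 1 (Suc i)" using M 0 r_0 by (simp add: Pph_def monom_Suc)
      moreover have "eop [:M:] \<in> G" using smult[OF one, of M] by (simp add: one_pCons)
      ultimately show ?thesis using phi[of "[:M:]"] r_0 by simp
    next
      case (Suc i')
      let ?P = "monom 1 i + smult (- r i) 1"
      have l: "lin r ?P = 0" by (simp add: lin_add lin_smult one_pCons r_0)
      then have "Pph M r False ?P = monom 1 (Suc i)"
        using Suc by (simp add: Pph_def monom_Suc one_pCons)
      then show ?thesis using phi[of ?P] l add[OF Suc.IH smult[OF one]] by simp
    qed
  qed
  have "eop (\<Sum>i\<in>A. monom (coeff P i) i) \<in> G" if "finite A" for A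
    using that
  proof (induction A rule: finite_induct)
    case (insert i A)
    have "monom (coeff P i) i = smult (coeff P i) (monom 1 i)" by (simp add: smult_monom)
    then show ?case using insert add smult monom by simp
  qed (simp add: zero)
  from this[of "{..degree P}"] show ?thesis by (simp add: poly_as_sum_of_monoms)
qed

section \<open>Comparison with the approximating groups\<close>

context
  fixes s assumes s: "approx M r s"
begin

abbreviation \<psi> where "\<psi> n \<equiv> lin (psi M (s n))"

lemma ev_large: "\<forall>\<^sub>F n in sequentially. \<bar>s n\<bar> > k"
proof -
  have "\<forall>\<^sub>F n in sequentially. \<bar>s n\<bar> \<ge> k + 1"
    using s by (auto simp: approx_def filterlim_at_top)
  then show ?thesis by eventually_elim simp
qed

lemma ev_nz: "\<forall>\<^sub>F n in sequentially. s n \<noteq> 0"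
  using ev_large[of 0] by eventually_elim auto

lemma ev_r: "\<forall>\<^sub>F n in sequentially. \<forall>i\<le>k. rr M (s n) i = r i"
  using s by (simp add: approx_def eventually_ball_finite_distrib flip: ball_simps(9) atMost_iff Ball_def)

lemma ev_lin: "\<forall>\<^sub>F n in sequentially. lin (rr M (s n)) P = lin r P"
  using ev_r[of "degree P"] by eventually_elim (auto intro: lin_cong)

text \<open>By \<open>ss_rr\<close> the exponent \<open>psi M x i\<close> is congruent to the digit
  \<open>rr M x i\<close> modulo \<open>M\<close>.\<close>

lemma psi_mod: "M dvd \<psi> n P - lin (rr M (s n)) P"
proof -
  have "psi M (s n) i = M * (if i = 0 then 0 else ss M (s n) i) + rr M (s n) i" for i
    using ss_rr[of "s n" M "i - 1"] by (cases i) (simp_all del: ss.simps rr.simps add: ss.simps(1) rr.simps(1))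
  then have "\<psi> n P = lin (\<lambda>i. M * (if i = 0 then 0 else ss M (s n) i) + rr M (s n) i) P"
    by (rule lin_cong)
  then show ?thesis by (simp only: lin_add_fun lin_mult) simp
qed

lemma psi_coeff_0: "s n dvd \<psi> n P - coeff P 0"
proof -
  obtain c Q where P: "P = pCons c Q" by (cases P)
  have "lin (\<lambda>i. psi M (s n) (Suc i)) Q = s n * lin (ss M (s n)) Q"
    by (simp add: lin_mult)
  then show ?thesis by (simp add: P lin_pCons)
qed

text \<open>Modulo \<open>s n\<close> only the constant coefficient survives, and
  \<open>smod\<close> returns it once \<open>s n\<close> is more than twice as large. Modulo
  \<open>M\<close> the exponents become the digits, which are eventually those of
  \<open>r\<close>.\<close>

lemma ev_rep: "\<forall>\<^sub>F n in sequentially. Zrep M (s n) e (\<psi> n P) = \<psi> n (Prep M r e P)"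
proof (cases e)
  case True
  have "\<forall>\<^sub>F n in sequentially. smod (s n) (\<psi> n P) = coeff P 0"
    using ev_large[of "2 * \<bar>coeff P 0\<bar>"]
  proof eventually_elim
    case (elim n)
    have "smod (s n) (\<psi> n P) = smod (s n) (coeff P 0)"
      using smod_add[OF psi_coeff_0[of n P], of "coeff P 0"] by simp
    then show ?case using smod_small elim by simp
  qed
  then show ?thesis using True by (simp add: Zrep_def Prep_def)
next
  case False
  have "\<forall>\<^sub>F n in sequentially. \<psi> n P mod M = lin r P mod M"
    using ev_lin[of P]
  proof eventually_elim
    case (elim n)
    then show ?case using psi_mod[of n P] by (simp add: mod_eq_dvd_iff)
  qed
  then show ?thesis using False by (simp add: Zrep_def Prep_def)
qed

text \<open>On exponents, conjugation by \<open>a\<close> in \<open>BS(M,x)\<close> is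
  multiplication by \<open>x / M\<close>. The recursion \<open>ss_rr\<close> is made so that
  \<open>\<psi> n\<close> turns \<phi> into this map, here with the denominator cleared.\<close>

lemma ev_phi:
  assumes "M dvd lin r P"
  shows "\<forall>\<^sub>F n in sequentially. M * \<psi> n (Pph M r False P) = s n * \<psi> n P"
  using ev_lin[of P]
proof eventually_elim
  case (elim n)
  obtain c Q where P: "P = pCons c Q" by (cases P)
  let ?x = "s n" and ?s = "ss M (s n)"
  define j where "j = lin r P div M"
  have j: "lin r P = M * j" using assms by (simp add: j_def)
  have ph: "Pph M r False P = pCons 0 (pCons j Q)" by (simp add: Pph_def P j_def)
  have "\<psi> n (Pph M r False P) = ?x * j + lin (\<lambda>i. ?x * ?s (Suc i)) Q"
    unfolding ph by (simp add: lin_pCons del: ss.simps(2))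
  then have "M * \<psi> n (Pph M r False P) = ?x * (M * j + lin (\<lambda>i. M * ?s (Suc i)) Q)"
    by (simp only: lin_mult) (simp only: algebra_simps)
  also have "lin (\<lambda>i. M * ?s (Suc i)) Q = lin (\<lambda>i. psi M ?x (Suc i)) Q - lin (\<lambda>i. rr M ?x (Suc i)) Q"
  proof -
    have "psi M ?x (Suc i) = M * ?s (Suc i) + rr M ?x (Suc i)" for i
      using ss_rr[of ?x M i] by (simp only: psi.simps)
    then show ?thesis by (simp only: lin_add_fun add_diff_cancel_right')
  qed
  also have "M * j = c + lin (\<lambda>i. rr M ?x (Suc i)) Q"
    using j elim by (simp only: P lin_pCons rr.simps(1) mult_1_right)
  also have "c + lin (\<lambda>i. rr M ?x (Suc i)) Q + (lin (\<lambda>i. psi M ?x (Suc i)) Q - lin (\<lambda>i. rr M ?x (Suc i)) Q) = \<psi> n P"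
    by (simp add: P lin_pCons del: psi.simps(2) rr.simps(2))
  finally show ?case .
qed

lemma ev_ph:
  assumes "Prep M r e P = 0"
  shows "\<forall>\<^sub>F n in sequentially. Zph M (s n) e (\<psi> n P) = \<psi> n (Pph M r e P)"
proof (cases e)
  case False
  then have d: "M dvd lin r P" using assms rep_False by simp
  show ?thesis using ev_phi[OF d] ev_lin[of P]
  proof eventually_elim
    case (elim n)
    have "M dvd \<psi> n P" using dvd_add[OF psi_mod[of n P], of "lin r P"] elim(2) d by simp
    then obtain j where j: "\<psi> n P = M * j" by auto
    then have "\<psi> n (Pph M r False P) = s n * j" using elim(1) M by (simp add: mult.left_commute)
    then show ?case using False j M by (simp add: Zph_def)
  qed
next
  case True
  let ?P = "Pph M r True P"
  have d: "M dvd lin r ?P" using rep_ph[of True P] assms True rep_False by simp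
  have P: "Pph M r False ?P = P" using ph_ph[of True P] assms True by simp
  show ?thesis using ev_phi[OF d] ev_lin[of ?P] ev_nz
  proof eventually_elim
    case (elim n)
    have "M dvd \<psi> n ?P" using dvd_add[OF psi_mod[of n ?P], of "lin r ?P"] elim(2) d by simp
    then obtain j where j: "\<psi> n ?P = M * j" by auto
    then have "\<psi> n P = s n * j" using elim(1) M unfolding P by (simp add: mult.left_commute)
    then show ?case using True j elim by (simp add: Zph_def)
  qed
qed

text \<open>A nonzero constant coefficient is visible modulo \<open>s n\<close>. Otherwise
  \<open>P\<close> is \<phi> of a nonzero polynomial of smaller degree, and \<open>ev_phi\<close>
  transfers nonvanishing.\<close>

lemma ev_nonzero: "P \<noteq> 0 \<Longrightarrow> \<forall>\<^sub>F n in sequentially. \<psi> n P \<noteq> 0"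
proof (induction "degree P" arbitrary: P rule: less_induct)
  case less
  show ?case
  proof (cases "coeff P 0 = 0")
    case False
    show ?thesis using ev_rep[of True P] ev_nz
    proof eventually_elim
      case (elim n)
      then show ?case using False smod_eq_0_iff[of "s n" 0] by (auto simp: Zrep_def Prep_def)
    qed
  next
    case True
    let ?P = "Pph M r True P"
    have T: "Prep M r True P = 0" using True rep_True by simp
    have P: "Pph M r False ?P = P" and d: "M dvd lin r ?P"
      using ph_ph[OF T] rep_ph[OF T] rep_False by auto
    have nz: "?P \<noteq> 0" using P less.prems ph_0[of False] by auto
    have "degree P \<noteq> 0" using True less.prems
      by (metis leading_coeff_0_iff)
    moreover have "degree ?P \<le> degree (poly_shift 1 P)"
      unfolding Pph_def Let_def by (simp add: degree_add_le)
    moreover have "degree P = Suc (degree (poly_shift 1 P))"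
      using pCons_poly_shift[OF True] less.prems
      by (metis One_nat_def degree_pCons_eq pCons_0_0)
    ultimately have "degree ?P < degree P" by simp
    from less.hyps[OF this nz] ev_phi[OF d] ev_nz show ?thesis
    proof eventually_elim
      case (elim n)
      then show ?case unfolding P using M by auto
    qed
  qed
qed

lemma ev_eq_0: "\<forall>\<^sub>F n in sequentially. \<psi> n P = 0 \<longleftrightarrow> P = 0"
  using ev_nonzero[of P] by (cases "P = 0") (auto elim: eventually_mono)

abbreviation Zv where "Zv n \<equiv> hnn.vE (Zrep M (s n)) (Zph M (s n))"
abbreviation Zc where "Zc n \<equiv> hnn.cE (Zrep M (s n)) (Zph M (s n))"
abbreviation \<psi>l where "\<psi>l n \<equiv> map (\<lambda>p. (fst p, \<psi> n (snd p)))"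

lemma ev_hnn: "\<forall>\<^sub>F n in sequentially. hnn (Zrep M (s n)) (Zph M (s n))"
  using ev_nz by eventually_elim (rule hnn_Z[OF M])

lemma ev_vE:
  "\<forall>\<^sub>F n in sequentially. Zv n (\<psi> n q) (\<psi>l n l) = \<psi>l n (vE q l) \<and> Zc n (\<psi> n q) (\<psi>l n l) = \<psi> n (cE q l)"
proof (induction l arbitrary: q)
  case Nil
  show ?case using ev_hnn by eventually_elim (simp add: hnn.vE.simps hnn.cE.simps)
next
  case (Cons p l)
  obtain e \<rho> where p: "p = (e, \<rho>)" by (cases p)
  show ?case
    using Cons.IH[of "nx e q \<rho>"] ev_rep[of e "q + \<rho>"] ev_ph[OF rep_diff[of e "q + \<rho>"]] ev_hnn
  proof eventually_elim
    case (elim n)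
    interpret Z: hnn "Zrep M (s n)" "Zph M (s n)" by fact
    have 1: "Zrep M (s n) e (\<psi> n q + \<psi> n \<rho>) = \<psi> n (Prep M r e (q + \<rho>))"
      using elim(2) by (simp add: lin_add)
    have 2: "Z.nx e (\<psi> n q) (\<psi> n \<rho>) = \<psi> n (nx e q \<rho>)"
      using elim(3) unfolding Z.nx_def nx_def 1 by (simp add: lin_add lin_diff)
    show ?case using elim(1) by (simp add: p 1 2)
  qed
qed

text \<open>Validity of the image list is left as a premise; \<open>ev_word_act\<close> obtains it
  from the target side, where every state reached from the base state is valid.\<close>

lemma ev_T:
  assumes "valid l"
  shows "\<forall>\<^sub>F n in sequentially. hnn.valid (Zrep M (s n)) (\<psi>l n l) \<longrightarrow>
    hnn.T (Zrep M (s n)) (Zph M (s n)) 1 c (\<psi>l n l, \<psi> n p) =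
    (\<psi>l n (fst (T c (l, p))), \<psi> n (snd (T c (l, p))))"
proof (cases "fst c")
  case True
  let ?q = "if snd c then - 1 else 1 :: int poly"
  show ?thesis using ev_vE[of ?q l] ev_hnn
  proof eventually_elim
    case (elim n)
    interpret Z: hnn "Zrep M (s n)" "Zph M (s n)" 1 by fact
    have "\<psi> n 1 = 1" by (simp add: one_pCons)
    then have q: "\<psi> n ?q = (if snd c then - 1 else 1)" by (simp add: lin_uminus)
    show ?case using elim(1) assms True unfolding q
      by (auto simp: Z.T_def T_def Z.eop_def eop_def lin_add)
  qed
next
  case False
  have "\<forall>\<^sub>F n in sequentially. hnn.push (\<not> snd c) (\<psi>l n l) = \<psi>l n (push (\<not> snd c) l)"
  proof (cases l)
    case Nil
    show ?thesis using ev_hnn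
      by eventually_elim (simp add: Nil push_def hnn.push_def)
  next
    case (Cons p l')
    \<comment> \<open>Cancellation tests a representative for 0, so \<open>\<psi> n\<close> must not
      kill a nonzero one.\<close>
    show ?thesis using ev_hnn ev_eq_0[of "snd p"]
      by eventually_elim (cases p; auto simp: Cons push_def hnn.push_def)
  qed
  then show ?thesis using ev_hnn
  proof eventually_elim
    case (elim n)
    interpret Z: hnn "Zrep M (s n)" "Zph M (s n)" 1 by fact
    show ?case using elim(1) assms False
      by (auto simp: Z.T_def T_def Z.aop_def aop_def)
  qed
qed

lemma ev_word_act:
  "\<forall>\<^sub>F n in sequentially. word_act (hnn.T (Zrep M (s n)) (Zph M (s n)) 1) w ([], 0) =
    (\<psi>l n (fst (word_act T w ([], 0))), \<psi> n (snd (word_act T w ([], 0))))"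
proof (induction w)
  case (Cons c w)
  define l where "l = fst (word_act T w ([], 0))"
  define p where "p = snd (word_act T w ([], 0))"
  have lp: "word_act T w ([], 0) = (l, p)" by (simp add: l_def p_def)
  have "valid l" using G_state[of "word_act T w" "[]" 0] lp by (auto simp: vm_def)
  from ev_T[OF this, of c p] Cons.IH ev_hnn show ?case
  proof eventually_elim
    case (elim n)
    interpret Z: hnn "Zrep M (s n)" "Zph M (s n)" 1 by fact
    have z: "word_act Z.T w ([], 0) = (\<psi>l n l, \<psi> n p)" using elim(2) lp by simp
    then have "Z.valid (\<psi>l n l)"
      using Z.G_state[of "word_act Z.T w" "[]" 0] by (auto simp: Z.vm_def)
    then show ?case using elim(1) z lp by simp
  qed
qed simp

lemma ev_BSN:
  assumes "reduced w"
  shows "\<forall>\<^sub>F n in sequentially. w \<in> BSN M (s n) \<longleftrightarrow> word_act T w ([], 0) = ([], 0)"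
  using ev_word_act[of w] ev_nz ev_eq_0[of "snd (word_act T w ([], 0))"]
proof eventually_elim
  case (elim n)
  show ?case unfolding BSN_word_act[OF M elim(2) assms] elim(1)
    using elim(3) by (auto simp: prod_eq_iff)
qed

end

text \<open>A word that fixes the base state lies in \<open>BSN M (s n)\<close> for large
  \<open>n\<close>. So do its conjugates, by normality, hence they fix the base state too; by
  transitivity the word fixes every valid state.\<close>

lemma free:
  assumes "g \<in> G" "g ([], 0) = ([], 0)"
  shows "g = id"
proof -
  obtain s where s: "approx M r s" using ex_approx by blast
  obtain w0 where "g = word_act T w0" using assms(1) by auto
  then obtain w where w: "reduced w" "g = word_act T w"
    using word_act_reduce[of w0] reduced_reduce by metis
  have "g (l, p) = (l, p)" if l: "valid l" for l p
  proof -
    obtain h where "h \<in> G" "h ([], 0) = (l, p)"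
      using transitive_states[OF eop_in_G l] by blast
    then obtain u0 where "word_act T u0 ([], 0) = (l, p)" by auto
    then obtain u where u: "reduced u" "word_act T u ([], 0) = (l, p)"
      using word_act_reduce[of u0] reduced_reduce by metis
    let ?v = "inv\<^bsub>FG\<^esub> u \<otimes>\<^bsub>FG\<^esub> w \<otimes>\<^bsub>FG\<^esub> u"
    have cu: "u \<in> carrier FG" "w \<in> carrier FG" using u w by simp_all
    then have v: "?v \<in> carrier FG" by (intro FG.m_closed FG.inv_closed)
    then have rv: "reduced ?v" by simp
    from ev_BSN[OF s w(1)] ev_BSN[OF s rv]
    have "\<forall>\<^sub>F n in sequentially. word_act T ?v ([], 0) = ([], 0)"
    proof eventually_elim
      case (elim n)
      have "w \<in> BSN M (s n)" using elim assms w by simp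
      then have "?v \<in> BSN M (s n)"
        using normal.inv_op_closed1[OF normal_BSN cu(1)] by blast
      then show ?case using elim by simp
    qed
    then have v0: "word_act T ?v ([], 0) = ([], 0)" by simp
    have "u \<otimes>\<^bsub>FG\<^esub> ?v = w \<otimes>\<^bsub>FG\<^esub> u"
      using cu by (metis FG.inv_closed FG.l_one FG.m_assoc FG.m_closed FG.r_inv)
    then have "word_act T (u \<otimes>\<^bsub>FG\<^esub> ?v) = word_act T (w \<otimes>\<^bsub>FG\<^esub> u)" by (rule arg_cong)
    then have "word_act T u \<circ> word_act T ?v = word_act T w \<circ> word_act T u"
      unfolding mult_FG[of u] mult_FG[of w] word_act_reduce word_act_append .
    then have "word_act T u (word_act T ?v ([], 0)) = word_act T w (word_act T u ([], 0))"
      by (metis comp_apply)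
    then show ?thesis unfolding v0 u(2) w(2) by simp
  qed
  moreover have "g s = s" if "\<not> valid (fst s)" for s
    using assms(1) that
    by (induction rule: G_induct) (simp_all add: aop_def eop_def)
  ultimately show ?thesis by (metis eq_id_iff prod.collapse)
qed

sublocale hnn_regular "Prep M r" "Pph M r" 1
  by unfold_locales (auto intro: eop_in_G free)

lemma ev_act_kernel:
  assumes "approx M r s" "reduced w"
  shows "\<forall>\<^sub>F n in sequentially. w \<in> BSN M (s n) \<longleftrightarrow> w \<in> act_kernel"
proof -
  have "word_act T w ([], 0) = ([], 0) \<longleftrightarrow> w \<in> act_kernel"
    using free[of "word_act T w"] assms(2) by (auto simp: act_kernel_def)
  then show ?thesis using ev_BSN[OF assms] by simp
qed

lemma G2_tendsto_act_kernel:
  assumes "approx M r s"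
  shows "G2_tendsto (\<lambda>n. BSN M (s n)) act_kernel"
  unfolding G2_tendsto_def
proof
  fix L
  have "finite {w :: letter list. set w \<subseteq> UNIV \<and> length w \<le> L}"
    by (rule finite_lists_length_le) simp
  then have "finite {w \<in> carrier FG. length w \<le> L}" by (rule rev_finite_subset) auto
  moreover have "\<forall>w\<in>{w \<in> carrier FG. length w \<le> L}. \<forall>\<^sub>F n in sequentially.
      w \<in> BSN M (s n) \<longleftrightarrow> w \<in> act_kernel"
    using ev_act_kernel[OF assms] by simp
  ultimately have "\<forall>\<^sub>F n in sequentially. \<forall>w\<in>{w \<in> carrier FG. length w \<le> L}.
      w \<in> BSN M (s n) \<longleftrightarrow> w \<in> act_kernel"
    by (rule eventually_ball_finite)
  then show "\<exists>n0. \<forall>n\<ge>n0. \<forall>w\<in>carrier FG. length w \<le> L \<longrightarrow>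
      (w \<in> BSN M (s n)) = (w \<in> act_kernel)"
    unfolding eventually_sequentially by blast
qed

end

section \<open>Identification of \<open>BSbar\<close>\<close>

lemma G2_tendsto_unique:
  assumes "G2_tendsto Ns N" "G2_tendsto Ns N'" "N \<subseteq> carrier FG" "N' \<subseteq> carrier FG"
  shows "N = N'"
proof -
  have "w \<in> N \<longleftrightarrow> w \<in> N'" if w: "w \<in> carrier FG" for w
  proof -
    obtain n0 n1 where "\<forall>n\<ge>n0. w \<in> Ns n \<longleftrightarrow> w \<in> N" "\<forall>n\<ge>n1. w \<in> Ns n \<longleftrightarrow> w \<in> N'"
      using assms(1,2) w unfolding G2_tendsto_def by (metis order_refl)
    then show ?thesis by (metis max.cobounded1 max.cobounded2)
  qed
  then show ?thesis using assms(3,4) by blast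
qed

text \<open>If one relator is \<open>u\<close> times the inverse of \<open>v\<close>, the other is
  the inverse of \<open>u\<close> times \<open>v\<close>; it arises by inverting and then
  conjugating with \<open>u\<close>.\<close>

lemma BSN_neg: "BSN (- p) (- q) = BSN p q"
proof -
  have sub: "BS_rel (- p) (- q) \<in> N" if N: "N \<lhd> FG" and pq: "BS_rel p q \<in> N" for N p q
  proof -
    interpret N: normal N FG by fact
    define u where "u = gen_a \<otimes>\<^bsub>FG\<^esub> (gen_b [^]\<^bsub>FG\<^esub> p) \<otimes>\<^bsub>FG\<^esub> inv\<^bsub>FG\<^esub> gen_a"
    define v where "v = gen_b [^]\<^bsub>FG\<^esub> q"
    have g: "gen_a \<in> carrier FG" "gen_b \<in> carrier FG" by simp_all
    have uv: "u \<in> carrier FG" "v \<in> carrier FG"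
      unfolding u_def v_def by (intro FG.m_closed FG.inv_closed FG.int_pow_closed g)+
    have "gen_a \<otimes>\<^bsub>FG\<^esub> (gen_b [^]\<^bsub>FG\<^esub> (- p)) \<otimes>\<^bsub>FG\<^esub> inv\<^bsub>FG\<^esub> gen_a = inv\<^bsub>FG\<^esub> u"
      unfolding u_def using g
      by (simp only: FG.inv_mult_group FG.int_pow_neg FG.inv_inv FG.m_closed FG.inv_closed FG.int_pow_closed FG.m_assoc)
    moreover have "inv\<^bsub>FG\<^esub> (gen_b [^]\<^bsub>FG\<^esub> (- q)) = v"
      unfolding v_def using g by (simp only: FG.int_pow_neg FG.inv_inv FG.int_pow_closed)
    ultimately have rel: "BS_rel (- p) (- q) = inv\<^bsub>FG\<^esub> u \<otimes>\<^bsub>FG\<^esub> v" by (simp only: BS_rel_def)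
    have "u \<otimes>\<^bsub>FG\<^esub> inv\<^bsub>FG\<^esub> v \<in> N" using pq by (simp only: BS_rel_def u_def v_def)
    then have "inv\<^bsub>FG\<^esub> (u \<otimes>\<^bsub>FG\<^esub> inv\<^bsub>FG\<^esub> v) \<in> N" by (rule N.m_inv_closed)
    then have "v \<otimes>\<^bsub>FG\<^esub> inv\<^bsub>FG\<^esub> u \<in> N" using uv by (simp only: FG.inv_mult_group FG.inv_inv FG.inv_closed)
    then have "inv\<^bsub>FG\<^esub> u \<otimes>\<^bsub>FG\<^esub> (v \<otimes>\<^bsub>FG\<^esub> inv\<^bsub>FG\<^esub> u) \<otimes>\<^bsub>FG\<^esub> u \<in> N"
      using N.inv_op_closed1[OF uv(1)] by blast
    moreover have "inv\<^bsub>FG\<^esub> u \<otimes>\<^bsub>FG\<^esub> (v \<otimes>\<^bsub>FG\<^esub> inv\<^bsub>FG\<^esub> u) \<otimes>\<^bsub>FG\<^esub> u = inv\<^bsub>FG\<^esub> u \<otimes>\<^bsub>FG\<^esub> v"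
      using uv by (simp only: FG.m_assoc FG.l_inv FG.r_one FG.inv_closed FG.m_closed)
    ultimately show ?thesis unfolding rel by simp
  qed
  have "BS_rel (- p) (- q) \<in> N \<longleftrightarrow> BS_rel p q \<in> N" if "N \<lhd> FG" for N
    using sub[OF that, of p q] sub[OF that, of "- p" "- q"] by auto
  then show ?thesis unfolding BSN_def by (metis (no_types, lifting))
qed

text \<open>Because of \<open>BS(m,n) = BS(-m,-n)\<close> the sign of \<open>m\<close> can be moved to \<open>\<xi>\<close>.  The \<open>i\<close>-th digit
depends on \<open>\<xi>\<close> only modulo \<open>\<bar>m\<bar>\<^sup>i\<close>.\<close>

definition digits :: "int \<Rightarrow> (nat \<Rightarrow> int) \<Rightarrow> nat \<Rightarrow> int" where
  "digits m \<xi> i = rr \<bar>m\<bar> (sgn m * \<xi> i) i"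

lemma Zadic_mod:
  assumes "\<xi> \<in> Zadic m" "j \<le> n"
  shows "\<xi> n mod \<bar>m\<bar> ^ j = \<xi> j"
  using assms(2)
proof (induction n)
  case 0
  have "0 \<le> \<xi> 0" "\<xi> 0 < \<bar>m\<bar> ^ 0" using assms(1) unfolding Zadic_def by blast+
  then show ?case using 0 by simp
next
  case (Suc n)
  show ?case
  proof (cases "j = Suc n")
    case True
    then show ?thesis using assms(1) unfolding Zadic_def by (metis (mono_tags, lifting) mem_Collect_eq mod_pos_pos_trivial)
  next
    case False
    then have "j \<le> n" using Suc.prems by simp
    have "\<xi> (Suc n) mod \<bar>m\<bar> ^ n = \<xi> n" using assms(1) by (auto simp: Zadic_def)
    then have "\<xi> n mod \<bar>m\<bar> ^ j = \<xi> (Suc n) mod \<bar>m\<bar> ^ j"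
      using mod_mod_cancel[of "\<bar>m\<bar> ^ j" "\<bar>m\<bar> ^ n" "\<xi> (Suc n)"] le_imp_power_dvd[OF \<open>j \<le> n\<close>, of "\<bar>m\<bar>"] by simp
    then show ?thesis using Suc.IH[OF \<open>j \<le> n\<close>] by simp
  qed
qed

lemma approx_adic:
  assumes m: "m \<noteq> 0" and s: "filterlim (\<lambda>n. \<bar>s n\<bar>) at_top sequentially" "adic_tendsto m s \<xi>"
    and \<xi>: "\<xi> \<in> Zadic m"
  shows "approx \<bar>m\<bar> (digits m \<xi>) (\<lambda>n. sgn m * s n)"
proof -
  have "\<bar>sgn m * s n\<bar> = \<bar>s n\<bar>" for n using m by (simp add: abs_mult abs_sgn_eq)
  moreover have "\<forall>\<^sub>F n in sequentially. rr \<bar>m\<bar> (sgn m * s n) i = digits m \<xi> i" for i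
  proof -
    obtain n0 where n0: "\<And>n. n \<ge> n0 \<Longrightarrow> s n mod \<bar>m\<bar> ^ i = \<xi> i"
      using s(2) by (auto simp: adic_tendsto_def)
    have "rr \<bar>m\<bar> (sgn m * s n) i = digits m \<xi> i" if "n \<ge> n0" for n
    proof -
      have "s n mod \<bar>m\<bar> ^ i = \<xi> i mod \<bar>m\<bar> ^ i"
        using n0[OF that] Zadic_mod[OF \<xi>, of i i] by simp
      then have "\<bar>m\<bar> ^ i dvd s n - \<xi> i" by (simp add: mod_eq_dvd_iff)
      then have "\<bar>m\<bar> ^ i dvd sgn m * s n - sgn m * \<xi> i"
        by (simp add: dvd_mult flip: right_diff_distrib)
      then show ?thesis
        using rr_cong[of "\<bar>m\<bar>" 1 "\<bar>m\<bar>" "sgn m * \<xi> i" i "sgn m * s n" i] m by (simp add: digits_def)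
    qed
    then show ?thesis by (auto simp: eventually_sequentially)
  qed
  ultimately show ?thesis using s(1) by (simp add: approx_def)
qed

lemma adic_sequence:
  assumes "m \<noteq> 0" "\<xi> \<in> Zadic m"
  shows "\<exists>s. filterlim (\<lambda>n. \<bar>s n\<bar>) at_top sequentially \<and> adic_tendsto m s \<xi>"
proof (intro exI conjI)
  \<comment> \<open>The second summand vanishes modulo all levels up to \<open>n\<close> and forces
    growth, even for \<open>\<bar>m\<bar> = 1\<close>.\<close>
  let ?s = "\<lambda>n. \<xi> n + \<bar>m\<bar> ^ n * int n"
  show "filterlim (\<lambda>n. \<bar>?s n\<bar>) at_top sequentially"
  proof (rule filterlim_at_top_mono)
    show "filterlim int at_top sequentially" by (rule filterlim_int_sequentially)
    have "int n \<le> \<bar>?s n\<bar>" for n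
    proof -
      have "\<xi> n \<ge> 0" using assms(2) by (auto simp: Zadic_def)
      moreover have "\<bar>m\<bar> ^ n * int n \<ge> 1 * int n"
        using assms(1) by (intro mult_right_mono) (auto intro: one_le_power)
      ultimately show ?thesis by linarith
    qed
    then show "\<forall>\<^sub>F n in sequentially. int n \<le> \<bar>?s n\<bar>" by simp
  qed
  show "adic_tendsto m ?s \<xi>"
    unfolding adic_tendsto_def
  proof (intro allI exI impI)
    fix j n :: nat assume "j \<le> n"
    then have "\<bar>m\<bar> ^ j dvd \<bar>m\<bar> ^ n * int n" by (simp add: le_imp_power_dvd dvd_mult2)
    then have "?s n mod \<bar>m\<bar> ^ j = \<xi> n mod \<bar>m\<bar> ^ j" by (simp add: mod_eq_dvd_iff)
    then show "?s n mod \<bar>m\<bar> ^ j = \<xi> j" using Zadic_mod[OF assms(2) \<open>j \<le> n\<close>] by simp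
  qed
qed

lemma bs_limit_digits:
  assumes "m \<noteq> 0" "\<xi> \<in> Zadic m"
  shows "bs_limit \<bar>m\<bar> (digits m \<xi>)"
  using adic_sequence[OF assms] approx_adic[OF assms(1) _ _ assms(2)] assms(1)
  by unfold_locales auto

lemma BSbar_eq:
  assumes "m \<noteq> 0" "\<xi> \<in> Zadic m"
  shows "BSbar m \<xi> = letter_act.act_kernel (hnn.T (Prep \<bar>m\<bar> (digits m \<xi>)) (Pph \<bar>m\<bar> (digits m \<xi>)) 1)"
proof -
  interpret bs_limit "\<bar>m\<bar>" "digits m \<xi>" by (rule bs_limit_digits[OF assms])
  have conv: "G2_tendsto (\<lambda>n. BSN m (s n)) act_kernel"
    if s: "filterlim (\<lambda>n. \<bar>s n\<bar>) at_top sequentially" "adic_tendsto m s \<xi>" for s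
  proof -
    have "BSN \<bar>m\<bar> (sgn m * s n) = BSN m (s n)" for n
      using assms(1) BSN_neg[of m "s n"] by (cases "m > 0") auto
    then show ?thesis using G2_tendsto_act_kernel[OF approx_adic[OF assms(1) s assms(2)]] by simp
  qed
  show ?thesis unfolding BSbar_def
  proof (rule the_equality)
    fix N assume N: "N \<lhd> FG \<and> (\<forall>s. filterlim (\<lambda>n. \<bar>s n\<bar>) at_top sequentially \<and> adic_tendsto m s \<xi> \<longrightarrow>
        G2_tendsto (\<lambda>n. BSN m (s n)) N)"
    obtain s where s: "filterlim (\<lambda>n. \<bar>s n\<bar>) at_top sequentially" "adic_tendsto m s \<xi>"
      using adic_sequence[OF assms] by blast
    show "N = act_kernel"
    proof (rule G2_tendsto_unique)
      show "G2_tendsto (\<lambda>n. BSN m (s n)) N" using N s by blast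
      show "G2_tendsto (\<lambda>n. BSN m (s n)) act_kernel" by (rule conv[OF s])
      show "N \<subseteq> carrier FG" using N normal_imp_subgroup subgroup.subset by blast
      show "act_kernel \<subseteq> carrier FG" by (auto simp: act_kernel_def)
    qed
  qed (use conv normal_act_kernel in blast)
qed

section \<open>Isomorphisms between limit groups\<close>

lemma comp_exchange: "f \<circ> g = g' \<circ> f' \<Longrightarrow> f \<circ> (g \<circ> h) = g' \<circ> (f' \<circ> h)"
  by (simp only: comp_assoc[symmetric])

context bs_limit
begin

text \<open>\<phi> is only partially defined, so it is treated as a relation; this gives meaning to
  all integer powers of it in \<open>phpow\<close>.\<close>

definition phrel :: "int poly \<Rightarrow> int poly \<Rightarrow> bool" where
  "phrel P Q \<longleftrightarrow> M dvd lin r P \<and> Q = Pph M r False P"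

definition phpow :: "int \<Rightarrow> int poly \<Rightarrow> int poly \<Rightarrow> bool" where
  "phpow h P Q \<longleftrightarrow> (if h \<ge> 0 then (phrel ^^ nat h) P Q else (phrel ^^ nat (- h)) Q P)"

lemma phrel_fun: "phrel P Q \<Longrightarrow> phrel P Q' \<Longrightarrow> Q = Q'"
  by (simp add: phrel_def)

lemma phrel_inj: "phrel P Q \<Longrightarrow> phrel P' Q \<Longrightarrow> P = P'"
  using ph_ph[of False P] ph_ph[of False P'] by (simp add: phrel_def rep_False)

lemma phpow_down:
  assumes "phrel q q'" "phpow k P q'"
  shows "phpow (k - 1) P q"
proof (cases "k \<ge> 1")
  case True
  then have "nat k = Suc (nat (k - 1))" by simp
  then obtain z where "(phrel ^^ nat (k - 1)) P z" "phrel z q'"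
    using assms(2) True by (auto simp: phpow_def)
  then show ?thesis using phrel_inj[OF assms(1)] True by (auto simp: phpow_def)
next
  case False
  then have "(phrel ^^ nat (- k)) q' P"
    using assms(2) by (cases "k = 0") (auto simp: phpow_def)
  then have "(phrel ^^ Suc (nat (- k))) q P" using assms(1) by (rule relpowp_Suc_I2[rotated])
  moreover have "nat (- (k - 1)) = Suc (nat (- k))" using False by simp
  ultimately show ?thesis using False by (simp add: phpow_def)
qed

lemma phpow_up:
  assumes "phrel q' q" "phpow k P q'"
  shows "phpow (k + 1) P q"
proof (cases "k \<ge> 0")
  case True
  then have "nat (k + 1) = Suc (nat k)" by simp
  then show ?thesis using assms True by (auto simp: phpow_def)
next
  case False
  then have "nat (- k) = Suc (nat (- (k + 1)))" by simp
  then obtain z where "phrel q' z" "(phrel ^^ nat (- (k + 1))) z P"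
    using assms(2) False relpowp_Suc_D2 by (metis phpow_def)
  then show ?thesis using phrel_fun[OF assms(1)] False by (cases "k = - 1") (auto simp: phpow_def)
qed

text \<open>Each syllable that \<open>q\<close> crosses applies \<phi> or its inverse. Opposite
  steps cancel because \<open>phrel\<close> is functional and injective, so only the height of the
  list counts.\<close>

lemma phpow_cE:
  assumes "valid l" "vE q l = l"
  shows "phpow (ht l) (cE q l) q"
  using assms
proof (induction l arbitrary: q)
  case Nil
  then show ?case by (simp add: phpow_def)
next
  case (Cons s l)
  obtain e \<rho> where s: "s = (e, \<rho>)" by (cases s)
  from vE_fix[OF Cons.prems[unfolded s]]
  have fx: "Prep M r e q = 0" "vE (Pph M r e q) l = l" "cE q (s # l) = cE (Pph M r e q) l"
    by (auto simp: s)
  have IH: "phpow (ht l) (cE q (s # l)) (Pph M r e q)"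
    unfolding fx(3) by (rule Cons.IH) (use Cons.prems s fx in auto)
  show ?case
  proof (cases e)
    case True
    have "phrel (Pph M r e q) q"
      using fx(1) True rep_ph[of True q] ph_ph[of True q] by (simp add: phrel_def rep_False)
    from phpow_up[OF this IH] show ?thesis by (simp add: s True add.commute)
  next
    case False
    have "phrel q (Pph M r e q)" using fx(1) False rep_False by (simp add: phrel_def)
    from phpow_down[OF this IH] show ?thesis by (simp add: s False)
  qed
qed

lemma conj_phpow:
  assumes "g \<in> G" "eop Q \<circ> g = g \<circ> eop P"
  shows "phpow (hgt g) P Q"
  using phpow_cE[of "vm g []" Q] conj_eop[OF assms] by (simp add: hgt_def)

text \<open>\<phi> changes the constant coefficient and then multiplies by \<open>X\<close>;
  injectivity prevents the changed polynomial from vanishing.\<close>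

lemma phrel_degree:
  assumes "phrel P Q"
  shows "(P = 0 \<longleftrightarrow> Q = 0) \<and> (P \<noteq> 0 \<longrightarrow> degree Q = Suc (degree P))"
proof -
  have Q: "Q = pCons 0 (P + [:lin r P div M - coeff P 0:])"
    using assms by (simp add: phrel_def Pph_def)
  have Q0: "P = 0 \<longleftrightarrow> Q = 0"
    using ph_ph[of False P] ph_0[of True] ph_0[of False] assms by (auto simp: phrel_def rep_False)
  moreover have "degree Q = Suc (degree P)" if "P \<noteq> 0"
  proof -
    let ?R = "P + [:lin r P div M - coeff P 0:]"
    have "?R \<noteq> 0" using Q0 Q that by auto
    then have "degree Q = Suc (degree ?R)" unfolding Q by (rule degree_pCons_eq)
    moreover have "degree ?R = degree P"
    proof (cases "degree P = 0")
      case True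
      then show ?thesis using degree_add_le[of P 0 "[:lin r P div M - coeff P 0:]"] by simp
    qed (simp add: degree_add_eq_left)
    ultimately show ?thesis by simp
  qed
  ultimately show ?thesis by blast
qed

lemma phpow_degree:
  assumes "phpow h P Q" "P \<noteq> 0"
  shows "Q \<noteq> 0" "int (degree Q) = int (degree P) + h"
proof -
  have pw: "(P = 0 \<longleftrightarrow> Q = 0) \<and> (P \<noteq> 0 \<longrightarrow> degree Q = degree P + k)" if "(phrel ^^ k) P Q" for k P Q
    using that
  proof (induction k arbitrary: Q)
    case (Suc k)
    then obtain z where "(phrel ^^ k) P z" "phrel z Q" by auto
    then show ?case using Suc.IH[of z] phrel_degree[of z Q] by auto
  qed auto
  show "Q \<noteq> 0" "int (degree Q) = int (degree P) + h"
    using assms pw[of "nat h" P Q] pw[of "nat (- h)" Q P] by (auto simp: phpow_def split: if_splits)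
qed

text \<open>If \<open>g\<close> moved the base vertex, \<open>b\<close> would fix the first edge on
  the way to \<open>vm g []\<close>, that is, \<open>e\<^sub>0\<close> would lie in \<phi>'s image
  \<open>X\<int>[X]\<close> or in its domain; the latter means \<open>M dvd 1\<close>.\<close>

lemma centralizer_one:
  assumes "M \<noteq> 1" "g \<in> G" "eop 1 \<circ> g = g \<circ> eop 1"
  shows "\<exists>q. g = eop q"
proof (cases "vm g []")
  case Nil
  then show ?thesis using stabilizer assms by blast
next
  case (Cons s l)
  obtain e \<rho> where "s = (e, \<rho>)" by (cases s)
  then have "Prep M r e 1 = 0" using vE_fix(1)[of e \<rho> l 1] conj_eop[OF assms(2,3)] Cons by auto
  then show ?thesis using assms(1) M r_0
    by (cases e) (auto simp: rep_True rep_False one_pCons zdvd1_eq)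
qed

text \<open>For \<open>M = 1\<close> every element of \<open>E\<close> can be moved across
  \<open>a\<close>, so finitely many elements of height 0 are conjugated into the abelian group
  \<open>E\<close> by one large power of \<open>a\<close>.\<close>

lemma height_zero_commute:
  assumes M1: "M = 1" and g: "g \<in> G" "hgt g = 0" and h: "h \<in> G" "hgt h = 0"
  shows "g \<circ> h = h \<circ> g"
proof -
  let ?a = "aop True"
  have up: "\<exists>Q. ?a \<circ> eop P = eop Q \<circ> ?a" for P
    using aop_eop[of True P] rep_False M1 by auto
  \<comment> \<open>\<open>N\<close> is taken large enough to absorb every inverse of
    \<open>a\<close> that occurs in \<open>g\<close>.\<close>
  have push: "\<exists>n. \<forall>N\<ge>n. int N + hgt g \<ge> 0 \<and> (\<exists>P. ?a ^^ N \<circ> g = eop P \<circ> ?a ^^ nat (int N + hgt g))"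
    if "g \<in> G" for g
    using that
  proof (induction rule: G_induct)
    case id
    have "?a ^^ N \<circ> id = eop 0 \<circ> ?a ^^ nat (int N + 0)" for N
      unfolding eop_0 comp_id id_comp by simp
    then show ?case unfolding hgt_simps(1) by (metis add.right_neutral of_nat_0_le_iff)
  next
    case (comp_a e g)
    then obtain n where n: "\<And>N. N \<ge> n \<Longrightarrow> int N + hgt g \<ge> 0 \<and> (\<exists>P. ?a ^^ N \<circ> g = eop P \<circ> ?a ^^ nat (int N + hgt g))"
      by blast
    have hg: "hgt (aop e \<circ> g) = (if e then 1 else - 1) + hgt g"
      using hgt_comp[OF aop_in_G comp_a(1)] by simp
    show ?case
    proof (intro exI[of _ "Suc n"] allI impI)
      fix N assume N: "N \<ge> Suc n"
      show "int N + hgt (aop e \<circ> g) \<ge> 0 \<and> (\<exists>P. ?a ^^ N \<circ> (aop e \<circ> g) = eop P \<circ> ?a ^^ nat (int N + hgt (aop e \<circ> g)))"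
      proof (cases e)
        case True
        have "?a ^^ N \<circ> (aop e \<circ> g) = ?a ^^ Suc N \<circ> g"
          by (simp only: True funpow_Suc_right comp_assoc)
        then show ?thesis using n[of "Suc N"] N True unfolding hg by (simp add: algebra_simps)
      next
        case False
        obtain N' where N': "N = Suc N'" using N by (cases N) auto
        have "?a ^^ N \<circ> (aop e \<circ> g) = ?a ^^ N' \<circ> (?a \<circ> aop False) \<circ> g"
          using False by (simp only: N' funpow_Suc_right comp_assoc)
        also have "\<dots> = ?a ^^ N' \<circ> g" using aop_aop[of True] by simp
        finally show ?thesis using n[of N'] N N' False unfolding hg by simp
      qed
    qed
  next
    case (comp_b q g)
    then obtain n where n: "\<And>N. N \<ge> n \<Longrightarrow> int N + hgt g \<ge> 0 \<and> (\<exists>P. ?a ^^ N \<circ> g = eop P \<circ> ?a ^^ nat (int N + hgt g))"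
      by blast
    have hg: "hgt (eop q \<circ> g) = hgt g"
      using hgt_comp[OF eop_in_G comp_b(2)] by simp
    have upN: "\<exists>Q. ?a ^^ N \<circ> eop q = eop Q \<circ> ?a ^^ N" for N
    proof (induction N)
      case 0
      show ?case by (rule exI[of _ q]) simp
    next
      case (Suc N)
      then obtain Q where Q: "?a ^^ N \<circ> eop q = eop Q \<circ> ?a ^^ N" by blast
      obtain Q' where Q': "?a \<circ> eop Q = eop Q' \<circ> ?a" using up by blast
      have "?a ^^ Suc N \<circ> eop q = eop Q' \<circ> ?a ^^ Suc N"
        unfolding funpow.simps comp_assoc Q comp_exchange[OF Q'] by (rule refl)
      then show ?case by blast
    qed
    show ?case unfolding hg
    proof (intro exI[of _ n] allI impI conjI)
      fix N assume N: "N \<ge> n"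
      obtain P where P: "?a ^^ N \<circ> g = eop P \<circ> ?a ^^ nat (int N + hgt g)" using n[OF N] by blast
      obtain Q where "?a ^^ N \<circ> eop q = eop Q \<circ> ?a ^^ N" using upN by blast
      then have "?a ^^ N \<circ> (eop q \<circ> g) = eop Q \<circ> (?a ^^ N \<circ> g)" by (rule comp_exchange)
      also have "\<dots> = eop (Q + P) \<circ> ?a ^^ nat (int N + hgt g)"
        unfolding P eop_add by (simp only: comp_assoc)
      finally have "?a ^^ N \<circ> (eop q \<circ> g) = eop (Q + P) \<circ> ?a ^^ nat (int N + hgt g)" .
      then show "\<exists>P. ?a ^^ N \<circ> (eop q \<circ> g) = eop P \<circ> ?a ^^ nat (int N + hgt g)" by blast
    qed (use n in blast)
  qed
  obtain n1 where n1: "\<And>N. N \<ge> n1 \<Longrightarrow> \<exists>P. ?a ^^ N \<circ> g = eop P \<circ> ?a ^^ N"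
    using push[OF g(1)] g(2) by fastforce
  obtain n2 where n2: "\<And>N. N \<ge> n2 \<Longrightarrow> \<exists>P. ?a ^^ N \<circ> h = eop P \<circ> ?a ^^ N"
    using push[OF h(1)] h(2) by fastforce
  define N where "N = max n1 n2"
  obtain P Q where P: "?a ^^ N \<circ> g = eop P \<circ> ?a ^^ N" and Q: "?a ^^ N \<circ> h = eop Q \<circ> ?a ^^ N"
    using n1[of N] n2[of N] by (auto simp: N_def)
  have "?a ^^ N \<circ> (g \<circ> h) = eop P \<circ> eop Q \<circ> ?a ^^ N"
    unfolding comp_exchange[OF P] Q by (simp only: comp_assoc)
  moreover have "?a ^^ N \<circ> (h \<circ> g) = eop Q \<circ> eop P \<circ> ?a ^^ N"
    unfolding comp_exchange[OF Q] P by (simp only: comp_assoc)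
  ultimately have e: "?a ^^ N \<circ> (g \<circ> h) = ?a ^^ N \<circ> (h \<circ> g)" using eop_commute by metis
  have aa: "aop False \<circ> ?a = id" using aop_aop[of False] by simp
  have inv: "aop False ^^ N \<circ> ?a ^^ N = id"
  proof (induction N)
    case (Suc N)
    have "aop False ^^ Suc N \<circ> ?a ^^ Suc N = aop False ^^ N \<circ> (aop False \<circ> ?a) \<circ> ?a ^^ N"
      unfolding funpow_Suc_right[of N "aop False"] funpow.simps(2)[of N ?a] by (simp only: comp_assoc)
    then show ?case unfolding aa comp_id Suc .
  qed simp
  have "aop False ^^ N \<circ> (?a ^^ N \<circ> (g \<circ> h)) = aop False ^^ N \<circ> (?a ^^ N \<circ> (h \<circ> g))"
    unfolding e by (rule refl)
  then show ?thesis unfolding comp_assoc[symmetric] inv id_comp .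
qed

end

section \<open>Heights and fixed vertices under an abstract isomorphism\<close>

locale bs_iso = A: bs_limit M r + B: bs_limit M' r' for M r M' r' +
  fixes f
  assumes bij: "bij_betw f A.G B.G"
    and f_comp: "g \<in> A.G \<Longrightarrow> h \<in> A.G \<Longrightarrow> f (g \<circ> h) = f g \<circ> f h"
begin

lemma f_in: "g \<in> A.G \<Longrightarrow> f g \<in> B.G"
  using bij by (rule bij_betw_apply)

lemma f_inj: "g \<in> A.G \<Longrightarrow> h \<in> A.G \<Longrightarrow> f g = f h \<Longrightarrow> g = h"
  using bij by (auto simp: bij_betw_def inj_on_def)

lemma f_surj: "h \<in> B.G \<Longrightarrow> \<exists>g\<in>A.G. h = f g"
  using bij by (auto simp: bij_betw_def)

lemma f_id: "f id = id"
proof -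
  have e: "f id \<circ> f id = f id" using f_comp[OF A.G_id A.G_id] by (simp only: comp_id)
  obtain k where "k \<circ> f id = id" using B.G_inv[OF f_in[OF A.G_id]] by blast
  then show ?thesis using e by (metis comp_assoc id_comp)
qed

lemma bs_iso_inv: "bs_iso M' r' M r (inv_into A.G f)"
proof
  show "bij_betw (inv_into A.G f) B.G A.G" using bij by (rule bij_betw_inv_into)
  fix g h assume gh: "g \<in> B.G" "h \<in> B.G"
  obtain g0 where g0: "g0 \<in> A.G" "g = f g0" using f_surj[OF gh(1)] by blast
  obtain h0 where h0: "h0 \<in> A.G" "h = f h0" using f_surj[OF gh(2)] by blast
  have inv: "inv_into A.G f (f k) = k" if "k \<in> A.G" for k
    using bij that by (simp add: bij_betw_inv_into_left)
  have "inv_into A.G f (f g0 \<circ> f h0) = g0 \<circ> h0"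
    using inv[OF A.G_comp[OF g0(1) h0(1)]] f_comp[OF g0(1) h0(1)] by simp
  then show "inv_into A.G f (g \<circ> h) = inv_into A.G f g \<circ> inv_into A.G f h"
    using inv g0 h0 by simp
qed

definition t where "t = f (A.aop True)"
definition fe where "fe P = f (A.eop P)"

lemma t_in: "t \<in> B.G" by (simp only: t_def f_in A.aop_in_G)
lemma fe_in: "fe P \<in> B.G" by (simp only: fe_def f_in A.eop_in_G)

lemma fe_add: "fe (P + Q) = fe P \<circ> fe Q"
  unfolding fe_def A.eop_add by (rule f_comp[OF A.eop_in_G A.eop_in_G])

lemma fe_0: "fe 0 = id"
  using f_id A.eop_0 by (simp add: fe_def)

lemma fe_commute: "fe P \<circ> fe Q = fe Q \<circ> fe P"
  by (simp only: fe_add[symmetric] add.commute)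

lemma fe_inj: "fe P = fe Q \<Longrightarrow> P = Q"
  unfolding fe_def using f_inj[OF A.eop_in_G A.eop_in_G] A.eop_inj by blast

lemma t_fe: "M dvd lin r P \<Longrightarrow> t \<circ> fe P = fe (Pph M r False P) \<circ> t"
proof -
  assume "M dvd lin r P"
  then have "A.aop True \<circ> A.eop P = A.eop (Pph M r False P) \<circ> A.aop True"
    using A.aop_eop[of True P] A.rep_False by simp
  then show ?thesis unfolding t_def fe_def using f_comp A.aop_in_G A.eop_in_G by metis
qed

lemma phi_M: "Pph M r False [:M:] = [:0, 1:]" "M dvd lin r [:M:]"
  using A.M A.r_0 by (simp_all add: Pph_def)

text \<open>By transitivity every vertex stabilizer is conjugate to that of the base vertex, which
  is \<open>E\<close>.\<close>

lemma conj_to_base: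
  assumes "g \<in> B.G" "B.valid u" "B.vm g u = u"
  shows "\<exists>h k q. h \<in> B.G \<and> k \<in> B.G \<and> h \<circ> k = id \<and> k \<circ> h = id \<and> k \<circ> g \<circ> h = B.eop q"
proof -
  obtain h where h: "h \<in> B.G" "h ([], 0) = (u, 0)"
    using B.transitive_states[OF B.eop_in_G assms(2)] by blast
  obtain k where k: "k \<in> B.G" "k \<circ> h = id" "h \<circ> k = id" using B.G_inv[OF h(1)] by blast
  have v: "B.valid []" by simp
  have hu: "B.vm h [] = u" using h by (simp add: B.vm_def)
  have "B.vm (k \<circ> g \<circ> h) [] = B.vm k (B.vm g (B.vm h []))"
    using B.vm_comp[OF B.G_comp[OF k(1) assms(1)] h(1) v] B.vm_comp[OF k(1) assms(1) B.valid_vm[OF h(1) v]]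
    by simp
  also have "\<dots> = B.vm (k \<circ> h) []" using B.vm_comp[OF k(1) h(1) v] assms(3) hu by simp
  also have "\<dots> = []" unfolding k(2) by (simp add: B.vm_def)
  finally have "B.vm (k \<circ> g \<circ> h) [] = []" .
  then obtain q where "k \<circ> g \<circ> h = B.eop q"
    using B.stabilizer[OF B.G_comp[OF B.G_comp[OF k(1) assms(1)] h(1)]] by blast
  then show ?thesis using h k by blast
qed

lemma vm_commute:
  assumes "g \<in> B.G" "h \<in> B.G" "g \<circ> h = h \<circ> g" "u \<in> {u. B.valid u}"
  shows "B.vm g (B.vm h u) = B.vm h (B.vm g u)"
  using assms B.vm_comp[OF assms(1,2), of u] B.vm_comp[OF assms(2,1), of u] by simp

text \<open>\<open>M e\<^sub>0\<close> and \<open>e\<^sub>1\<close> are conjugate, so the image of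
  \<open>?Y\<close>, their difference, has height 0. It commutes with \<open>fe 1\<close>; if that
  had nonzero height \<open>h\<close>, \<open>fe ?Y\<close> would fix a vertex and be conjugate to
  some \<open>q \<noteq> 0\<close> of \<open>E'\<close>. Then the \<open>h\<close>-th power of
  \<phi>' would fix \<open>q\<close>, although it changes the degree by \<open>h\<close>.\<close>

lemma hgt_fe_one: "B.hgt (fe 1) = 0"
proof (rule ccontr)
  assume nz: "B.hgt (fe 1) \<noteq> 0"
  let ?Y = "[:- M, 1:]"
  have "fe [:0, 1:] = fe ?Y \<circ> fe [:M:]" by (simp only: fe_add[symmetric]) simp
  then have 1: "B.hgt (fe [:0, 1:]) = B.hgt (fe ?Y) + B.hgt (fe [:M:])"
    using B.hgt_comp[OF fe_in fe_in] by simp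
  have "B.hgt (t \<circ> fe [:M:]) = B.hgt (fe [:0, 1:] \<circ> t)" using t_fe[OF phi_M(2)] phi_M(1) by simp
  then have 2: "B.hgt (fe [:M:]) = B.hgt (fe [:0, 1:])"
    using B.hgt_comp[OF t_in fe_in] B.hgt_comp[OF fe_in t_in] by simp
  have Y0: "B.hgt (fe ?Y) = 0" using 1 2 by simp
  have "\<exists>u\<in>{u. B.valid u}. B.vm (fe ?Y) u = u"
  proof (rule B.tree.fixed_vertex_of_commuting[OF _ B.aut_vm[OF fe_in] nz])
    show "B.tree.aut (B.vm (fe ?Y)) 0" using B.aut_vm[OF fe_in[of ?Y]] Y0 by simp
    show "{u. B.valid u} \<noteq> {}" by (auto intro: exI[of _ "[]"])
  qed (rule vm_commute[OF fe_in fe_in fe_commute])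
  then obtain u where u: "B.valid u" "B.vm (fe ?Y) u = u" by blast
  from conj_to_base[OF fe_in u] obtain h k q where h: "h \<in> B.G" "k \<in> B.G"
    "h \<circ> k = id" "k \<circ> h = id" "k \<circ> fe ?Y \<circ> h = B.eop q" by blast
  define x where "x = k \<circ> fe 1 \<circ> h"
  have x: "x \<in> B.G" unfolding x_def by (intro B.G_comp h fe_in)
  have cj: "(k \<circ> g \<circ> h) \<circ> (k \<circ> g' \<circ> h) = k \<circ> (g \<circ> g') \<circ> h" for g g'
    using h(3) by (metis comp_assoc comp_id)
  have "B.eop q \<circ> x = x \<circ> B.eop q"
    unfolding x_def h(5)[symmetric] cj using fe_commute by metis
  then have pw: "B.phpow (B.hgt x) q q" using B.conj_phpow[OF x] by blast
  have "B.hgt x = B.hgt (fe 1)"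
  proof -
    have "B.hgt k + B.hgt h = 0" using B.hgt_comp[OF h(2,1)] h(4) by simp
    then show ?thesis unfolding x_def
      using B.hgt_comp[OF B.G_comp[OF h(2) fe_in] h(1)] B.hgt_comp[OF h(2) fe_in] by simp
  qed
  moreover have "q \<noteq> 0"
  proof
    assume "q = 0"
    then have "k \<circ> fe ?Y \<circ> h = id" using h(5) B.eop_0 by simp
    then have "fe ?Y = fe 0" unfolding fe_0 using h(3) by (metis comp_assoc comp_id id_comp)
    then show False using fe_inj by force
  qed
  ultimately show False using B.phpow_degree(2)[OF pw] nz by simp
qed

text \<open>For \<open>M' = 1\<close> the images of \<open>b\<close> and \<open>b'\<close>, the
  conjugate of \<open>b\<close> by the inverse of \<open>a\<close>, have height 0 and commute. For
  \<open>M \<noteq> 1\<close> this would place \<open>b'\<close> in the centralizer \<open>E\<close>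
  of \<open>b\<close>, hence \<open>e\<^sub>0\<close> in \<open>X\<int>[X]\<close>.\<close>

lemma M_eq_1: 
  assumes "M' = 1"
  shows "M = 1"
proof (rule ccontr)
  assume M: "M \<noteq> 1"
  define b' where "b' = A.aop False \<circ> A.eop 1 \<circ> A.aop True"
  have b': "b' \<in> A.G" unfolding b'_def by (intro A.G_comp A.aop_in_G A.eop_in_G)
  have c: "A.aop True \<circ> b' = A.eop 1 \<circ> A.aop True"
    unfolding b'_def using A.aop_aop[of True] by (simp add: comp_assoc[symmetric])
  have "t \<circ> f b' = fe 1 \<circ> t"
    unfolding t_def fe_def using c f_comp A.aop_in_G A.eop_in_G b' by metis
  then have "B.hgt (f b') = 0"
    using B.hgt_comp[OF t_in f_in[OF b']] B.hgt_comp[OF fe_in[of 1] t_in] hgt_fe_one by simp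
  then have "fe 1 \<circ> f b' = f b' \<circ> fe 1"
    using B.height_zero_commute[OF assms fe_in hgt_fe_one f_in[OF b']] by blast
  then have "A.eop 1 \<circ> b' = b' \<circ> A.eop 1"
    unfolding fe_def using f_inj f_comp A.G_comp A.eop_in_G b' by metis
  then obtain q where "b' = A.eop q" using A.centralizer_one[OF M b'] by blast
  then have "A.eop 1 \<circ> A.aop True = A.aop True \<circ> A.eop q" using c by simp
  from A.conj_eop(1,2)[OF A.aop_in_G this]
  have "A.vE 1 [(True, 0)] = [(True, 0)]" by (simp add: A.vm_def A.aop_def A.push_def)
  then have "Prep M r True 1 = 0" using A.vE_fix(1)[of True 0 "[]" 1] by simp
  then show False by (simp add: A.rep_True)
qed

text \<open>Height after \<open>f\<close> is a homomorphism to \<int> that kills \<open>b\<close>,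
  hence a multiple of the height.\<close>

lemma hgt_f: "g \<in> A.G \<Longrightarrow> B.hgt (f g) = A.hgt g * B.hgt t"
proof (induction rule: A.G_induct)
  case id
  show ?case unfolding f_id B.hgt_simps(1) A.hgt_simps(1) by (rule mult_zero_left[symmetric])
next
  case (comp_a e g)
  have "B.hgt (f (A.aop False)) = - B.hgt t"
  proof -
    have "f (A.aop False) \<circ> t = id"
      unfolding t_def using f_comp[OF A.aop_in_G A.aop_in_G, of False True] A.aop_aop[of False] f_id by simp
    then show ?thesis using B.hgt_comp[OF f_in[OF A.aop_in_G] t_in, of False] by simp
  qed
  then have "B.hgt (f (A.aop e)) = A.hgt (A.aop e) * B.hgt t" by (cases e) (simp_all add: t_def)
  then show ?case
    unfolding f_comp[OF A.aop_in_G comp_a(1)] B.hgt_comp[OF f_in[OF A.aop_in_G] f_in[OF comp_a(1)]]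
      A.hgt_comp[OF A.aop_in_G comp_a(1)] comp_a(2) by (simp only: distrib_right)
next
  case (comp_b q g)
  have "B.hgt (fe (- 1)) = 0"
  proof -
    have "fe (- 1) \<circ> fe 1 = id" by (simp only: fe_add[symmetric]) (simp add: fe_0)
    then show ?thesis using B.hgt_comp[OF fe_in[of "- 1"] fe_in[of 1]] hgt_fe_one by simp
  qed
  then have "B.hgt (f (A.eop q)) = 0" using comp_b(1) hgt_fe_one by (auto simp: fe_def)
  then show ?case
    unfolding f_comp[OF A.eop_in_G comp_b(2)] B.hgt_comp[OF f_in[OF A.eop_in_G] f_in[OF comp_b(2)]]
      A.hgt_comp[OF A.eop_in_G comp_b(2)] comp_b(3) by simp
qed

lemma hgt_t: "B.hgt t \<noteq> 0"
proof
  assume "B.hgt t = 0"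
  moreover obtain g where "g \<in> A.G" "B.aop True = f g" using f_surj[OF B.aop_in_G] by blast
  then have "A.hgt g * B.hgt t = 1" using hgt_f[of g] B.hgt_simps(2)[of True] by simp
  ultimately show False by simp
qed

text \<open>\<open>fixed_vertex_of_conj_power\<close> is applied to the images of \<open>b\<close>,
  \<open>e\<^sub>1\<close> and \<open>a\<close>, with exponent \<open>M\<close>; then
  \<open>f\<close> is followed by the conjugation that brings the fixed vertex to the base.\<close>

lemma ex_based: "\<exists>f' Q. bs_iso M r M' r' f' \<and> f' (A.eop 1) = B.eop Q"
proof -
  have "\<exists>u\<in>{u. B.valid u}. B.vm (fe 1) u = u"
  proof (rule B.tree.fixed_vertex_of_conj_power[OF _ B.aut_vm[OF t_in] hgt_t])
    show "B.tree.aut (B.vm (fe 1)) 0" using B.aut_vm[OF fe_in[of 1]] hgt_fe_one by simp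
    have "B.hgt (fe [:0, 1:]) = 0"
      using hgt_f[OF A.eop_in_G, of "[:0, 1:]"] by (simp add: fe_def)
    then show "B.tree.aut (B.vm (fe [:0, 1:])) 0" using B.aut_vm[OF fe_in[of "[:0, 1:]"]] by simp
    show "B.vm (fe [:0, 1:]) (B.vm (fe 1) u) = B.vm (fe 1) (B.vm (fe [:0, 1:]) u)"
      if "u \<in> {u. B.valid u}" for u by (rule vm_commute[OF fe_in fe_in fe_commute that])
    show "nat M > 0" using A.M by simp
    show "{u. B.valid u} \<noteq> {}" by (auto intro: exI[of _ "[]"])
    fix u assume "u \<in> {u. B.valid u}"
    then have u: "B.valid u" by simp
    have pow: "(B.vm (fe 1) ^^ n) u = B.vm (fe (of_nat n)) u" for n
    proof (induction n)
      case 0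
      show ?case by (simp add: fe_0 B.vm_def)
    next
      case (Suc n)
      show ?case unfolding funpow.simps comp_apply Suc of_nat_Suc fe_add
        by (rule B.vm_comp[OF fe_in fe_in u, symmetric, unfolded comp_apply])
    qed
    have "of_nat (nat M) = [:M:]" using A.M by (simp add: of_nat_poly)
    then have "B.vm t ((B.vm (fe 1) ^^ nat M) u) = B.vm (t \<circ> fe [:M:]) u"
      using pow[of "nat M"] B.vm_comp[OF t_in fe_in u] by simp
    also have "\<dots> = B.vm (fe [:0, 1:]) (B.vm t u)"
      using t_fe[OF phi_M(2)] phi_M(1) B.vm_comp[OF fe_in t_in u] by simp
    finally show "B.vm t ((B.vm (fe 1) ^^ nat M) u) = B.vm (fe [:0, 1:]) (B.vm t u)" .
  qed
  then obtain u where u: "B.valid u" "B.vm (fe 1) u = u" by blast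
  from conj_to_base[OF fe_in u] obtain h k q where h: "h \<in> B.G" "k \<in> B.G"
    "h \<circ> k = id" "k \<circ> h = id" "k \<circ> fe 1 \<circ> h = B.eop q" by blast
  define f' where "f' g = k \<circ> f g \<circ> h" for g
  have "bij_betw (\<lambda>g. k \<circ> g \<circ> h) B.G B.G"
  proof (rule bij_betw_byWitness[where f' = "\<lambda>g. h \<circ> g \<circ> k"])
    show "\<forall>a\<in>B.G. h \<circ> (k \<circ> a \<circ> h) \<circ> k = a" "\<forall>a\<in>B.G. k \<circ> (h \<circ> a \<circ> k) \<circ> h = a"
      using h(3,4) by (metis comp_assoc comp_id id_comp)+
    show "(\<lambda>g. k \<circ> g \<circ> h) ` B.G \<subseteq> B.G" "(\<lambda>g. h \<circ> g \<circ> k) ` B.G \<subseteq> B.G"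
      using h(1,2) B.G_comp by blast+
  qed
  then have "bij_betw ((\<lambda>g. k \<circ> g \<circ> h) \<circ> f) A.G B.G" using bij bij_betw_trans by blast
  moreover have "(\<lambda>g. k \<circ> g \<circ> h) \<circ> f = f'" by (simp add: f'_def fun_eq_iff)
  ultimately have "bs_iso M r M' r' f'"
  proof unfold_locales
    fix g g' assume g: "g \<in> A.G" "g' \<in> A.G"
    have "f' g \<circ> f' g' = k \<circ> f g \<circ> (h \<circ> k) \<circ> f g' \<circ> h" by (simp only: f'_def comp_assoc)
    also have "\<dots> = f' (g \<circ> g')" unfolding h(3) comp_id f'_def f_comp[OF g] by (simp only: comp_assoc)
    finally show "f' (g \<circ> g') = f' g \<circ> f' g'" by (rule sym)
  qed simp
  moreover have "f' (A.eop 1) = B.eop q" using h(5) by (simp only: f'_def fe_def)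
  ultimately show ?thesis by blast
qed

end

section \<open>Isomorphisms that send \<open>b\<close> into the base group\<close>

locale bs_iso_based = bs_iso +
  fixes Q
  assumes M_ge: "M \<noteq> 1" "M' \<noteq> 1" and based: "f (A.eop 1) = B.eop Q"
begin

text \<open>An element of \<open>E'\<close> commutes with \<open>f(b)\<close>, so its preimage
  centralizes \<open>b\<close>. In \<open>ex_F\<close> the same argument runs in the other
  direction, with the preimage of the target's \<open>b\<close>.\<close>

lemma eop_in_range_fe: "\<exists>P. fe P = B.eop q"
proof -
  obtain g where g: "g \<in> A.G" "B.eop q = f g" using f_surj[OF B.eop_in_G] by blast
  have "f (A.eop 1 \<circ> g) = f (g \<circ> A.eop 1)"
    using f_comp[OF A.eop_in_G g(1)] f_comp[OF g(1) A.eop_in_G] based g(2) B.eop_commute by metis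
  then have "A.eop 1 \<circ> g = g \<circ> A.eop 1"
    by (rule f_inj[OF A.G_comp[OF A.eop_in_G g(1)] A.G_comp[OF g(1) A.eop_in_G]])
  then obtain p where "g = A.eop p" using A.centralizer_one[OF M_ge(1) g(1)] by blast
  then show ?thesis using g(2) by (auto simp: fe_def)
qed

lemma ex_F: "\<exists>q. fe P = B.eop q"
proof -
  obtain P1 where "fe P1 = B.eop 1" using eop_in_range_fe by blast
  then have "B.eop 1 \<circ> fe P = fe P \<circ> B.eop 1" using fe_commute by metis
  then show ?thesis using B.centralizer_one[OF M_ge(2) fe_in] by blast
qed

definition F where "F P = (SOME q. fe P = B.eop q)"

lemma fe_F: "fe P = B.eop (F P)"
  unfolding F_def by (rule someI_ex[OF ex_F])

lemma F_add: "F (P + R) = F P + F R"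
  using fe_add[of P R] unfolding fe_F B.eop_add[symmetric] by (rule B.eop_inj)

lemma F_0 [simp]: "F 0 = 0"
  using F_add[of 0 0] by simp

lemma F_uminus: "F (- P) = - F P"
  using F_add[of P "- P"] by (simp add: add_eq_0_iff2)

lemma F_diff: "F (P - R) = F P - F R"
  using F_add[of P "- R"] F_uminus[of R] by simp

lemma F_inj: "F P = F R \<Longrightarrow> P = R"
  using fe_inj fe_F by metis

lemma F_eq_0: "F P = 0 \<longleftrightarrow> P = 0"
  using F_inj[of P 0] by auto

lemma F_surj: "\<exists>P. F P = R"
  using eop_in_range_fe[of R] fe_F B.eop_inj by metis

lemma F_smult: "F (smult c P) = smult c (F P)"
proof -
  have nat: "F (smult (int n) P) = smult (int n) (F P)" for n
    by (induction n) (simp_all add: smult_add_left F_add)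
  show ?thesis
  proof (cases c rule: int_cases2)
    case (nonpos n)
    then show ?thesis using nat[of n] by (simp add: F_uminus)
  qed (use nat in simp)
qed

lemma F_1: "F 1 = Q"
  using based fe_F[of 1] B.eop_inj by (simp add: fe_def)

lemma F_const: "F [:c:] = smult c Q"
  using F_smult[of c 1] F_1 by (simp add: one_pCons)

lemma F_phi: "M dvd lin r P \<Longrightarrow> B.phpow (B.hgt t) (F P) (F (Pph M r False P))"
  using t_fe[of P] B.conj_phpow[OF t_in, of "F (Pph M r False P)" "F P"] fe_F by simp

text \<open>The preimages of the basis elements \<open>e\<^bsub>i+1\<^esub>\<close> under \<open>\<phi>\<close>.\<close>

definition pre where "pre i = (if i = 0 then [:M:] else monom 1 i - [:r i:])"

lemma pre: "M dvd lin r (pre i)" "Pph M r False (pre i) = monom 1 (Suc i)"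
proof -
  have "lin r (pre i) = (if i = 0 then M else 0)" by (simp add: pre_def lin_diff A.r_0)
  then show "M dvd lin r (pre i)" "Pph M r False (pre i) = monom 1 (Suc i)"
    using A.M by (auto simp: Pph_def pre_def monom_Suc monom_0)
qed

lemma F_pre: "F (pre i) = (if i = 0 then smult M Q else F (monom 1 i) - smult (r i) Q)"
  by (simp add: pre_def F_const F_diff)

lemma pre_nz: "F (pre i) \<noteq> 0"
proof -
  have "pre i \<noteq> 0"
  proof
    assume "pre i = 0"
    then have "monom 1 (Suc i) = (0 :: int poly)" using pre(2)[of i] A.ph_0[of False] by simp
    then show False by simp
  qed
  then show ?thesis using F_eq_0 by blast
qed

lemma degree_F_monom: "int (degree (F (monom 1 (Suc i)))) = int (degree (F (pre i))) + B.hgt t"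
  using B.phpow_degree(2)[OF F_phi[OF pre(1)] pre_nz] pre(2) by simp

lemma F_sum: "F P = (\<Sum>i\<le>degree P. smult (coeff P i) (F (monom 1 i)))"
proof -
  have "F (\<Sum>i\<in>S. monom (coeff P i) i) = (\<Sum>i\<in>S. smult (coeff P i) (F (monom 1 i)))" if "finite S" for S
    using that
  proof (induction S rule: finite_induct)
    case (insert i S)
    have "monom (coeff P i) i = smult (coeff P i) (monom 1 i)" by (simp add: smult_monom)
    then show ?case using insert by (simp add: F_add F_smult)
  qed simp
  from this[of "{..degree P}"] show ?thesis by (simp add: poly_as_sum_of_monoms)
qed

text \<open>Otherwise no \<open>F (monom 1 i)\<close> would have degree above
  \<open>degree Q\<close>, and \<open>F\<close> could not be surjective.\<close>

lemma hgt_t_pos: "B.hgt t > 0"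
proof (rule ccontr)
  assume h: "\<not> B.hgt t > 0"
  have m: "degree (F (monom 1 i)) \<le> degree Q" for i
  proof (induction i)
    case 0
    then show ?case using F_1 by simp
  next
    case (Suc i)
    have "degree (F (pre i)) \<le> degree Q"
    proof (cases "i = 0")
      case True
      then show ?thesis by (simp add: F_pre)
    next
      case False
      then show ?thesis unfolding F_pre using Suc
        by (simp add: degree_diff_le)
    qed
    then show ?case using degree_F_monom[of i] h by linarith
  qed
  obtain P where P: "F P = monom 1 (Suc (degree Q))" using F_surj by blast
  have "degree (F P) \<le> degree Q"
    unfolding F_sum[of P] by (rule degree_sum_le) (use m in \<open>auto intro: order_trans[OF degree_smult_le]\<close>)
  then show False using P by (simp add: degree_monom_eq)
qed

text \<open>Each application of \<phi> adds \<open>B.hgt t\<close> to the degree of the image, and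
  for \<open>i > 0\<close> the correction by \<open>r i\<close> times \<open>Q\<close> is of smaller
  degree. So the images of the powers of \<open>X\<close> have strictly increasing degrees, and the
  leading term decides.\<close>

lemma degree_F: "P \<noteq> 0 \<Longrightarrow> int (degree (F P)) = int (degree Q) + B.hgt t * int (degree P)"
proof -
  have m: "int (degree (F (monom 1 i))) = int (degree Q) + B.hgt t * int i" for i
  proof (induction i)
    case 0
    then show ?case using F_1 by simp
  next
    case (Suc i)
    have "degree (F (pre i)) = degree (F (monom 1 i))"
    proof (cases "i = 0")
      case True
      then show ?thesis using F_1 A.M by (simp add: F_pre)
    next
      case False
      have "B.hgt t * int i > 0" using hgt_t_pos False by simp
      then have "degree Q < degree (F (monom 1 i))" using Suc by linarith
      then have "degree (- smult (r i) Q) < degree (F (monom 1 i))"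
        using le_less_trans[OF degree_smult_le] by (simp only: degree_minus)
      then show ?thesis using degree_add_eq_left[of "- smult (r i) Q" "F (monom 1 i)"] False
        by (simp add: F_pre)
    qed
    then show ?case using degree_F_monom[of i] Suc by (simp add: algebra_simps)
  qed
  have le: "int (degree (F P)) \<le> int (degree Q) + B.hgt t * int n" if "degree P \<le> n" for P n
  proof -
    have "degree (F (monom 1 i)) \<le> nat (int (degree Q) + B.hgt t * int n)" if "i \<le> n" for i
    proof -
      have "B.hgt t * int i \<le> B.hgt t * int n" using that hgt_t_pos by simp
      then show ?thesis using m[of i] by linarith
    qed
    then have "degree (F P) \<le> nat (int (degree Q) + B.hgt t * int n)"
      unfolding F_sum[of P] using that
      by (intro degree_sum_le) (auto intro: order_trans[OF degree_smult_le])
    moreover have "B.hgt t * int n \<ge> 0" using hgt_t_pos by simp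
    ultimately show ?thesis by linarith
  qed
  assume P: "P \<noteq> 0"
  show ?thesis
  proof (cases "degree P")
    case 0
    then obtain c where c: "P = [:c:]" by (rule degree_eq_zeroE)
    then have "c \<noteq> 0" using P by auto
    then show ?thesis by (simp add: c F_const)
  next
    case (Suc n)
    define R where "R = P - monom (lead_coeff P) (degree P)"
    have R: "degree R \<le> n"
    proof (rule degree_le, intro allI impI)
      fix i assume "n < i"
      then show "coeff R i = 0" using Suc by (cases "i = degree P") (auto simp: R_def coeff_eq_0)
    qed
    have "monom (lead_coeff P) (degree P) = smult (lead_coeff P) (monom 1 (degree P))" by (simp add: smult_monom)
    then have FP: "F P = smult (lead_coeff P) (F (monom 1 (degree P))) + F R"
      using F_add[of "monom (lead_coeff P) (degree P)" R] F_smult by (simp add: R_def)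
    have d: "degree (smult (lead_coeff P) (F (monom 1 (degree P)))) = degree (F (monom 1 (degree P)))"
      using P by simp
    have "int (degree (F R)) < int (degree (F (monom 1 (degree P))))"
      using le[OF R] m[of "degree P"] Suc hgt_t_pos by (simp add: algebra_simps)
    then have "degree (F P) = degree (F (monom 1 (degree P)))"
      unfolding FP using degree_add_eq_left[of "F R" "smult (lead_coeff P) (F (monom 1 (degree P)))"] d by simp
    then show ?thesis using m by simp
  qed
qed

text \<open>By \<open>degree_F\<close> a preimage of 1 and \<open>Q\<close> itself are constants,
  and their product is 1. A preimage of \<open>X\<close> gives \<open>hgt_t_1\<close> in the same
  way.\<close>

lemma Q_unit: "\<exists>q. Q = [:q:] \<and> \<bar>q\<bar> = 1"
proof -
  obtain P where P: "F P = 1" using F_surj by blast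
  then have "P \<noteq> 0" by auto
  from degree_F[OF this] P have e: "int (degree Q) + B.hgt t * int (degree P) = 0" by simp
  moreover have "B.hgt t * int (degree P) \<ge> 0" using hgt_t_pos by simp
  ultimately have "degree Q = 0" "B.hgt t * int (degree P) = 0" by linarith+
  then have "degree Q = 0" "degree P = 0" using hgt_t_pos by auto
  then obtain q p where qp: "Q = [:q:]" "P = [:p:]" by (meson degree_eq_zeroE)
  then have "p * q = 1" using P by (simp add: F_const one_pCons)
  then have "q dvd 1" by (metis dvd_triv_right)
  then have "\<bar>q\<bar> = 1" by simp
  then show ?thesis using qp by blast
qed

lemma hgt_t_1: "B.hgt t = 1"
proof -
  obtain P where P: "F P = monom 1 1" using F_surj by blast
  then have "P \<noteq> 0" by auto
  moreover have "degree Q = 0" using Q_unit by auto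
  ultimately have "B.hgt t * int (degree P) = 1" using degree_F[of P] P by (simp add: degree_monom_eq)
  then have "B.hgt t dvd 1" by (metis dvd_triv_left)
  then show ?thesis using hgt_t_pos by simp
qed

lemma F_phi': "M dvd lin r P \<Longrightarrow> M' dvd lin r' (F P) \<and> F (Pph M r False P) = Pph M' r' False (F P)"
  using F_phi[of P] by (auto simp: hgt_t_1 B.phpow_def B.phrel_def)

text \<open>\<phi>' must be defined at the image of \<open>[:M:]\<close>, which is \<open>M\<close>
  up to sign. The opposite divisibility comes from the inverse isomorphism.\<close>

lemma M_dvd: "M' dvd M"
proof -
  obtain q where q: "Q = [:q:]" "\<bar>q\<bar> = 1" using Q_unit by blast
  have "M' dvd M * q" using F_phi'[OF phi_M(2)] q B.r_0 by (simp add: F_const)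
  moreover have "q = 1 \<or> q = - 1" using q(2) by linarith
  ultimately show ?thesis by auto
qed

lemma r_eq:
  assumes "M = M'" "i > 0"
  shows "r i = r' i"
proof -
  obtain q where q: "Q = [:q:]" "\<bar>q\<bar> = 1" using Q_unit by blast
  have q1: "q = 1 \<or> q = - 1" using q(2) by linarith
  have digit: "r i = r' i" if "F (monom 1 i) = smult q (monom 1 i)" "i > 0" for i
  proof -
    have "lin r' (F (pre i)) = q * (r' i - r i)"
      using that B.r_0 by (simp add: F_pre lin_diff lin_smult q algebra_simps)
    then have "M dvd q * (r' i - r i)" using F_phi'[OF pre(1)] assms(1) by metis
    then have "M dvd r' i - r i" using q1 by (auto simp: dvd_diff_commute)
    then have "r' i mod M = r i mod M" by (simp add: mod_eq_dvd_iff)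
    then show ?thesis using A.r_bound[OF that(2)] B.r_bound[OF that(2)] assms(1) by simp
  qed
  have "F (monom 1 i) = smult q (monom 1 i)" for i
  proof (induction i)
    case 0
    then show ?case using F_1 q by simp
  next
    case (Suc i)
    have "F (monom 1 (Suc i)) = Pph M' r' False (F (pre i))" using F_phi'[OF pre(1)] pre(2) by metis
    also have "\<dots> = smult q (monom 1 (Suc i))"
    proof (cases "i = 0")
      case True
      then have "F (pre i) = [:M * q:]" by (simp add: F_pre q(1))
      then show ?thesis using True B.M B.r_0 unfolding assms(1)[symmetric]
        by (simp add: Pph_def monom_Suc monom_0)
    next
      case False
      have "r i = r' i" using digit[OF Suc] False by simp
      then show ?thesis using False Suc q B.r_0
        by (simp add: F_pre Pph_def monom_Suc lin_diff lin_smult)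
    qed
    finally show ?case .
  qed
  then show ?thesis using digit assms(2) by blast
qed

end

theorem (in bs_iso) iso_imp_eq: "M = M' \<and> (\<forall>i. r i = r' i)"
proof (cases "M = 1 \<or> M' = 1")
  case True
  interpret I: bs_iso M' r' M r "inv_into A.G f" by (rule bs_iso_inv)
  have "M = 1" "M' = 1" using True M_eq_1 I.M_eq_1 by auto
  moreover have "r i = r' i" for i
    \<comment> \<open>For modulus 1 all digits of positive index are 0.\<close>
    using A.r_bound[of i] B.r_bound[of i] A.r_0 B.r_0 calculation by (cases i) auto
  ultimately show ?thesis by simp
next
  case False
  have dvd: "M2 dvd M1 \<and> (M1 = M2 \<longrightarrow> (\<forall>i>0. r1 i = r2 i))"
    if "bs_iso M1 r1 M2 r2 g" "M1 \<noteq> 1" "M2 \<noteq> 1" for M1 r1 M2 r2 g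
  proof -
    interpret J: bs_iso M1 r1 M2 r2 g by fact
    obtain f' Q where f': "bs_iso M1 r1 M2 r2 f'" "f' (J.A.eop 1) = J.B.eop Q" using J.ex_based by blast
    interpret K: bs_iso M1 r1 M2 r2 f' by (rule f')
    interpret K: bs_iso_based M1 r1 M2 r2 f' Q
      by unfold_locales (use that f' in auto)
    show ?thesis using K.M_dvd K.r_eq by blast
  qed
  have 1: "M' dvd M" "M = M' \<Longrightarrow> i > 0 \<Longrightarrow> r i = r' i" for i
    using dvd[OF bs_iso_axioms] False by auto
  have "M dvd M'" using dvd[OF bs_iso_inv] False by auto
  then have "M = M'" using 1(1) A.M B.M zdvd_antisym_nonneg[of M M'] by simp
  moreover have "r i = r' i" for i using 1(2)[OF \<open>M = M'\<close>, of i] A.r_0 B.r_0 by (cases i) auto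
  ultimately show ?thesis by blast
qed

section \<open>Digits of m-adic integers\<close>

text \<open>With equal digits the differences of the \<open>ss\<close> obey a linear recursion with
  solution \<open>(\<eta> - \<eta>') * u\<close> after multiplication by a power of
  \<open>K\<close>. Modulo \<open>K\<close> the factor \<open>u\<close> is a power of
  \<open>\<eta>\<close>, hence coprime to \<open>K\<close>, so the power of \<open>K\<close> divides
  \<open>\<eta> - \<eta>'\<close>.\<close>

lemma rr_inj:
  assumes M: "M = d * K" "d > 0" "K > 0" and x: "x = d * \<eta>" "x' = d * \<eta>'"
    and cop: "coprime \<eta> K" and eq: "\<And>i. i \<le> n \<Longrightarrow> rr M x i = rr M x' i"
  shows "d * K ^ n dvd x - x'"
proof (cases n)
  case 0
  then show ?thesis by (simp add: x)
next
  case (Suc n')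
  have K: "K * (ss M x (Suc i) - ss M x' (Suc i)) = \<eta> * (ss M x i - ss M x' i) + (\<eta> - \<eta>') * ss M x' i"
    if "Suc i \<le> n" for i
  proof -
    have "x * ss M x i - x' * ss M x' i = M * (ss M x (Suc i) - ss M x' (Suc i))"
      using ss_rr[of x M i] ss_rr[of x' M i] eq[OF that] by (simp only: right_diff_distrib)
    then have "d * (K * (ss M x (Suc i) - ss M x' (Suc i))) =
        d * (\<eta> * (ss M x i - ss M x' i) + (\<eta> - \<eta>') * ss M x' i)"
      unfolding M(1) x by (simp only: algebra_simps)
    then show ?thesis using M(2) by simp
  qed
  have "\<exists>u. coprime u K \<and> K ^ Suc i * (ss M x (Suc i) - ss M x' (Suc i)) = (\<eta> - \<eta>') * u" if "Suc i \<le> n" for i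
    using that
  proof (induction i)
    case 0
    show ?case using K[OF 0] by (intro exI[of _ 1]) simp
  next
    case (Suc i)
    then obtain u where u: "coprime u K" "K ^ Suc i * (ss M x (Suc i) - ss M x' (Suc i)) = (\<eta> - \<eta>') * u"
      by auto
    define w where "w = \<eta> * u + K ^ Suc i * ss M x' (Suc i)"
    have "K ^ Suc (Suc i) * (ss M x (Suc (Suc i)) - ss M x' (Suc (Suc i))) =
      K ^ Suc i * (K * (ss M x (Suc (Suc i)) - ss M x' (Suc (Suc i))))"
      by (simp only: power_Suc mult.assoc mult.left_commute)
    also have "\<dots> = \<eta> * (K ^ Suc i * (ss M x (Suc i) - ss M x' (Suc i))) + (\<eta> - \<eta>') * (K ^ Suc i * ss M x' (Suc i))"
      unfolding K[OF Suc.prems] by (simp only: distrib_left mult.left_commute)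
    also have "\<dots> = (\<eta> - \<eta>') * w"
      unfolding u(2) w_def by (simp only: distrib_left mult.left_commute)
    finally have e: "K ^ Suc (Suc i) * (ss M x (Suc (Suc i)) - ss M x' (Suc (Suc i))) = (\<eta> - \<eta>') * w" .
    have "coprime (\<eta> * u) K" using cop u(1) by simp
    then have "coprime w K"
      unfolding w_def by (simp add: coprime_iff_gcd_eq_1 gcd_add_mult mult.assoc)
        (metis add.commute coprime_iff_gcd_eq_1 gcd.commute gcd_add_mult mult.assoc mult.commute)
    then show ?case using e by blast
  qed
  from this[of n'] obtain u where u: "coprime u K"
    "K ^ n * (ss M x n - ss M x' n) = (\<eta> - \<eta>') * u" using Suc by auto
  have "K ^ n dvd (\<eta> - \<eta>') * u" unfolding u(2)[symmetric] by simp
  then have "K ^ n dvd \<eta> - \<eta>'"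
    using u(1) coprime_dvd_mult_left_iff[of "K ^ n" u "\<eta> - \<eta>'"] by (simp add: coprime_commute)
  then show ?thesis unfolding x by (simp flip: right_diff_distrib)
qed

section \<open>Gcd and quotients in \<int>_m\<close>

lemma ZadicI:
  assumes "m \<noteq> 0" "\<And>j. \<bar>m\<bar> ^ j dvd c (Suc j) - c j"
  shows "(\<lambda>j. c j mod \<bar>m\<bar> ^ j) \<in> Zadic m"
proof -
  have "(c (Suc j) mod \<bar>m\<bar> ^ Suc j) mod \<bar>m\<bar> ^ j = c j mod \<bar>m\<bar> ^ j" for j
  proof -
    have "(c (Suc j) mod \<bar>m\<bar> ^ Suc j) mod \<bar>m\<bar> ^ j = c (Suc j) mod \<bar>m\<bar> ^ j"
      by (rule mod_mod_cancel) simp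
    also have "\<dots> = c j mod \<bar>m\<bar> ^ j" using assms(2)[of j] by (simp only: mod_eq_dvd_iff)
    finally show ?thesis .
  qed
  then show ?thesis using assms(1) by (simp add: Zadic_def)
qed

lemma Zadic_Suc: "\<xi> \<in> Zadic m \<Longrightarrow> \<bar>m\<bar> ^ j dvd \<xi> (Suc j) - \<xi> j"
proof -
  assume "\<xi> \<in> Zadic m"
  then have "\<xi> (Suc j) mod \<bar>m\<bar> ^ j = \<xi> j mod \<bar>m\<bar> ^ j"
    using Zadic_mod[of \<xi> m j "Suc j"] Zadic_mod[of \<xi> m j j] by simp
  then show ?thesis by (simp add: mod_eq_dvd_iff)
qed

lemma Zadic_mod_1: "\<xi> \<in> Zadic m \<Longrightarrow> \<xi> (Suc j) mod \<bar>m\<bar> = \<xi> 1 mod \<bar>m\<bar>"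
  using Zadic_mod[of \<xi> m 1 "Suc j"] Zadic_mod[of \<xi> m 1 1] by simp

lemma adic_smul_apply: "adic_smul m c x j = (c * x j) mod \<bar>m\<bar> ^ j"
  by (simp add: adic_smul_def adic_mul_def adic_of_int_def mod_mult_left_eq)

lemma adic_smul_closed:
  assumes "m \<noteq> 0" "x \<in> Zadic m" shows "adic_smul m c x \<in> Zadic m"
proof -
  have "(\<lambda>j. (c * x j) mod \<bar>m\<bar> ^ j) \<in> Zadic m"
    by (rule ZadicI[OF assms(1)]) (use Zadic_Suc[OF assms(2)] in \<open>simp flip: right_diff_distrib\<close>)
  then show ?thesis by (simp add: adic_smul_apply[abs_def])
qed

lemma dvd_Zadic:
  assumes "\<xi> \<in> Zadic m" "d dvd m" "d dvd \<xi> 1"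
  shows "d dvd \<xi> (Suc j)"
proof -
  have "d dvd \<xi> (Suc j) - \<xi> 1" using Zadic_mod_1[OF assms(1), of j] assms(2)
    by (metis dvd_abs_iff dvd_trans mod_eq_dvd_iff)
  then show ?thesis using assms(3) by (metis dvd_add diff_add_cancel)
qed

text \<open>Division by a divisor \<open>d\<close> of \<open>m\<close> costs at most one level, so
  level \<open>j\<close> of the quotient is computed from level \<open>j + 1\<close>.\<close>

lemma adic_quotient:
  assumes m: "m \<noteq> 0" and \<xi>: "\<xi> \<in> Zadic m" and d: "d dvd m" "d dvd \<xi> 1"
  defines "\<eta> \<equiv> \<lambda>j. (\<xi> (Suc j) div d) mod \<bar>m\<bar> ^ j"
  shows "\<eta> \<in> Zadic m \<and> adic_smul m d \<eta> = \<xi>"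
proof
  have d0: "d \<noteq> 0" using d m by auto
  note dd = dvd_Zadic[OF \<xi> d]
  have "\<bar>m\<bar> ^ j dvd \<xi> (Suc (Suc j)) div d - \<xi> (Suc j) div d" for j
  proof -
    have "d * (\<xi> (Suc (Suc j)) div d - \<xi> (Suc j) div d) = \<xi> (Suc (Suc j)) - \<xi> (Suc j)"
      using dd by (simp add: right_diff_distrib)
    moreover have "\<bar>m\<bar> ^ Suc j dvd \<xi> (Suc (Suc j)) - \<xi> (Suc j)" by (rule Zadic_Suc[OF \<xi>])
    moreover have "d * \<bar>m\<bar> ^ j dvd \<bar>m\<bar> ^ Suc j" using d(1) by (simp add: mult_dvd_mono)
    ultimately have "d * \<bar>m\<bar> ^ j dvd d * (\<xi> (Suc (Suc j)) div d - \<xi> (Suc j) div d)"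
      by (metis dvd_trans)
    then show ?thesis using d0 by simp
  qed
  then show "\<eta> \<in> Zadic m" unfolding \<eta>_def by (rule ZadicI[OF m])
  have "adic_smul m d \<eta> j = \<xi> j" for j
    using dd[of j] Zadic_mod[OF \<xi>, of j "Suc j"]
    by (simp add: adic_smul_apply \<eta>_def mod_mult_right_eq)
  then show "adic_smul m d \<eta> = \<xi>" by blast
qed

lemma adic_div_eq:
  assumes m: "m \<noteq> 0" and \<xi>: "\<xi> \<in> Zadic m" and d: "d dvd m" "d dvd \<xi> 1"
  shows "adic_div m \<xi> d = (\<lambda>j. (\<xi> (Suc j) div d) mod \<bar>m\<bar> ^ j)"
  unfolding adic_div_def
proof (rule the_equality)
  show "(\<lambda>j. (\<xi> (Suc j) div d) mod \<bar>m\<bar> ^ j) \<in> Zadic m \<and>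
      adic_smul m d (\<lambda>j. (\<xi> (Suc j) div d) mod \<bar>m\<bar> ^ j) = \<xi>"
    by (rule adic_quotient[OF assms])
next
  fix \<eta> assume "\<eta> \<in> Zadic m \<and> adic_smul m d \<eta> = \<xi>"
  then have \<eta>: "\<eta> \<in> Zadic m" "adic_smul m d \<eta> = \<xi>" by auto
  have d0: "d \<noteq> 0" using d m by auto
  have "\<eta> j = (\<xi> (Suc j) div d) mod \<bar>m\<bar> ^ j" for j
  proof -
    have "\<xi> (Suc j) mod \<bar>m\<bar> ^ Suc j = d * \<eta> (Suc j) mod \<bar>m\<bar> ^ Suc j"
      unfolding \<eta>(2)[symmetric] adic_smul_apply by simp
    then have "\<bar>m\<bar> ^ Suc j dvd \<xi> (Suc j) - d * \<eta> (Suc j)" by (simp only: mod_eq_dvd_iff)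
    moreover have "\<xi> (Suc j) - d * \<eta> (Suc j) = d * (\<xi> (Suc j) div d - \<eta> (Suc j))"
      using dvd_Zadic[OF \<xi> d, of j] by (simp add: right_diff_distrib)
    moreover have "d * \<bar>m\<bar> ^ j dvd \<bar>m\<bar> ^ Suc j" using d(1) by (simp add: mult_dvd_mono)
    ultimately have "d * \<bar>m\<bar> ^ j dvd d * (\<xi> (Suc j) div d - \<eta> (Suc j))" by (metis dvd_trans)
    then have "\<bar>m\<bar> ^ j dvd \<xi> (Suc j) div d - \<eta> (Suc j)" using d0 by simp
    then have "(\<xi> (Suc j) div d) mod \<bar>m\<bar> ^ j = \<eta> (Suc j) mod \<bar>m\<bar> ^ j" by (simp only: mod_eq_dvd_iff)
    then show ?thesis using Zadic_mod[OF \<eta>(1), of j "Suc j"] by simp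
  qed
  then show "\<eta> = (\<lambda>j. (\<xi> (Suc j) div d) mod \<bar>m\<bar> ^ j)" by blast
qed

text \<open>By \<open>adic_quotient\<close>, divisibility by a divisor of \<open>m\<close> is
  decided at level 1. There Bezout's identity applies, and comparing multiples of the unit shows
  that the generator is unique.\<close>

lemma adic_gcd_eq:
  assumes m: "m \<noteq> 0" and \<xi>: "\<xi> \<in> Zadic m"
  shows "adic_gcd m m \<xi> = gcd m (\<xi> 1)"
proof -
  let ?I = "{adic_add m (adic_smul m m x) (adic_mul m \<xi> y) | x y. x \<in> Zadic m \<and> y \<in> Zadic m}"
  let ?J = "\<lambda>d. {adic_smul m d z | z. z \<in> Zadic m}"
  define d where "d = gcd m (\<xi> 1)"
  have d: "d > 0" "d dvd m" "d dvd \<xi> 1" using m by (simp_all add: d_def)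
  have add: "adic_add m (adic_smul m c x) (adic_mul m \<xi> y) j = (c * x j + \<xi> j * y j) mod \<bar>m\<bar> ^ j" for c x y j
    by (simp add: adic_add_def adic_smul_apply adic_mul_def mod_add_eq)
  have IJ: "?I = ?J d"
  proof (intro equalityI subsetI)
    fix e assume "e \<in> ?I"
    then obtain x y where xy: "x \<in> Zadic m" "y \<in> Zadic m"
      and e: "e = adic_add m (adic_smul m m x) (adic_mul m \<xi> y)" by blast
    have e': "e = (\<lambda>j. (m * x j + \<xi> j * y j) mod \<bar>m\<bar> ^ j)" unfolding e using add by blast
    have "e \<in> Zadic m" unfolding e'
    proof (rule ZadicI[OF m])
      fix j
      have "m * x (Suc j) + \<xi> (Suc j) * y (Suc j) - (m * x j + \<xi> j * y j) =
        m * (x (Suc j) - x j) + (\<xi> (Suc j) * (y (Suc j) - y j) + y j * (\<xi> (Suc j) - \<xi> j))"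
        by (simp add: algebra_simps)
      then show "\<bar>m\<bar> ^ j dvd m * x (Suc j) + \<xi> (Suc j) * y (Suc j) - (m * x j + \<xi> j * y j)"
        using Zadic_Suc[OF xy(1), of j] Zadic_Suc[OF xy(2), of j] Zadic_Suc[OF \<xi>, of j]
        by (simp only: dvd_add dvd_mult)
    qed
    moreover have "d dvd e 1" unfolding e' using d by (simp add: dvd_mod)
    ultimately have "\<exists>z. z \<in> Zadic m \<and> adic_smul m d z = e"
      using adic_quotient[OF m _ d(2)] by (intro exI)
    then show "e \<in> ?J d" by auto
  next
    fix e assume "e \<in> ?J d"
    then obtain z where z: "z \<in> Zadic m" "e = adic_smul m d z" by blast
    obtain u v where uv: "u * m + v * \<xi> 1 = d" using bezout_int[of m "\<xi> 1"] by (auto simp: d_def)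
    define y where "y = adic_smul m v z"
    have y: "y \<in> Zadic m" unfolding y_def by (rule adic_smul_closed[OF m z(1)])
    \<comment> \<open>What is missing from \<open>d * z\<close> after subtracting \<xi> times
      \<open>y\<close>; by Bezout it is divisible by \<open>m\<close> at level 1, so it is
      \<open>m\<close> times some \<open>x\<close>.\<close>
    define c where "c j = d * z j - \<xi> j * (v * z j)" for j
    define e' where "e' = (\<lambda>j. c j mod \<bar>m\<bar> ^ j)"
    have "e' \<in> Zadic m" unfolding e'_def
    proof (rule ZadicI[OF m])
      fix j
      have "c (Suc j) - c j = (d - v * \<xi> (Suc j)) * (z (Suc j) - z j) + (- (v * z j)) * (\<xi> (Suc j) - \<xi> j)"
        by (simp add: c_def algebra_simps)
      then show "\<bar>m\<bar> ^ j dvd c (Suc j) - c j"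
        using Zadic_Suc[OF z(1), of j] Zadic_Suc[OF \<xi>, of j] by (simp only: dvd_add dvd_mult)
    qed
    moreover have "m dvd e' 1"
    proof -
      have "c 1 = m * (u * z 1)" unfolding c_def uv[symmetric] by (simp add: algebra_simps)
      then show ?thesis by (simp add: e'_def dvd_mod)
    qed
    ultimately obtain x where x: "x \<in> Zadic m" "adic_smul m m x = e'" using adic_quotient[OF m \<open>e' \<in> Zadic m\<close> dvd_refl] by auto
    have "e j = adic_add m (adic_smul m m x) (adic_mul m \<xi> y) j" for j
    proof -
      have "adic_add m (adic_smul m m x) (adic_mul m \<xi> y) j = (c j + \<xi> j * (v * z j)) mod \<bar>m\<bar> ^ j"
        unfolding x(2) by (simp add: adic_add_def adic_mul_def e'_def y_def adic_smul_apply mod_mult_right_eq mod_add_eq)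
      then show ?thesis by (simp add: c_def z(2) adic_smul_apply)
    qed
    then have "e = adic_add m (adic_smul m m x) (adic_mul m \<xi> y)" by blast
    then show "e \<in> ?I" using x(1) y by blast
  qed
  have J: "d1 dvd d2" if "?J d1 = ?J d2" "d1 dvd m" "d2 dvd m" for d1 d2
  proof -
    have one: "(\<lambda>j. 1 mod \<bar>m\<bar> ^ j) \<in> Zadic m" by (rule ZadicI[OF m]) simp
    then have "adic_smul m d2 (\<lambda>j. 1 mod \<bar>m\<bar> ^ j) \<in> ?J d1" unfolding that(1) by blast
    then obtain z where "adic_smul m d2 (\<lambda>j. 1 mod \<bar>m\<bar> ^ j) = adic_smul m d1 z" by blast
    then have "adic_smul m d2 (\<lambda>j. 1 mod \<bar>m\<bar> ^ j) 1 = adic_smul m d1 z 1" by simp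
    then have "d2 mod \<bar>m\<bar> = (d1 * z 1) mod \<bar>m\<bar>" by (simp add: adic_smul_apply mod_mult_right_eq)
    moreover have "d1 dvd (d1 * z 1) mod \<bar>m\<bar>" using that(2) by (simp add: dvd_mod)
    ultimately show ?thesis using that(2) by (metis dvd_abs_iff dvd_mod_iff)
  qed
  show ?thesis unfolding adic_gcd_def d_def[symmetric]
  proof (rule the_equality)
    fix d' assume d': "d' > 0 \<and> d' dvd m \<and> ?I = ?J d'"
    then have "?J d' = ?J d" using IJ by simp
    then have "d' dvd d" "d dvd d'" using J[of d' d] J[of d d'] d' d(2) by auto
    then show "d' = d" using d' d(1) zdvd_antisym_nonneg[of d' d] by simp
  qed (use d IJ in blast)
qed

lemma adic_proj_div_eq_iff:
  assumes m: "m \<noteq> 0" and \<xi>: "\<xi> \<in> Zadic m" and \<zeta>: "\<zeta> \<in> Zadic m"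
    and d: "d dvd m" "d dvd \<xi> 1" "d dvd \<zeta> 1"
  shows "adic_proj (m div d) (adic_div m \<xi> d) = adic_proj (m div d) (adic_div m \<zeta> d) \<longleftrightarrow>
    (\<forall>j. d * \<bar>m div d\<bar> ^ j dvd \<xi> (Suc j) - \<zeta> (Suc j))"
proof -
  have d0: "d \<noteq> 0" using d m by auto
  have "\<bar>m div d\<bar> ^ j dvd \<bar>m\<bar> ^ j" for j
    using d(1) by (intro dvd_power_same) (simp add: div_dvd_iff_mult[OF d0 d(1)])
  then have "adic_proj (m div d) (adic_div m x d) = (\<lambda>j. (x (Suc j) div d) mod \<bar>m div d\<bar> ^ j)"
    if "x \<in> Zadic m" "d dvd x 1" for x
    unfolding adic_div_eq[OF m that(1) d(1) that(2)] adic_proj_def by (simp add: mod_mod_cancel)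
  then have "adic_proj (m div d) (adic_div m \<xi> d) = adic_proj (m div d) (adic_div m \<zeta> d) \<longleftrightarrow>
    (\<forall>j. \<bar>m div d\<bar> ^ j dvd \<xi> (Suc j) div d - \<zeta> (Suc j) div d)"
    using \<xi> \<zeta> d by (simp add: fun_eq_iff mod_eq_dvd_iff)
  moreover have "\<bar>m div d\<bar> ^ j dvd \<xi> (Suc j) div d - \<zeta> (Suc j) div d \<longleftrightarrow>
      d * \<bar>m div d\<bar> ^ j dvd \<xi> (Suc j) - \<zeta> (Suc j)" for j
  proof -
    have "d * (\<xi> (Suc j) div d - \<zeta> (Suc j) div d) = \<xi> (Suc j) - \<zeta> (Suc j)"
      using dvd_Zadic[OF \<xi> d(1,2), of j] dvd_Zadic[OF \<zeta> d(1,3), of j] by (simp add: right_diff_distrib)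
    then show ?thesis using d0 by (metis dvd_mult_cancel_left)
  qed
  ultimately show ?thesis by simp
qed

lemma digits_eq:
  assumes m: "m \<noteq> 0" and \<xi>: "\<xi> \<in> Zadic m" and "i \<le> n"
  shows "digits m \<xi> i = rr \<bar>m\<bar> (sgn m * \<xi> n) i"
proof -
  have "\<xi> n mod \<bar>m\<bar> ^ i = \<xi> i mod \<bar>m\<bar> ^ i"
    using Zadic_mod[OF \<xi>, of i n] Zadic_mod[OF \<xi>, of i i] assms(3) by simp
  then have "\<bar>m\<bar> ^ i dvd sgn m * (\<xi> n - \<xi> i)" by (simp add: mod_eq_dvd_iff)
  then show ?thesis
    using rr_cong[of "\<bar>m\<bar>" 1 "\<bar>m\<bar>" "sgn m * \<xi> i" i "sgn m * \<xi> n" i] m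
    by (simp add: digits_def right_diff_distrib)
qed

text \<open>With the signs moved to \<xi> and \<xi>', the condition becomes a congruence modulo
  \<open>d\<close> times all powers of \<open>\<bar>m\<bar> div d\<close>. Such congruences are
  equivalent to equality of the digits: \<open>rr_cong\<close> is one direction,
  \<open>rr_inj\<close> the other.\<close>

lemma adic_condition_iff_digits:
  fixes m m' :: int
  assumes m: "m \<noteq> 0" and m': "m' \<noteq> 0" and \<xi>: "\<xi> \<in> Zadic m" and \<xi>': "\<xi>' \<in> Zadic m'"
  shows "(\<exists>\<epsilon> \<in> {1, -1 :: int}. \<exists>d :: int. d > 0 \<and> m = \<epsilon> * m' \<and>
       d = adic_gcd m m \<xi> \<and> d = adic_gcd m' m' \<xi>' \<and>
       adic_proj (m div d) (adic_div m \<xi> d) =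
       adic_proj (m div d) (adic_div m (adic_smul m \<epsilon> \<xi>') d)) \<longleftrightarrow>
    \<bar>m\<bar> = \<bar>m'\<bar> \<and> (\<forall>i. digits m \<xi> i = digits m' \<xi>' i)"
    (is "?L \<longleftrightarrow> ?R")
proof -
  have key: "adic_proj (m div d) (adic_div m \<xi> d) = adic_proj (m div d) (adic_div m (adic_smul m \<epsilon> \<xi>') d) \<longleftrightarrow>
      (\<forall>j. d * (\<bar>m\<bar> div d) ^ j dvd sgn m * \<xi> (Suc j) - sgn m' * \<xi>' (Suc j))"
    and quot: "\<bar>m\<bar> = d * (\<bar>m\<bar> div d)" "\<bar>m\<bar> div d > 0"
    if \<epsilon>: "\<epsilon> \<in> {1, - 1}" "m = \<epsilon> * m'" and d: "d > 0" "d dvd m" "d dvd \<xi> 1" "d dvd \<xi>' 1" for \<epsilon> d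
  proof -
    have am: "\<bar>m\<bar> = \<bar>m'\<bar>" using \<epsilon> by auto
    then have Z: "Zadic m = Zadic m'" by (simp add: Zadic_def)
    define \<zeta> where "\<zeta> = adic_smul m \<epsilon> \<xi>'"
    have \<zeta>: "\<zeta> \<in> Zadic m" unfolding \<zeta>_def using adic_smul_closed[OF m] \<xi>' Z by simp
    have "d dvd (\<epsilon> * \<xi>' 1) mod \<bar>m\<bar>" using d by (simp add: dvd_mod)
    then have d\<zeta>: "d dvd \<zeta> 1" by (simp add: \<zeta>_def adic_smul_apply)
    show q: "\<bar>m\<bar> = d * (\<bar>m\<bar> div d)" using d(2) by simp
    then show "\<bar>m\<bar> div d > 0" using m d(1) by (metis mult_pos_pos not_less_iff_gr_or_eq zero_less_abs_iff zero_less_mult_iff)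
    have K: "\<bar>m div d\<bar> = \<bar>m\<bar> div d" using d(1,2) by (metis abs_div abs_of_pos)
    have "d * (\<bar>m\<bar> div d) ^ j dvd \<xi> (Suc j) - \<zeta> (Suc j) \<longleftrightarrow>
       d * (\<bar>m\<bar> div d) ^ j dvd sgn m * \<xi> (Suc j) - sgn m' * \<xi>' (Suc j)" for j
    proof -
      let ?D = "d * (\<bar>m\<bar> div d) ^ j"
      have "(\<bar>m\<bar> div d) ^ j dvd \<bar>m\<bar> ^ j" using d(1,2) by (intro dvd_power_same) (metis dvd_triv_right q)
      then have "?D dvd \<bar>m\<bar> ^ Suc j" using d(2) by (simp add: mult_dvd_mono)
      moreover have "\<bar>m\<bar> ^ Suc j dvd \<zeta> (Suc j) - \<epsilon> * \<xi>' (Suc j)"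
        unfolding \<zeta>_def adic_smul_apply by (simp only: mod_eq_dvd_iff[symmetric] mod_mod_trivial)
      ultimately have D: "?D dvd \<zeta> (Suc j) - \<epsilon> * \<xi>' (Suc j)" by (rule dvd_trans)
      have "?D dvd \<xi> (Suc j) - \<zeta> (Suc j) \<longleftrightarrow> ?D dvd \<xi> (Suc j) - \<epsilon> * \<xi>' (Suc j)"
        using dvd_add_left_iff[OF D, of "\<xi> (Suc j) - \<zeta> (Suc j)"] by simp
      also have "\<dots> \<longleftrightarrow> ?D dvd sgn m * (\<xi> (Suc j) - \<epsilon> * \<xi>' (Suc j))"
        using m by (cases "m > 0") (simp_all add: dvd_diff_commute)
      also have "sgn m * (\<xi> (Suc j) - \<epsilon> * \<xi>' (Suc j)) = sgn m * \<xi> (Suc j) - sgn m' * \<xi>' (Suc j)"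
        using \<epsilon> by (auto simp: sgn_mult right_diff_distrib)
      finally show ?thesis .
    qed
    then show "adic_proj (m div d) (adic_div m \<xi> d) = adic_proj (m div d) (adic_div m (adic_smul m \<epsilon> \<xi>') d) \<longleftrightarrow>
      (\<forall>j. d * (\<bar>m\<bar> div d) ^ j dvd sgn m * \<xi> (Suc j) - sgn m' * \<xi>' (Suc j))"
      using adic_proj_div_eq_iff[OF m \<xi> \<zeta> d(2,3) d\<zeta>] unfolding K \<zeta>_def by simp
  qed
  show ?thesis
  proof
    assume ?L
    then obtain \<epsilon> d where \<epsilon>: "\<epsilon> \<in> {1, - 1}" "m = \<epsilon> * m'" and d: "d > 0" "d = gcd m (\<xi> 1)" "d = gcd m' (\<xi>' 1)"
      and p: "adic_proj (m div d) (adic_div m \<xi> d) = adic_proj (m div d) (adic_div m (adic_smul m \<epsilon> \<xi>') d)"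
      using adic_gcd_eq[OF m \<xi>] adic_gcd_eq[OF m' \<xi>'] by metis
    have am: "\<bar>m\<bar> = \<bar>m'\<bar>" using \<epsilon> by auto
    have dd: "d dvd m" "d dvd \<xi> 1" "d dvd \<xi>' 1" "d dvd m'"
      using d(2,3) by (metis gcd_dvd1, metis gcd_dvd2, metis gcd_dvd2, metis gcd_dvd1)
    note k = key[OF \<epsilon> d(1) dd(1-3), THEN iffD1, OF p] and q = quot[OF \<epsilon> d(1) dd(1-3)]
    have "digits m \<xi> i = digits m' \<xi>' i" for i
    proof -
      have "d dvd sgn m' * \<xi>' (Suc i)" using dvd_Zadic[OF \<xi>' dd(4,3)] by simp
      then have "rr \<bar>m\<bar> (sgn m * \<xi> (Suc i)) i = rr \<bar>m\<bar> (sgn m' * \<xi>' (Suc i)) i"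
        using rr_cong[OF q(1) d(1) q(2) _ k[rule_format, of i] order_refl] by blast
      then show ?thesis using digits_eq[OF m \<xi>, of i "Suc i"] digits_eq[OF m' \<xi>', of i "Suc i"] am by simp
    qed
    then show ?R using am by blast
  next
    assume R: ?R
    define \<epsilon> where "\<epsilon> = sgn m * sgn m'"
    have \<epsilon>: "\<epsilon> \<in> {1, - 1}" "m = \<epsilon> * m'"
      using m m' R by (auto simp: \<epsilon>_def sgn_if abs_if split: if_splits)
    have rr: "rr \<bar>m\<bar> (sgn m * \<xi> n) i = rr \<bar>m\<bar> (sgn m' * \<xi>' n) i" if "i \<le> n" for i n
      using digits_eq[OF m \<xi> that] digits_eq[OF m' \<xi>' that] R by simp
    define d where "d = gcd m (\<xi> 1)"
    \<comment> \<open>The digits of index 1 determine \<xi> and \<xi>' modulo \<open>m\<close> up to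
      sign, hence both gcds.\<close>
    have "(sgn m * \<xi> 1) mod \<bar>m\<bar> = (sgn m' * \<xi>' 1) mod \<bar>m\<bar>" using rr[of 1 1] by simp
    then have "gcd \<bar>m\<bar> (sgn m * \<xi> 1) = gcd \<bar>m\<bar> (sgn m' * \<xi>' 1)" using m by (metis abs_eq_0_iff gcd_mod_right)
    moreover have "gcd \<bar>n\<bar> (sgn n * a) = gcd n a" if "n \<noteq> 0" for n a :: int
      using that by (simp add: sgn_if)
    from this[OF m, of "\<xi> 1"] this[OF m', of "\<xi>' 1"]
    have "gcd \<bar>m\<bar> (sgn m * \<xi> 1) = gcd m (\<xi> 1)" "gcd \<bar>m\<bar> (sgn m' * \<xi>' 1) = gcd m' (\<xi>' 1)"
      using R by simp_all
    ultimately have d: "d > 0" "d = gcd m (\<xi> 1)" "d = gcd m' (\<xi>' 1)" using m m' by (simp_all add: d_def)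
    have dd: "d dvd m" "d dvd \<xi> 1" "d dvd \<xi>' 1" "d dvd m'"
      using d(2,3) by (metis gcd_dvd1, metis gcd_dvd2, metis gcd_dvd2, metis gcd_dvd1)
    note q = quot[OF \<epsilon> d(1) dd(1-3)]
    have "d * (\<bar>m\<bar> div d) ^ j dvd sgn m * \<xi> (Suc j) - sgn m' * \<xi>' (Suc j)" for j
    proof (rule rr_inj[OF q(1) d(1) q(2)])
      show "sgn m * \<xi> (Suc j) = d * (sgn m * \<xi> (Suc j) div d)"
        using dvd_Zadic[OF \<xi> dd(1,2)] by simp
      show "sgn m' * \<xi>' (Suc j) = d * (sgn m' * \<xi>' (Suc j) div d)"
        using dvd_Zadic[OF \<xi>' dd(4,3)] by simp
      show "coprime (sgn m * \<xi> (Suc j) div d) (\<bar>m\<bar> div d)"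
      proof -
        have "gcd \<bar>m\<bar> (\<xi> (Suc j)) = gcd \<bar>m\<bar> (\<xi> 1)"
          using Zadic_mod_1[OF \<xi>, of j] m by (metis abs_eq_0_iff gcd_mod_right)
        then have "gcd (sgn m * \<xi> (Suc j)) \<bar>m\<bar> = d"
          using m d(2) by (auto simp: sgn_if gcd.commute)
        then show ?thesis using div_gcd_coprime[of "sgn m * \<xi> (Suc j)" "\<bar>m\<bar>"] m by simp
      qed
      show "rr \<bar>m\<bar> (sgn m * \<xi> (Suc j)) i = rr \<bar>m\<bar> (sgn m' * \<xi>' (Suc j)) i" if "i \<le> j" for i
        using rr[of i "Suc j"] that by simp
    qed
    then have "adic_proj (m div d) (adic_div m \<xi> d) = adic_proj (m div d) (adic_div m (adic_smul m \<epsilon> \<xi>') d)"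
      using key[OF \<epsilon> d(1) dd(1-3)] by blast
    then show ?L using \<epsilon> d adic_gcd_eq[OF m \<xi>] adic_gcd_eq[OF m' \<xi>'] by metis
  qed
qed

theorem theoremC:
  fixes m m' :: int and \<xi> \<xi>' :: "nat \<Rightarrow> int"
  assumes "m \<noteq> 0" and "m' \<noteq> 0" and "\<xi> \<in> Zadic m" and "\<xi>' \<in> Zadic m'"
  shows "(FG Mod BSbar m \<xi>) \<cong> (FG Mod BSbar m' \<xi>') \<longleftrightarrow>
    (\<exists>\<epsilon> \<in> {1, -1 :: int}. \<exists>d :: int. d > 0 \<and> m = \<epsilon> * m' \<and>
       d = adic_gcd m m \<xi> \<and> d = adic_gcd m' m' \<xi>' \<and>
       adic_proj (m div d) (adic_div m \<xi> d) =
       adic_proj (m div d) (adic_div m (adic_smul m \<epsilon> \<xi>') d))"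
proof -
  interpret A: bs_limit "\<bar>m\<bar>" "digits m \<xi>" by (rule bs_limit_digits[OF assms(1,3)])
  interpret B: bs_limit "\<bar>m'\<bar>" "digits m' \<xi>'" by (rule bs_limit_digits[OF assms(2,4)])
  have "(FG Mod BSbar m \<xi>) \<cong> (FG Mod BSbar m' \<xi>') \<longleftrightarrow>
      \<bar>m\<bar> = \<bar>m'\<bar> \<and> (\<forall>i. digits m \<xi> i = digits m' \<xi>' i)"
  proof
    assume iso: "FG Mod BSbar m \<xi> \<cong> FG Mod BSbar m' \<xi>'"
    have 1: "FG Mod BSbar m \<xi> \<cong> act_group A.T"
      unfolding BSbar_eq[OF assms(1,3)] by (rule A.FG_Mod_act_kernel)
    have 2: "FG Mod BSbar m' \<xi>' \<cong> act_group B.T"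
      unfolding BSbar_eq[OF assms(2,4)] by (rule B.FG_Mod_act_kernel)
    have "group (FG Mod BSbar m \<xi>)"
      unfolding BSbar_eq[OF assms(1,3)] by (rule normal.factorgroup_is_group[OF A.normal_act_kernel])
    then have "act_group A.T \<cong> act_group B.T"
      using group.iso_sym[OF _ 1] iso 2 by (meson iso_trans)
    then obtain f where f: "f \<in> iso (act_group A.T) (act_group B.T)" by (auto simp: is_iso_def)
    interpret bs_iso "\<bar>m\<bar>" "digits m \<xi>" "\<bar>m'\<bar>" "digits m' \<xi>'" f
      by unfold_locales (use f in \<open>auto simp: iso_def hom_def\<close>)
    show "\<bar>m\<bar> = \<bar>m'\<bar> \<and> (\<forall>i. digits m \<xi> i = digits m' \<xi>' i)" by (rule iso_imp_eq)
  next
    assume "\<bar>m\<bar> = \<bar>m'\<bar> \<and> (\<forall>i. digits m \<xi> i = digits m' \<xi>' i)"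
    then have "\<bar>m\<bar> = \<bar>m'\<bar>" "digits m \<xi> = digits m' \<xi>'" by auto
    \<comment> \<open>Equal digits give not only isomorphic groups but the same normal subgroup of
      \<open>FG\<close>.\<close>
    then have "BSbar m \<xi> = BSbar m' \<xi>'"
      unfolding BSbar_eq[OF assms(1,3)] BSbar_eq[OF assms(2,4)] by simp
    then show "FG Mod BSbar m \<xi> \<cong> FG Mod BSbar m' \<xi>'" by (simp add: iso_refl)
  qed
  then show ?thesis using adic_condition_iff_digits[OF assms] by (rule trans[OF _ sym])
qed

end
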